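(* Let $c_1,c_2$ be the constant marginal costs of two firms, let $p_a>\max(c_1,c_2)$ and $p_a<p_b$, and suppose that the equilibrium supply functions $s_1,s_2$ are continuously differentiable on $[p_a,p_b]$, so that they satisfy the first order conditions $$s_{-i}'(p)-\frac{s_i(p)}{p-c_i}=D'(p),\qquad i=1,2,\ p\in[p_a,p_b].$$ Place $N$ price levels $\{p_k\}_{k=1}^N$ uniformly in $[p_a,p_b]$ and choose knots $\{\tau_t\}_{t=1}^K$. Let $\hat s_1,\hat s_2$ be piecewise cubic splines with these knots that solve the least squares problem of minimizing $$\sum_{k=1}^N\sum_{i=1,2}\left(\hat s_{-i}'(p_k)-\frac{\hat s_i(p_k)}{p_k-c_i}-D'(p_k)\right)^2$$ over all pairs of piecewise cubic splines with knots $\{\tau_t\}$. Then, as the length $|\tau|$ of the largest knot interval tends to $0$ and $N\to\infty$, the system of first order conditions will be satisfied by $\hat s_1$ and $\hat s_2$, in the sense that the error functions $$\hat s_{-i}'(p)-\frac{\hat s_i(p)}{p-c_i}-D'(p),\qquad i=1,2,$$ converge uniformly to $0$ on $[p_a,p_b]$.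
   Context: The index $-i$ denotes the other firm: $-1=2$ and $-2=1$. The function $D$ (the deterministic part of the market demand $D(p)+\varepsilon$, where $\varepsilon$ is a random shock) is strictly decreasing, continuously differentiable and concave. The knots form a finite increasing sequence $p_a=\tau_1<\tau_2<\dots<\tau_K=p_b$, and $|\tau|=\max_t(\tau_{t+1}-\tau_t)$. A piecewise cubic spline with knots $\{\tau_t\}$ is a twice continuously differentiable function on $[p_a,p_b]$ whose restriction to each interval $[\tau_t,\tau_{t+1}]$ is a polynomial of degree at most $3$. "Uniformly placed" means equally spaced in $[p_a,p_b]$. The splines $\hat s_1,\hat s_2$ depend on $N$ and on the knots. *)

theory Defs
  imports "HOL-Analysis.Analysis" "HOL-Computational_Algebra.Polynomial"
begin

datatype firm = Firm1 | Firm2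

fun rival :: "firm \<Rightarrow> firm" where
  "rival Firm1 = Firm2"
| "rival Firm2 = Firm1"

text \<open>
  Derivatives are taken relative to the price interval, so they are one-sided at its two endpoints.
\<close>

abbreviation deriv_on :: "real set \<Rightarrow> (real \<Rightarrow> real) \<Rightarrow> real \<Rightarrow> real" where
  "deriv_on S f p \<equiv> vector_derivative f (at p within S)"

definition C1_on :: "real set \<Rightarrow> (real \<Rightarrow> real) \<Rightarrow> bool" where
  "C1_on S f \<longleftrightarrow> f differentiable_on S \<and> continuous_on S (deriv_on S f)"

definition C2_on :: "real set \<Rightarrow> (real \<Rightarrow> real) \<Rightarrow> bool" where
  "C2_on S f \<longleftrightarrow> C1_on S f \<and> C1_on S (deriv_on S f)"

text \<open>The knots are \<open>\<tau> 1, \<dots>, \<tau> K\<close>; other values of \<open>\<tau>\<close> play no role.\<close>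

definition knots :: "real \<Rightarrow> real \<Rightarrow> nat \<Rightarrow> (nat \<Rightarrow> real) \<Rightarrow> bool" where
  "knots a b K \<tau> \<longleftrightarrow> 2 \<le> K \<and> strict_mono_on {1..K} \<tau> \<and> \<tau> 1 = a \<and> \<tau> K = b"

definition mesh :: "nat \<Rightarrow> (nat \<Rightarrow> real) \<Rightarrow> real" where
  "mesh K \<tau> = Max ((\<lambda>t. \<tau> (t + 1) - \<tau> t) ` {1..<K})"

definition cubic_spline :: "nat \<Rightarrow> (nat \<Rightarrow> real) \<Rightarrow> (real \<Rightarrow> real) \<Rightarrow> bool" where
  "cubic_spline K \<tau> s \<longleftrightarrow>
     C2_on {\<tau> 1..\<tau> K} s \<and>
     (\<forall>t\<in>{1..<K}. \<exists>q :: real poly. degree q \<le> 3 \<and> (\<forall>x\<in>{\<tau> t..\<tau> (t + 1)}. s x = poly q x))"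

text \<open>The \<open>N \<ge> 2\<close> equally spaced price levels include both endpoints of the interval.\<close>

definition price :: "real \<Rightarrow> real \<Rightarrow> nat \<Rightarrow> nat \<Rightarrow> real" where
  "price a b N k = a + (real k - 1) / (real N - 1) * (b - a)"

definition foc_error ::
  "(firm \<Rightarrow> real) \<Rightarrow> (real \<Rightarrow> real) \<Rightarrow> real \<Rightarrow> real \<Rightarrow> (firm \<Rightarrow> real \<Rightarrow> real) \<Rightarrow> firm \<Rightarrow> real \<Rightarrow> real" where
  "foc_error c D a b s i p =
     deriv_on {a..b} (s (rival i)) p - s i p / (p - c i) - deriv_on {a..b} D p"

definition lsq_objective ::
  "(firm \<Rightarrow> real) \<Rightarrow> (real \<Rightarrow> real) \<Rightarrow> real \<Rightarrow> real \<Rightarrow> nat \<Rightarrow> (firm \<Rightarrow> real \<Rightarrow> real) \<Rightarrow> real" where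
  "lsq_objective c D a b N s =
     (\<Sum>k=1..N. \<Sum>i\<in>{Firm1, Firm2}. (foc_error c D a b s i (price a b N k))\<^sup>2)"

definition lsq_solution ::
  "(firm \<Rightarrow> real) \<Rightarrow> (real \<Rightarrow> real) \<Rightarrow> real \<Rightarrow> real \<Rightarrow> nat \<Rightarrow> (nat \<Rightarrow> real) \<Rightarrow> nat \<Rightarrow>
   (firm \<Rightarrow> real \<Rightarrow> real) \<Rightarrow> bool" where
  "lsq_solution c D a b K \<tau> N s \<longleftrightarrow>
     is_arg_min (lsq_objective c D a b N) (\<lambda>r. \<forall>i. cubic_spline K \<tau> (r i)) s"

end

theory Submission
  imports Defs
begin

text \<open>
  Write \<open>H\<close> for the mesh size, \<open>e\<close> for the error functions of the least squares solution and \<open>T\<close> for the linear operator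
  \<open>foc_op\<close> of the first order conditions, so that \<open>e = T (s_hat - s)\<close>.

  Since \<open>D\<close> is concave, \<open>s'\<close> has bounded variation, and comparison with a spline whose derivative is a local
  quasi-interpolant of \<open>s'\<close> shows that the \<open>L\<^sup>2\<close> norm of \<open>e\<close> is \<open>o(H\<^sup>1\<^sup>/\<^sup>2)\<close>.  For fixed knots the sampled norms
  agree with the \<open>L\<^sup>2\<close> norm up to a factor as \<open>N\<close> grows.

  The kernel of \<open>T\<close> is spanned by \<open>(p - c\<^sub>1, p - c\<^sub>2)\<close>, which is itself a spline, and one more solution whose derivatives of order four
  never vanish.  Fourth differences of a cubic on the longest interval therefore show that the component of
  \<open>s_hat - s\<close> along the latter is \<open>o(H\<^sup>-\<^sup>3)\<close>, and since quadratic splines approximate smooth functions to order \<open>H\<^sup>3\<close>,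
  each error function is uniformly close to a quadratic spline \<open>\<rho>\<close>.

  The normal equations, tested with antiderivatives of B-splines, make the B-spline moments of \<open>\<rho>\<close> relatively small.  The
  Gram matrix of the quadratic B-splines is diagonally dominant after a fixed rescaling, for every knot sequence,
  so \<open>\<rho>\<close> is uniformly small.
\<close>

section \<open>Diagonal dominance: the polynomial inequality\<close>

text \<open>The knots are arbitrary: adjacent intervals may have any ratio, so no inverse estimate
  with a constant independent of the knots leads from the \<open>L\<^sup>2\<close> norm of a spline
  to its maximum. A small least squares value is therefore not enough, and the last step works with
  moments against B-splines, each measured relative to the length of its support. A test function
  whose derivative is a B-spline is bounded by that length, so the moment of one error function is
  at most the length times a constant and the \<open>L\<^sup>1\<close> norm of the other.

  The powers of \<open>H\<close> match exactly. A squared error of order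
  \<open>\<epsilon>\<^sup>2 * H\<close> gives an integral of order \<open>\<epsilon> * H\<close>
  over an interval of length \<open>H\<close>, so the fourth difference there is small compared with
  \<open>H\<close>. Dividing by the order \<open>H ^ 4\<close> of the kernel solution costs
  \<open>H ^ 3\<close>, which third order approximation of that solution wins back. Only the product
  of its coefficient with \<open>H ^ 3\<close> is ever bounded.

  All constants are fixed before the knots; only the threshold for \<open>N\<close> depends on the
  knots.\<close>

definition coupling :: "real \<Rightarrow> real \<Rightarrow> real \<Rightarrow> real" where
  "coupling u v m =
     u\<^sup>2 * (1 - v) * ((1 + 3/5 * (1 - m) * u) * ((1 - u) / 5 + 1/10 + m / 30)
       + (1 + 3/5 * m) * (1 - m) / 30)
     + (1 - u)\<^sup>2 * (1 - v) * (1 + 3/5 * (1 - m) * u) * (u / 5 + 1/10 + v / 30)"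

text \<open>In this lemma and the next the difference of the two sides has non-negative Bernstein coefficients.\<close>

lemma coupling_le:
  assumes "0 \<le> u" "u \<le> 1" "0 \<le> v" "v \<le> 1" "0 \<le> m" "m \<le> 1"
  shows "coupling u v m \<le> coupling u v 0"
proof -
  have "coupling u v 0 - coupling u v m =
      2 * m * (1 - m) * (u * (1 - v) / 100 * (3 * (1-u)^2*(1-v) + 4 * (1-u)^2 * v + 5 * u * (1-u) + u^2))
      + m^2 * (u * (1-v) / 50 * (3 * (1-u)^2 * (1-v) + 4 * (1-u)^2 * v + 6 * u * (1-u) + 3 * u^2))"
    unfolding coupling_def by (simp add: field_simps power2_eq_square)
  also have "\<dots> \<ge> 0"
    using assms by (intro add_nonneg_nonneg mult_nonneg_nonneg divide_nonneg_pos) auto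
  finally show ?thesis by simp
qed

lemma bubble_dominates_coupling_0:
  assumes "0 \<le> u" "u \<le> 1" "0 \<le> v" "v \<le> 1"
  defines "x \<equiv> 1 + 3/5 * (1 - u) * (1 - v)"
  shows "(u * (1-v) + (1-u) * (1-v) + v * (1-u)) / 300 \<le>
     u^3 * (1-v) * x / 5 + v^3 * (1-u) * x / 5
     + (1-u) * (1-v) * x * (u^2/5 + 2/15 + v^2/5 + (u+v)/5 + u* v/15)
     - coupling u v 0 - coupling v u 0" (is "?l \<le> ?r")
proof -
  have "?r - ?l = 1/100*(1-u)^3*(1-v)^3 + 19/300*(1-u)^3* v *(1-v)^2 + 17/300*(1-u)^3* v^2*(1-v)
    + 1/300*(1-u)^3* v^3 + 19/300*u*(1-u)^2*(1-v)^3 + 14/75*u*(1-u)^2* v *(1-v)^2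
    + 11/100*u*(1-u)^2* v^2*(1-v) + 1/150*u*(1-u)^2* v^3 + 17/300*u^2*(1-u)*(1-v)^3
    + 11/100*u^2*(1-u)* v *(1-v)^2 + 23/300*u^2*(1-u)* v^2*(1-v) + 1/300*u^2*(1-u)* v^3
    + 1/300*u^3*(1-v)^3 + 1/150*u^3* v *(1-v)^2 + 1/300*u^3* v^2*(1-v)"
    unfolding coupling_def x_def by (simp add: field_simps power2_eq_square power3_eq_cube)
  also have "\<dots> \<ge> 0"
    using assms(1-4) by (intro add_nonneg_nonneg mult_nonneg_nonneg) auto
  finally show ?thesis by simp
qed

text \<open>The integral over the unit interval of the product of the two quadratics with Bernstein
  coefficients \<open>p0, p1, p2\<close> and \<open>q0, q1, q2\<close>.\<close>

definition bern_ip :: "real \<Rightarrow> real \<Rightarrow> real \<Rightarrow> real \<Rightarrow> real \<Rightarrow> real \<Rightarrow> real" where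
  "bern_ip p0 p1 p2 q0 q1 q2 =
     (6 * p0 * q0 + 3 * p0 * q1 + p0 * q2 + 3 * p1 * q0 + 4 * p1 * q1 + 3 * p1 * q2
      + p2 * q0 + 3 * p2 * q1 + 6 * p2 * q2) / 30"

text \<open>The left-hand side is what the coefficients \<open>p\<close> and \<open>q\<close> to the
  left of the diagonal add to a row of the Gram matrix. Their factors \<open>?cp\<close> and
  \<open>?cq\<close> are non-negative, so the worst case is that both equal their lower bounds, and
  \<open>coupling\<close> is minus the resulting value for \<open>B = 1\<close>. Exchanging
  \<open>u\<close> with \<open>v\<close> and \<open>m\<close> with \<open>n\<close> gives the right
  half of the row.\<close>

lemma row_left:
  fixes B :: real
  assumes B: "0 \<le> B" and u: "0 \<le> u" "u \<le> 1" and v: "0 \<le> v" "v \<le> 1" and m: "0 \<le> m" "m \<le> 1"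
    and p: "\<bar>p\<bar> \<le> B * (1 + 3/5 * m)" and q: "\<bar>q\<bar> \<le> B * (1 + 3/5 * (1 - m) * u)"
  shows "u * (1 - v) * u * (((1 - m) * p + m * q) / 30 + q / 10 + (1 - u) * q / 5)
         + (1 - u) * (1 - v) * ((1 - u) * q) * (u / 5 + 1/10 + v / 30) \<ge> - (B * coupling u v m)"
proof -
  have p': "- (B * (1 + 3/5 * m)) \<le> p" and q': "- (B * (1 + 3/5 * (1 - m) * u)) \<le> q"
    using p q by linarith+
  let ?cp = "u^2 * (1 - v) * (1 - m) / 30"
  let ?cq = "u^2 * (1 - v) * ((1 - u) / 5 + 1/10 + m / 30) + (1-u)^2 * (1-v) * (u / 5 + 1/10 + v / 30)"
  have "?cp \<ge> 0" "?cq \<ge> 0" using u v m by (auto intro!: add_nonneg_nonneg mult_nonneg_nonneg divide_nonneg_pos)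
  then have "?cp * p + ?cq * q \<ge> ?cp * (- (B * (1 + 3/5 * m))) + ?cq * (- (B * (1 + 3/5 * (1 - m) * u)))"
    using p' q' by (intro add_mono mult_left_mono) auto
  moreover have "?cp * p + ?cq * q = u * (1 - v) * u * (((1 - m) * p + m * q) / 30 + q / 10 + (1 - u) * q / 5)
         + (1 - u) * (1 - v) * ((1 - u) * q) * (u / 5 + 1/10 + v / 30)"
    by (simp add: field_simps power2_eq_square)
  moreover have "?cp * (- (B * (1 + 3/5 * m))) + ?cq * (- (B * (1 + 3/5 * (1 - m) * u))) = - (B * coupling u v m)"
    unfolding coupling_def by (simp add: field_simps power2_eq_square)
  ultimately show ?thesis by linarith
qed

text \<open>Row \<open>j\<close> of the Gram matrix, where \<open>u\<close>, \<open>v\<close>, \<open>m\<close>, \<open>n\<close> stand for \<open>wt j\<close>, \<open>1 - wt (j + 1)\<close>, \<open>wt (j - 1)\<close>,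
  \<open>1 - wt (j + 2)\<close>, and where the three interval lengths are multiplied by \<open>(1 - u) * (1 - v) / gap j\<close>.\<close>

lemma row_scaled:
  fixes B :: real
  assumes B: "0 \<le> B" and u: "0 \<le> u" "u \<le> 1" and v: "0 \<le> v" "v \<le> 1"
    and m: "0 \<le> m" "m \<le> 1" and n: "0 \<le> n" "n \<le> 1"
    and p: "\<bar>p\<bar> \<le> B * (1 + 3/5 * m)" and q: "\<bar>q\<bar> \<le> B * (1 + 3/5 * (1 - m) * u)"
    and r: "r = B * (1 + 3/5 * (1 - u) * (1 - v))"
    and s: "\<bar>s\<bar> \<le> B * (1 + 3/5 * (1 - n) * v)" and t: "\<bar>t\<bar> \<le> B * (1 + 3/5 * n)"
  shows "B * (u * (1-v) + (1-u) * (1-v) + v * (1-u)) / 300 \<le>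
     u * (1 - v) * bern_ip ((1 - m) * p + m * q) q ((1 - u) * q + u * r) 0 0 u
     + (1 - u) * (1 - v) * bern_ip ((1 - u) * q + u * r) r (v * r + (1 - v) * s) u 1 v
     + v * (1 - u) * bern_ip (v * r + (1 - v) * s) s (n * s + (1 - n) * t) v 0 0"
proof -
  define x where "x = 1 + 3/5 * (1 - u) * (1 - v)"
  \<comment> \<open>\<open>B * core\<close> is the part of the row due to the diagonal coefficient
    \<open>r\<close>; \<open>l\<close> and its mirror image \<open>l'\<close> are the parts due to
    the neighbours.\<close>
  define core where "core = u^3 * (1-v) * x / 5 + v^3 * (1-u) * x / 5
     + (1-u) * (1-v) * x * (u^2/5 + 2/15 + v^2/5 + (u+v)/5 + u* v/15)"
  define l where "l = u * (1 - v) * u * (((1 - m) * p + m * q) / 30 + q / 10 + (1 - u) * q / 5)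
         + (1 - u) * (1 - v) * ((1 - u) * q) * (u / 5 + 1/10 + v / 30)"
  define l' where "l' = v * (1 - u) * v * (((1 - n) * t + n * s) / 30 + s / 10 + (1 - v) * s / 5)
         + (1 - v) * (1 - u) * ((1 - v) * s) * (v / 5 + 1/10 + u / 30)"
  have "(u * (1-v) + (1-u) * (1-v) + v * (1-u)) / 300 \<le> core - coupling u v 0 - coupling v u 0"
    unfolding core_def x_def by (rule bubble_dominates_coupling_0) (use u v in auto)
  also have "\<dots> \<le> core - coupling u v m - coupling v u n"
    using coupling_le[of u v m] coupling_le[of v u n] u v m n by linarith
  finally have "B * ((u * (1-v) + (1-u) * (1-v) + v * (1-u)) / 300) \<le> B * (core - coupling u v m - coupling v u n)"
    using B by (rule mult_left_mono)
  moreover have "l \<ge> - (B * coupling u v m)" unfolding l_def by (rule row_left) fact+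
  moreover have "l' \<ge> - (B * coupling v u n)" unfolding l'_def by (rule row_left) fact+
  moreover have "u * (1 - v) * bern_ip ((1 - m) * p + m * q) q ((1 - u) * q + u * r) 0 0 u
     + (1 - u) * (1 - v) * bern_ip ((1 - u) * q + u * r) r (v * r + (1 - v) * s) u 1 v
     + v * (1 - u) * bern_ip (v * r + (1 - v) * s) s (n * s + (1 - n) * t) v 0 0 = B * core + l + l'"
    unfolding core_def l_def l'_def bern_ip_def r x_def[symmetric]
    by (simp add: field_simps power2_eq_square power3_eq_cube)
  ultimately show ?thesis unfolding right_diff_distrib times_divide_eq_right by linarith
qed

section \<open>Quadratic splines on arbitrary knots\<close>

lemma C1_onD:
  assumes "C1_on S f" "x \<in> S"
  shows "(f has_real_derivative deriv_on S f x) (at x within S)"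
  using assms unfolding C1_on_def differentiable_on_def
  by (auto simp: has_real_derivative_iff_has_vector_derivative vector_derivative_works)

lemma deriv_on_eqI:
  fixes a b :: real
  assumes "a < b" "x \<in> {a..b}" "(f has_real_derivative y) (at x within {a..b})"
  shows "deriv_on {a..b} f x = y"
  using assms vector_derivative_within_closed_interval[of a b x f y]
  by (auto simp: has_real_derivative_iff_has_vector_derivative)

lemma C1_onI:
  fixes a b :: real
  assumes "a < b" "\<And>x. x \<in> {a..b} \<Longrightarrow> (f has_real_derivative f' x) (at x within {a..b})"
    and "continuous_on {a..b} f'"
  shows "C1_on {a..b} f"
proof -
  have "deriv_on {a..b} f x = f' x" if "x \<in> {a..b}" for x
    using deriv_on_eqI[OF assms(1) that assms(2)[OF that]] .
  then have "continuous_on {a..b} (deriv_on {a..b} f)"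
    using assms(3) continuous_on_cong[of "{a..b}" "{a..b}" "deriv_on {a..b} f" f'] by simp
  moreover have "f differentiable_on {a..b}"
    using assms(2) unfolding differentiable_on_def real_differentiable_def by blast
  ultimately show ?thesis unfolding C1_on_def by blast
qed

text \<open>This glues the pieces of a spline. Outside the closed set \<open>S i\<close> the filter
  \<open>at x within S i\<close> is trivial and every \<open>D\<close> is a derivative, so only the
  pieces that contain \<open>x\<close> impose a condition.\<close>

lemma has_real_derivative_at_within_UN_closed:
  fixes f :: "real \<Rightarrow> real"
  assumes "finite I" "\<And>i. i \<in> I \<Longrightarrow> closed (S i)"
    and "\<And>i. i \<in> I \<Longrightarrow> x \<in> S i \<Longrightarrow> (f has_real_derivative D) (at x within S i)"
  shows "(f has_real_derivative D) (at x within (\<Union>i\<in>I. S i))"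
  using assms
proof (induction I)
  case empty
  then show ?case by (simp add: has_field_derivative_iff)
next
  case (insert i I)
  have "(f has_real_derivative D) (at x within S i)"
  proof (cases "x \<in> S i")
    case False
    then have "at x within S i = bot"
      using insert.prems(1)[of i] closed_limpt[of "S i"] by (auto simp: trivial_limit_within)
    then show ?thesis by (simp add: has_field_derivative_iff)
  qed (use insert.prems in auto)
  moreover have "(f has_real_derivative D) (at x within (\<Union>i\<in>I. S i))"
    using insert by auto
  ultimately show ?case
    by (simp add: has_field_derivative_iff Lim_within_Un)
qed

definition bern :: "real \<Rightarrow> real \<Rightarrow> real \<Rightarrow> real \<Rightarrow> real" where
  "bern p0 p1 p2 x = p0 * (1 - x)\<^sup>2 + 2 * p1 * x * (1 - x) + p2 * x\<^sup>2"

text \<open>The Bernstein polynomials are non-negative on the unit interval and sum to 1, so the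
  value is a convex combination of the three ordinates.\<close>

lemma bern_convex:
  assumes "0 \<le> x" "x \<le> 1" "\<bar>p0 - y\<bar> \<le> r" "\<bar>p1 - y\<bar> \<le> r" "\<bar>p2 - y\<bar> \<le> r"
  shows "\<bar>bern p0 p1 p2 x - y\<bar> \<le> r"
proof -
  have "bern p0 p1 p2 x - y = (p0 - y) * (1 - x)\<^sup>2 + (p1 - y) * (2 * x * (1 - x)) + (p2 - y) * x\<^sup>2"
    unfolding bern_def by (simp add: field_simps power2_eq_square)
  also have "\<bar>\<dots>\<bar> \<le> \<bar>(p0 - y) * (1 - x)\<^sup>2\<bar> + \<bar>(p1 - y) * (2 * x * (1 - x))\<bar> + \<bar>(p2 - y) * x\<^sup>2\<bar>"
    by linarith
  also have "\<dots> \<le> r * (1 - x)\<^sup>2 + r * (2 * x * (1 - x)) + r * x\<^sup>2"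
    unfolding abs_mult using assms by (intro add_mono mult_mono) auto
  also have "\<dots> = r" by (simp add: field_simps power2_eq_square)
  finally show ?thesis .
qed

locale knot_vector =
  fixes a b :: real and K :: nat and \<tau> :: "nat \<Rightarrow> real"
  assumes knots: "knots a b K \<tau>"
begin

text \<open>The convention that \<open>gap\<close> vanishes outside \<open>{1..<K}\<close> encodes multiple knots at the two ends.  A coefficient
  sequence \<open>\<beta>\<close> stands for the quadratic spline with Bezier ordinate \<open>\<beta> t\<close> in the middle of the \<open>t\<close>-th interval and with
  end values \<open>\<beta> 0\<close> and \<open>\<beta> K\<close>; \<open>knot_val \<beta> t\<close> is its value at \<open>\<tau> t\<close>, forced by continuity of the derivative.\<close>

definition gap :: "nat \<Rightarrow> real" where
  "gap t = (if t \<in> {1..<K} then \<tau> (t + 1) - \<tau> t else 0)"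

definition wt :: "nat \<Rightarrow> real" where
  "wt t = (if t \<le> 1 then 0 else if K \<le> t then 1 else gap (t - 1) / (gap (t - 1) + gap t))"

definition knot_val :: "(nat \<Rightarrow> real) \<Rightarrow> nat \<Rightarrow> real" where
  "knot_val \<beta> t = (1 - wt t) * \<beta> (t - 1) + wt t * \<beta> t"

definition locate :: "real \<Rightarrow> nat" where
  "locate x = Max {t \<in> {1..<K}. \<tau> t \<le> x}"

definition piece :: "(nat \<Rightarrow> real) \<Rightarrow> nat \<Rightarrow> real \<Rightarrow> real" where
  "piece \<beta> t x = bern (knot_val \<beta> t) (\<beta> t) (knot_val \<beta> (t + 1)) ((x - \<tau> t) / gap t)"

definition spl :: "(nat \<Rightarrow> real) \<Rightarrow> real \<Rightarrow> real" where
  "spl \<beta> x = piece \<beta> (locate x) x"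

definition piece' :: "(nat \<Rightarrow> real) \<Rightarrow> nat \<Rightarrow> real \<Rightarrow> real" where
  "piece' \<beta> t x = 2 * ((\<beta> t - knot_val \<beta> t) * (1 - (x - \<tau> t) / gap t)
     + (knot_val \<beta> (t + 1) - \<beta> t) * ((x - \<tau> t) / gap t)) / gap t"

lemma K: "2 \<le> K" and ends: "\<tau> 1 = a" "\<tau> K = b"
  and knot_less: "\<And>i j. i \<in> {1..K} \<Longrightarrow> j \<in> {1..K} \<Longrightarrow> i < j \<Longrightarrow> \<tau> i < \<tau> j"
  using knots unfolding knots_def strict_mono_on_def by auto

lemma knot_le: "i \<in> {1..K} \<Longrightarrow> j \<in> {1..K} \<Longrightarrow> i \<le> j \<Longrightarrow> \<tau> i \<le> \<tau> j"
  using knot_less[of i j] by (cases "i = j") auto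

lemma a_less_b: "a < b"
  using knot_less[of 1 K] K ends by auto

lemma gap_pos: "t \<in> {1..<K} \<Longrightarrow> 0 < gap t"
  unfolding gap_def using knot_less[of t "t + 1"] by auto

lemma gap_nonneg: "0 \<le> gap t"
  using gap_pos[of t] by (cases "t \<in> {1..<K}") (auto simp: gap_def)

lemma gap_eq: "t \<in> {1..<K} \<Longrightarrow> gap t = \<tau> (t + 1) - \<tau> t"
  by (simp add: gap_def)

lemma wt_nonneg: "0 \<le> wt t" and wt_le_1: "wt t \<le> 1"
  using gap_nonneg[of t] gap_nonneg[of "t - 1"] by (auto simp: wt_def divide_le_eq)

text \<open>This is the condition for equal slopes at a knot, written without division so that it
  persists at both ends, where \<open>gap\<close> is extended by zero.\<close>

lemma wt_gap: "gap t * wt t = gap (t - 1) * (1 - wt t)"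
proof (cases "t \<le> 1 \<or> K \<le> t")
  case True
  then show ?thesis using K by (auto simp: wt_def gap_def)
next
  case False
  then have "gap t > 0" "gap (t - 1) \<ge> 0" using gap_pos[of t] gap_nonneg by auto
  then show ?thesis using False by (simp add: wt_def field_simps)
qed

lemma interval_subset: "t \<in> {1..<K} \<Longrightarrow> {\<tau> t..\<tau> (t + 1)} \<subseteq> {a..b}"
  using knot_le[of 1 t] knot_le[of "t + 1" K] ends by auto

lemma locate_interval:
  assumes "x \<in> {a..b}"
  shows "locate x \<in> {1..<K}" "x \<in> {\<tau> (locate x)..\<tau> (locate x + 1)}"
proof -
  let ?S = "{t \<in> {1..<K}. \<tau> t \<le> x}"
  have fin: "finite ?S" and "1 \<in> ?S" using assms K ends by auto
  then have in_S: "locate x \<in> ?S" unfolding locate_def using Max_in by blast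
  then show "locate x \<in> {1..<K}" by simp
  have "x \<le> \<tau> (locate x + 1)"
  proof (cases "locate x + 1 < K")
    case True
    then have "locate x + 1 \<notin> ?S" using Max_ge[OF fin, of "locate x + 1"] unfolding locate_def by linarith
    then show ?thesis using True by auto
  next
    case False
    then have "locate x + 1 = K" using in_S by auto
    then show ?thesis using assms ends by simp
  qed
  then show "x \<in> {\<tau> (locate x)..\<tau> (locate x + 1)}" using in_S by auto
qed

lemma UN_intervals: "(\<Union>t\<in>{1..<K}. {\<tau> t..\<tau> (t + 1)}) = {a..b}"
  using interval_subset locate_interval by fast

text \<open>An interior knot is assigned by \<open>locate\<close> to the interval on its right, so
  the located index can differ from \<open>t\<close> only at the right end of interval
  \<open>t\<close>, where \<open>match\<close> applies. The family \<open>P\<close> is left open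
  because the argument serves the pieces and their derivatives alike.\<close>

lemma locate_glue:
  assumes t: "t \<in> {1..<K}" and x: "x \<in> {\<tau> t..\<tau> (t + 1)}"
    and match: "\<And>t. t \<in> {1..<K} \<Longrightarrow> t + 1 < K \<Longrightarrow> P t (\<tau> (t + 1)) = P (t + 1) (\<tau> (t + 1))"
  shows "P (locate x) x = P t x"
proof -
  have x': "x \<in> {a..b}" using x interval_subset[OF t] by blast
  note l = locate_interval[OF x']
  have fin: "finite {t \<in> {1..<K}. \<tau> t \<le> x}" by simp
  have "t \<le> locate x" unfolding locate_def using t x by (intro Max_ge) auto
  moreover have "locate x \<le> t + 1"
  proof (rule ccontr)
    assume "\<not> ?thesis"
    then have "\<tau> (t + 1) < \<tau> (locate x)" using t l by (intro knot_less) auto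
    then show False using l x by auto
  qed
  ultimately consider "locate x = t" | "locate x = t + 1" by linarith
  then show ?thesis
  proof cases
    case 2
    then have "x = \<tau> (t + 1)" using l x by auto
    then show ?thesis using match[of t] t 2 l by auto
  qed simp
qed

lemma piece_match:
  assumes "t \<in> {1..<K}" "t + 1 < K"
  shows "piece \<beta> t (\<tau> (t + 1)) = piece \<beta> (t + 1) (\<tau> (t + 1))"
proof -
  have "(\<tau> (t + 1) - \<tau> t) / gap t = 1" using gap_pos[OF assms(1)] assms by (simp add: gap_eq)
  then show ?thesis by (simp add: piece_def bern_def)
qed

text \<open>Both one-sided slopes are multiples of \<open>\<beta> (t + 1) - \<beta> t\<close>, and
  the factors agree by \<open>wt_gap\<close>.\<close>

lemma piece'_match:
  assumes "t \<in> {1..<K}" "t + 1 < K"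
  shows "piece' \<beta> t (\<tau> (t + 1)) = piece' \<beta> (t + 1) (\<tau> (t + 1))"
proof -
  have g: "gap t > 0" "gap (t + 1) > 0" using gap_pos[of t] gap_pos[of "t + 1"] assms by auto
  have \<xi>: "(\<tau> (t + 1) - \<tau> t) / gap t = 1" using g assms by (simp add: gap_eq)
  have 1: "piece' \<beta> t (\<tau> (t + 1)) = 2 * (wt (t + 1) * (\<beta> (t + 1) - \<beta> t)) / gap t"
    unfolding piece'_def \<xi> by (simp add: knot_val_def algebra_simps)
  have 2: "piece' \<beta> (t + 1) (\<tau> (t + 1)) = 2 * ((1 - wt (t + 1)) * (\<beta> (t + 1) - \<beta> t)) / gap (t + 1)"
    by (simp add: piece'_def knot_val_def algebra_simps)
  have "wt (t + 1) / gap t = (1 - wt (t + 1)) / gap (t + 1)"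
    using wt_gap[of "t + 1"] g by (simp add: field_simps)
  moreover have "2 * (w * d) / g = 2 * d * (w / g)" for w d g :: real by simp
  ultimately show ?thesis unfolding 1 2 by presburger
qed

lemma spl_eq_piece: "t \<in> {1..<K} \<Longrightarrow> x \<in> {\<tau> t..\<tau> (t + 1)} \<Longrightarrow> spl \<beta> x = piece \<beta> t x"
  unfolding spl_def by (rule locate_glue[OF _ _ piece_match])

definition spl' :: "(nat \<Rightarrow> real) \<Rightarrow> real \<Rightarrow> real" where
  "spl' \<beta> x = piece' \<beta> (locate x) x"

lemma spl'_eq_piece': "t \<in> {1..<K} \<Longrightarrow> x \<in> {\<tau> t..\<tau> (t + 1)} \<Longrightarrow> spl' \<beta> x = piece' \<beta> t x"
  unfolding spl'_def by (rule locate_glue[OF _ _ piece'_match])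

lemma piece_has_derivative:
  "t \<in> {1..<K} \<Longrightarrow> (piece \<beta> t has_real_derivative piece' \<beta> t x) (at x within S)"
  unfolding piece_def[abs_def] bern_def piece'_def using gap_pos[of t]
  by (auto intro!: derivative_eq_intros simp: field_simps power2_eq_square)

lemma spl_has_derivative:
  assumes "x \<in> {a..b}"
  shows "(spl \<beta> has_real_derivative spl' \<beta> x) (at x within {a..b})"
  unfolding UN_intervals[symmetric]
proof (rule has_real_derivative_at_within_UN_closed)
  fix t assume t: "t \<in> {1..<K}" and x: "x \<in> {\<tau> t..\<tau> (t + 1)}"
  have "(piece \<beta> t has_real_derivative spl' \<beta> x) (at x within {\<tau> t..\<tau> (t + 1)})"
    using piece_has_derivative[OF t] spl'_eq_piece'[OF t x] by simp
  then show "(spl \<beta> has_real_derivative spl' \<beta> x) (at x within {\<tau> t..\<tau> (t + 1)})"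
    by (rule has_field_derivative_transform_within[OF _ zero_less_one x])
      (use spl_eq_piece[OF t] in auto)
qed auto

lemma continuous_on_spl': "continuous_on {a..b} (spl' \<beta>)"
  unfolding UN_intervals[symmetric]
proof (rule continuous_on_closed_Union)
  fix t assume t: "t \<in> {1..<K}"
  have "continuous_on {\<tau> t..\<tau> (t + 1)} (piece' \<beta> t)"
    unfolding piece'_def[abs_def] using gap_pos[OF t] by (intro continuous_intros) auto
  then show "continuous_on {\<tau> t..\<tau> (t + 1)} (spl' \<beta>)"
    by (rule continuous_on_eq) (simp only: spl'_eq_piece'[OF t])
qed auto

lemma continuous_on_spl: "continuous_on {a..b} (spl \<beta>)"
  using spl_has_derivative by (rule DERIV_continuous_on)

lemma C1_on_spl: "C1_on {a..b} (spl \<beta>)"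
  using C1_onI[OF a_less_b spl_has_derivative continuous_on_spl'] .

lemma spl_linear: "spl (\<lambda>k. x * \<beta> k + y * \<gamma> k) p = x * spl \<beta> p + y * spl \<gamma> p"
  unfolding spl_def piece_def bern_def knot_val_def by (simp add: algebra_simps)

text \<open>On one interval the spline involves only three coefficients, and both
  \<open>knot_val\<close> and the Bernstein form are convex combinations.\<close>

lemma spl_close:
  assumes t: "t \<in> {1..<K}" and x: "x \<in> {\<tau> t..\<tau> (t + 1)}"
    and "\<And>k. k \<in> {t - 1, t, t + 1} \<Longrightarrow> \<bar>\<beta> k - y\<bar> \<le> r"
  shows "\<bar>spl \<beta> x - y\<bar> \<le> r"
proof -
  have kv: "\<bar>knot_val \<beta> k - y\<bar> \<le> r" if "\<bar>\<beta> (k - 1) - y\<bar> \<le> r" "\<bar>\<beta> k - y\<bar> \<le> r" for k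
  proof -
    have "\<bar>knot_val \<beta> k - y\<bar> = \<bar>(1 - wt k) * (\<beta> (k - 1) - y) + wt k * (\<beta> k - y)\<bar>"
      unfolding knot_val_def by (simp add: algebra_simps)
    also have "\<dots> \<le> \<bar>(1 - wt k) * (\<beta> (k - 1) - y)\<bar> + \<bar>wt k * (\<beta> k - y)\<bar>" by linarith
    also have "\<dots> \<le> (1 - wt k) * r + wt k * r"
      unfolding abs_mult using wt_nonneg[of k] wt_le_1[of k] that by (intro add_mono mult_mono) auto
    finally show ?thesis by (simp add: algebra_simps)
  qed
  show ?thesis unfolding spl_eq_piece[OF t x] piece_def
    using assms gap_pos[OF t] by (intro bern_convex kv) (auto simp: gap_eq field_simps)
qed

text \<open>For a quadratic spline \<open>f\<close>, \<open>lam f t\<close> is its middle Bezier ordinate on the \<open>t\<close>-th interval.\<close>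

definition lam :: "(real \<Rightarrow> real) \<Rightarrow> nat \<Rightarrow> real" where
  "lam f t = (if t < 1 then f a else if K \<le> t then f b
     else 2 * f ((\<tau> t + \<tau> (t + 1)) / 2) - (f (\<tau> t) + f (\<tau> (t + 1))) / 2)"

lemma lam_linear: "lam (\<lambda>p. x * f p + y * g p) t = x * lam f t + y * lam g t"
  unfolding lam_def by (simp add: field_simps)

text \<open>The coefficients 2, -1/2 and -1/2 of the functional sum to 1, so constants pass through,
  and their absolute values sum to 3. For \<open>t = 0\<close> and \<open>t = K\<close> the clamped
  range shrinks to an end point.\<close>

lemma lam_bound:
  assumes "t \<le> K"  "\<And>x. x \<in> {\<tau> (max 1 t)..\<tau> (min K (t + 1))} \<Longrightarrow> \<bar>f x - y\<bar> \<le> r"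
  shows "\<bar>lam f t - y\<bar> \<le> 3 * r"
proof -
  consider "t < 1" | "K \<le> t" | "t \<in> {1..<K}" by fastforce
  then show ?thesis
  proof cases
    case 1
    then have "\<bar>f a - y\<bar> \<le> r" using assms(2)[of a] K ends by (auto simp: max_def min_def)
    then show ?thesis using 1 by (simp add: lam_def)
  next
    case 2
    then have "\<bar>f b - y\<bar> \<le> r" using assms(1) assms(2)[of b] K ends
      by (auto simp: max_def min_def)
    then show ?thesis using 2 K by (simp add: lam_def)
  next
    case 3
    then have "max 1 t = t" "min K (t + 1) = t + 1" by auto
    then have *: "\<And>x. x \<in> {\<tau> t..\<tau> (t + 1)} \<Longrightarrow> \<bar>f x - y\<bar> \<le> r" using assms(2) by simp
    have "\<tau> t < \<tau> (t + 1)" using gap_pos[OF 3] 3 by (simp add: gap_eq)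
    then have "\<bar>f ((\<tau> t + \<tau> (t + 1)) / 2) - y\<bar> \<le> r" "\<bar>f (\<tau> t) - y\<bar> \<le> r" "\<bar>f (\<tau> (t + 1)) - y\<bar> \<le> r"
      using *[of "(\<tau> t + \<tau> (t + 1)) / 2"] *[of "\<tau> t"] *[of "\<tau> (t + 1)"] by (auto simp: field_simps)
    then show ?thesis using 3 unfolding lam_def by (auto simp: abs_le_iff field_simps)
  qed
qed

text \<open>The middle ordinate of a parabola is the height at which its two end tangents meet. Seen
  from an interior knot \<open>m\<close> the adjacent ordinates are thus
  \<open>f m - y * (m - l) / 2\<close> and \<open>f m + y * (r - m) / 2\<close> with a common slope
  \<open>y\<close>, and the weights \<open>wt\<close> make \<open>y\<close> cancel.\<close>

lemma knot_val_lam: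
  assumes quad: "\<And>t. t \<in> {1..<K} \<Longrightarrow> \<exists>c0 c1 c2. \<forall>x\<in>{\<tau> t..\<tau> (t + 1)}. f x = c0 + c1 * x + c2 * x\<^sup>2"
    and diff: "\<And>x. x \<in> {a..b} \<Longrightarrow> \<exists>y. (f has_real_derivative y) (at x within {a..b})"
    and t: "t \<in> {1..K}"
  shows "knot_val (lam f) t = f (\<tau> t)"
proof -
  consider "t = 1" | "t = K" | "t \<in> {1<..<K}" using t by fastforce
  then show ?thesis
  proof cases
    case 1
    then show ?thesis using ends by (simp add: knot_val_def wt_def lam_def)
  next
    case 2
    then show ?thesis using ends K by (simp add: knot_val_def wt_def lam_def)
  next
    case 3
    define l where "l = \<tau> (t - 1)"
    define r where "r = \<tau> (t + 1)"
    define m where "m = \<tau> t"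
    have lmr: "l < m" "m < r" using 3 by (auto simp: l_def m_def r_def intro!: knot_less)
    have tm: "t - 1 \<in> {1..<K}" "t - 1 + 1 = t" using 3 by auto
    have sub: "{l..m} \<subseteq> {a..b}" "{m..r} \<subseteq> {a..b}"
      using interval_subset[OF tm(1)] interval_subset[of t] 3 unfolding l_def m_def r_def tm(2) by simp_all
    obtain c0 c1 c2 where c: "\<And>x. x \<in> {l..m} \<Longrightarrow> f x = c0 + c1 * x + c2 * x\<^sup>2"
      using quad[OF tm(1)] unfolding l_def m_def tm(2) by blast
    obtain d0 d1 d2 where d: "\<And>x. x \<in> {m..r} \<Longrightarrow> f x = d0 + d1 * x + d2 * x\<^sup>2"
      using quad[of t] 3 by (auto simp: r_def m_def)
    obtain y where y: "(f has_real_derivative y) (at m within {a..b})" using diff sub lmr by force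
    have "((\<lambda>x. c0 + c1 * x + c2 * x\<^sup>2) has_real_derivative y) (at m within {l..m})"
      by (rule has_field_derivative_transform_within[OF DERIV_subset[OF y sub(1)] zero_less_one])
        (use c lmr in auto)
    moreover have "((\<lambda>x. c0 + c1 * x + c2 * x\<^sup>2) has_real_derivative c1 + 2 * c2 * m) (at m within {l..m})"
      by (auto intro!: derivative_eq_intros)
    ultimately have yc: "y = c1 + 2 * c2 * m"
      using deriv_on_eqI[OF lmr(1)] lmr by (metis atLeastAtMost_iff less_imp_le order_refl)
    have "((\<lambda>x. d0 + d1 * x + d2 * x\<^sup>2) has_real_derivative y) (at m within {m..r})"
      by (rule has_field_derivative_transform_within[OF DERIV_subset[OF y sub(2)] zero_less_one])
        (use d lmr in auto)
    moreover have "((\<lambda>x. d0 + d1 * x + d2 * x\<^sup>2) has_real_derivative d1 + 2 * d2 * m) (at m within {m..r})"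
      by (auto intro!: derivative_eq_intros)
    ultimately have yd: "y = d1 + 2 * d2 * m"
      using deriv_on_eqI[OF lmr(2)] lmr by (metis atLeastAtMost_iff less_imp_le order_refl)
    have "(l + m) / 2 \<in> {l..m}" "(m + r) / 2 \<in> {m..r}" using lmr by auto
    then have eL: "lam f (t - 1) = 2 * (c0 + c1 * ((l + m) / 2) + c2 * ((l + m) / 2)\<^sup>2) - (c0 + c1 * l + c2 * l\<^sup>2 + (c0 + c1 * m + c2 * m\<^sup>2)) / 2"
      and eR: "lam f t = 2 * (d0 + d1 * ((m + r) / 2) + d2 * ((m + r) / 2)\<^sup>2) - (d0 + d1 * m + d2 * m\<^sup>2 + (d0 + d1 * r + d2 * r\<^sup>2)) / 2"
      using 3 lmr c[of l] c[of m] c[of "(l + m) / 2"] d[of m] d[of r] d[of "(m + r) / 2"]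
      by (auto simp: lam_def l_def m_def r_def)
    have lamL: "lam f (t - 1) = c0 + c1 * m + c2 * m\<^sup>2 - y * (m - l) / 2"
      unfolding eL yc by (simp add: field_simps power2_eq_square)
    have lamR: "lam f t = d0 + d1 * m + d2 * m\<^sup>2 + y * (r - m) / 2"
      unfolding eR yd by (simp add: field_simps power2_eq_square)
    have L: "lam f (t - 1) = f m - y * (m - l) / 2" and R: "lam f t = f m + y * (r - m) / 2"
      unfolding lamL lamR using c[of m] d[of m] lmr by auto
    have g: "gap t = r - m" "gap (t - 1) = m - l" using 3 by (auto simp: gap_def r_def m_def l_def)
    have w: "wt t = (m - l) / (r - l)" using 3 unfolding wt_def g by auto
    have "wt t * (r - m) = (1 - wt t) * (m - l)" unfolding w using lmr by (simp add: field_simps)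
    then have "wt t * (y * (r - m)) = (1 - wt t) * (y * (m - l))" by (metis mult.left_commute)
    then show ?thesis unfolding knot_val_def L R m_def[symmetric] by (simp add: field_simps)
  qed
qed

text \<open>Once the knot values are recovered, every piece has the right Bezier ordinates. So
  passing from \<open>f\<close> to \<open>spl (lam f)\<close> is a projection onto the quadratic
  splines; in particular it reproduces polynomials up to degree 2.\<close>

lemma spl_lam:
  assumes quad: "\<And>t. t \<in> {1..<K} \<Longrightarrow> \<exists>c0 c1 c2. \<forall>x\<in>{\<tau> t..\<tau> (t + 1)}. f x = c0 + c1 * x + c2 * x\<^sup>2"
    and diff: "\<And>x. x \<in> {a..b} \<Longrightarrow> \<exists>y. (f has_real_derivative y) (at x within {a..b})"
    and x: "x \<in> {a..b}"
  shows "spl (lam f) x = f x"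
proof -
  define t where "t = locate x"
  define l where "l = \<tau> t"
  define r where "r = \<tau> (t + 1)"
  have t: "t \<in> {1..<K}" and xt: "x \<in> {l..r}" unfolding t_def l_def r_def using locate_interval[OF x] by auto
  have g: "gap t = r - l" "r > l" using gap_eq[OF t] gap_pos[OF t] by (auto simp: l_def r_def)
  obtain c0 c1 c2 where c: "\<And>x. x \<in> {l..r} \<Longrightarrow> f x = c0 + c1 * x + c2 * x\<^sup>2"
    using quad[OF t] by (auto simp: l_def r_def)
  define \<xi> where "\<xi> = (x - l) / (r - l)"
  have x_eq: "x = l + \<xi> * (r - l)" using g by (simp add: \<xi>_def)
  have "lam f t = 2 * (c0 + c1 * ((l + r) / 2) + c2 * ((l + r) / 2)\<^sup>2) - (c0 + c1 * l + c2 * l\<^sup>2 + (c0 + c1 * r + c2 * r\<^sup>2)) / 2"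
    using t g c[of l] c[of r] c[of "(l + r) / 2"] by (auto simp: lam_def l_def r_def)
  moreover have "spl (lam f) x = bern (f l) (lam f t) (f r) \<xi>"
    using spl_eq_piece[OF t, of x] xt knot_val_lam[OF quad diff, of t] knot_val_lam[OF quad diff, of "t + 1"] t g
    by (simp add: piece_def l_def r_def \<xi>_def)
  moreover have "f l = c0 + c1 * l + c2 * l\<^sup>2" "f r = c0 + c1 * r + c2 * r\<^sup>2" using c g by auto
  moreover have "bern (c0 + c1 * l + c2 * l\<^sup>2)
      (2 * (c0 + c1 * ((l + r) / 2) + c2 * ((l + r) / 2)\<^sup>2) - (c0 + c1 * l + c2 * l\<^sup>2 + (c0 + c1 * r + c2 * r\<^sup>2)) / 2)
      (c0 + c1 * r + c2 * r\<^sup>2) \<xi> = c0 + c1 * x + c2 * x\<^sup>2"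
    unfolding x_eq bern_def by (simp add: field_simps power2_eq_square)
  ultimately have "spl (lam f) x = c0 + c1 * x + c2 * x\<^sup>2" by simp
  then show ?thesis using c xt by simp
qed

end

section \<open>Sampling and the B-spline Gram matrix\<close>

text \<open>Both end points are price levels, so this is a left Riemann sum with a surplus term at
  \<open>b\<close>, of total weight \<open>(b - a) * N / (N - 1)\<close>. For
  \<open>N \<ge> 2\<close> the factor is positive and leaves the minimisers of a sum of squares
  unchanged.\<close>

definition riemann :: "real \<Rightarrow> real \<Rightarrow> nat \<Rightarrow> (real \<Rightarrow> real) \<Rightarrow> real" where
  "riemann a b N f = (b - a) / (real N - 1) * (\<Sum>k=1..N. f (price a b N k))"

lemma price_in_interval:
  assumes "a < b" "k \<in> {1..N}" "2 \<le> N"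
  shows "price a b N k \<in> {a..b}"
proof -
  have "0 \<le> (real k - 1) / (real N - 1)" "(real k - 1) / (real N - 1) \<le> 1"
    using assms by (auto simp: divide_le_eq)
  then have "(real k - 1) / (real N - 1) * (b - a) \<le> 1 * (b - a)" "0 \<le> (real k - 1) / (real N - 1) * (b - a)"
    using assms by (intro mult_right_mono mult_nonneg_nonneg; simp)+
  then show ?thesis by (simp add: price_def)
qed

lemma riemann_add: "riemann a b N (\<lambda>x. f x + g x) = riemann a b N f + riemann a b N g"
  by (simp add: riemann_def sum.distrib algebra_simps)

lemma riemann_mult: "riemann a b N (\<lambda>x. c * f x) = c * riemann a b N f"
  by (simp add: riemann_def sum_distrib_left mult.left_commute)

lemma riemann_sum: "riemann a b N (\<lambda>x. \<Sum>i\<in>I. f i x) = (\<Sum>i\<in>I. riemann a b N (f i))"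
  unfolding riemann_def by (subst sum.swap) (simp add: sum_distrib_left)

lemma riemann_mono:
  assumes "a < b" "2 \<le> N" "\<And>x. x \<in> {a..b} \<Longrightarrow> f x \<le> g x"
  shows "riemann a b N f \<le> riemann a b N g"
  unfolding riemann_def using assms price_in_interval[OF assms(1) _ assms(2)]
  by (intro mult_left_mono sum_mono) auto

lemma riemann_cong:
  assumes "a < b" "2 \<le> N" "\<And>x. x \<in> {a..b} \<Longrightarrow> f x = g x"
  shows "riemann a b N f = riemann a b N g"
  using assms by (intro antisym riemann_mono) auto

text \<open>Uniform continuity keeps the left Riemann sum within \<open>\<epsilon> / 2\<close> of
  the integral, by induction on the number of subintervals; the surplus term at \<open>b\<close>
  takes the other half.\<close>

lemma riemann_tendsto_integral:
  assumes ab: "a < b" and f: "continuous_on {a..b} f"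
  shows "(\<lambda>N. riemann a b N f) \<longlonglongrightarrow> integral {a..b} f"
proof (rule LIMSEQ_I)
  fix \<epsilon> :: real assume "\<epsilon> > 0"
  define \<eta> where "\<eta> = \<epsilon> / (2 * (b - a))"
  have "\<eta> > 0" using \<open>\<epsilon> > 0\<close> ab by (simp add: \<eta>_def)
  have "uniformly_continuous_on {a..b} f" using f compact_uniformly_continuous by blast
  then obtain d where d: "d > 0" "\<And>x y. x \<in> {a..b} \<Longrightarrow> y \<in> {a..b} \<Longrightarrow> \<bar>y - x\<bar> < d \<Longrightarrow> \<bar>f y - f x\<bar> < \<eta>"
    unfolding uniformly_continuous_on_def dist_real_def using \<open>\<eta> > 0\<close> by metis
  have lim: "(\<lambda>N. (b - a) / (real N - 1)) \<longlonglongrightarrow> 0"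
    by real_asymp
  then have "(\<lambda>N. (b - a) / (real N - 1) * \<bar>f b\<bar>) \<longlonglongrightarrow> 0" by (rule tendsto_mult_left_zero)
  then have "\<forall>\<^sub>F N in sequentially. (b - a) / (real N - 1) * \<bar>f b\<bar> < \<epsilon> / 2"
    by (rule order_tendstoD) (use \<open>\<epsilon> > 0\<close> in auto)
  moreover have "\<forall>\<^sub>F N in sequentially. (b - a) / (real N - 1) < d"
    using lim by (rule order_tendstoD) (use d in auto)
  moreover have "\<forall>\<^sub>F N in sequentially. N \<ge> 2" by (rule eventually_ge_at_top)
  ultimately have "\<forall>\<^sub>F N in sequentially. \<bar>riemann a b N f - integral {a..b} f\<bar> < \<epsilon>"
  proof eventually_elim
    case (elim N)
    define h where "h = (b - a) / (real N - 1)"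
    have h: "h > 0" "h < d" "(real N - 1) * h = b - a" using elim ab by (auto simp: h_def)
    have price: "price a b N (k + 1) = a + real k * h" for k by (simp add: price_def h_def)
    have main: "\<bar>integral {a..a + real n * h} f - h * (\<Sum>k<n. f (a + real k * h))\<bar> \<le> real n * h * \<eta>"
      if "n \<le> N - 1" for n
      using that
    proof (induction n)
      case (Suc n)
      let ?l = "a + real n * h" and ?r = "a + real (Suc n) * h"
      have lr: "a \<le> ?l" "?l \<le> ?r" using h by (auto simp: algebra_simps)
      have "real (Suc n) * h \<le> (real N - 1) * h" using Suc.prems h elim by (intro mult_right_mono) auto
      then have rb: "?r \<le> b" using h by simp
      have int: "f integrable_on {a..b}" using f integrable_continuous_real by blast
      have intr: "f integrable_on {a..?r}" "f integrable_on {?l..?r}"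
        using int lr rb by (auto intro: integrable_on_subinterval)
      have split: "integral {a..?r} f = integral {a..?l} f + integral {?l..?r} f"
        using Henstock_Kurzweil_Integration.integral_combine[OF lr intr(1)] by simp
      have "integral {?l..?r} f - h * f ?l = integral {?l..?r} (\<lambda>x. f x - f ?l)"
        using intr(2) lr by (subst integral_diff) (auto simp: algebra_simps)
      also have "\<bar>\<dots>\<bar> \<le> \<eta> * (?r - ?l)"
      proof (rule integral_bound[where f = "\<lambda>x. f x - f ?l", unfolded real_norm_def])
        have "{?l..?r} \<subseteq> {a..b}" using lr(1) rb by auto
        then show "continuous_on {?l..?r} (\<lambda>x. f x - f ?l)"
          by (intro continuous_intros continuous_on_subset[OF f])
        fix t assume t: "t \<in> {?l..?r}"
        have "?r = ?l + h" by (simp add: algebra_simps)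
        then have "\<bar>t - ?l\<bar> < d" using t h by auto
        moreover have "t \<in> {a..b}" "?l \<in> {a..b}" using t lr rb by auto
        ultimately show "\<bar>f t - f ?l\<bar> \<le> \<eta>" using d(2) by (meson less_imp_le)
      qed (rule lr)
      finally have "\<bar>integral {?l..?r} f - h * f ?l\<bar> \<le> \<eta> * h" by (simp add: algebra_simps)
      then show ?case using Suc split by (simp add: algebra_simps)
    qed simp
    have "a + real (N - 1) * h = b" using h elim by simp
    then have *: "\<bar>integral {a..b} f - h * (\<Sum>k<N - 1. f (a + real k * h))\<bar> \<le> \<epsilon> / 2"
    proof -
      have "real (N - 1) * h = b - a" using h elim by simp
      moreover have "(b - a) * \<eta> = \<epsilon> / 2" using ab by (simp add: \<eta>_def field_simps)
      ultimately have "real (N - 1) * h * \<eta> = \<epsilon> / 2" by simp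
      then show ?thesis using main[of "N - 1"] \<open>a + real (N - 1) * h = b\<close> by simp
    qed
    have "(\<Sum>k=1..N. f (price a b N k)) = (\<Sum>k<N. f (a + real k * h))"
      using price by (intro sum.reindex_bij_witness[of _ "\<lambda>k. k + 1" "\<lambda>k. k - 1"]) (auto simp: price_def h_def)
    also have "\<dots> = (\<Sum>k<N - 1. f (a + real k * h)) + f b"
      using elim \<open>a + real (N - 1) * h = b\<close> by (cases N) auto
    finally have "riemann a b N f = h * (\<Sum>k<N - 1. f (a + real k * h)) + h * f b"
      by (simp add: riemann_def h_def algebra_simps)
    moreover have "\<bar>h * f b\<bar> < \<epsilon> / 2" using elim h ab by (simp add: abs_mult h_def)
    ultimately show ?case using * by linarith
  qed
  then show "\<exists>N0. \<forall>N\<ge>N0. norm (riemann a b N f - integral {a..b} f) < \<epsilon>"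
    by (simp add: eventually_sequentially)
qed

lemma bern_1: "bern 1 1 1 x = 1"
  by (simp add: bern_def power2_eq_square algebra_simps)

lemma bern_mult_has_integral:
  assumes "l < r"
  shows "((\<lambda>x. bern p0 p1 p2 ((x - l) / (r - l)) * bern q0 q1 q2 ((x - l) / (r - l)))
    has_integral (r - l) * bern_ip p0 p1 p2 q0 q1 q2) {l..r}"
proof -
  define c1 where "c1 = 2 * (p1 - p0)"
  define c2 where "c2 = p0 - 2 * p1 + p2"
  define d1 where "d1 = 2 * (q1 - q0)"
  define d2 where "d2 = q0 - 2 * q1 + q2"
  define F where "F x = x * (p0 * q0) + x^2 * ((p0 * d1 + c1 * q0) / 2) + x^3 * ((p0 * d2 + c1 * d1 + c2 * q0) / 3)
    + x^4 * ((c1 * d2 + c2 * d1) / 4) + x^5 * (c2 * d2 / 5)" for x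
  have bp: "bern p0 p1 p2 x = p0 + c1 * x + c2 * x^2" for x
    by (simp add: bern_def c1_def c2_def power2_eq_square algebra_simps)
  have bq: "bern q0 q1 q2 x = q0 + d1 * x + d2 * x^2" for x
    by (simp add: bern_def d1_def d2_def power2_eq_square algebra_simps)
  have dF: "(F has_real_derivative bern p0 p1 p2 x * bern q0 q1 q2 x) (at x within S)" for x S
    unfolding F_def[abs_def] bp bq
    by (auto intro!: derivative_eq_intros simp: field_simps power2_eq_square power3_eq_cube power4_eq_xxxx)
  have "((\<lambda>x. (r - l) * F ((x - l) / (r - l))) has_vector_derivative
      bern p0 p1 p2 ((x - l) / (r - l)) * bern q0 q1 q2 ((x - l) / (r - l))) (at x within {l..r})" for x
    unfolding has_real_derivative_iff_has_vector_derivative[symmetric]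
    using assms by (auto intro!: derivative_eq_intros DERIV_chain2[OF dF])
  then have "((\<lambda>x. bern p0 p1 p2 ((x - l) / (r - l)) * bern q0 q1 q2 ((x - l) / (r - l))) has_integral
      (r - l) * F ((r - l) / (r - l)) - (r - l) * F ((l - l) / (r - l))) {l..r}"
    using assms by (intro fundamental_theorem_of_calculus) auto
  moreover have "F 1 = bern_ip p0 p1 p2 q0 q1 q2"
    by (simp add: F_def bern_ip_def c1_def c2_def d1_def d2_def field_simps)
  moreover have "F 0 = 0" by (simp add: F_def)
  ultimately show ?thesis using assms by simp
qed

section \<open>B-splines and their inner products\<close>

context knot_vector
begin

text \<open>For \<open>j \<le> K\<close> the function \<open>spl (unit j)\<close> is the quadratic
  B-spline of index \<open>j\<close>, normalised so that all of them add up to 1. It lives on the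
  intervals \<open>j - 1\<close>, \<open>j\<close> and \<open>j + 1\<close>.\<close>

definition unit :: "nat \<Rightarrow> nat \<Rightarrow> real" where
  "unit j k = (if k = j then 1 else 0)"

lemma has_integral_intervals:
  fixes f :: "real \<Rightarrow> real"
  assumes "\<And>t. t \<in> {1..<K} \<Longrightarrow> (f has_integral c t) {\<tau> t..\<tau> (t + 1)}"
  shows "(f has_integral (\<Sum>t\<in>{1..<K}. c t)) {a..b}"
proof -
  have "1 \<le> n \<Longrightarrow> n \<le> K \<Longrightarrow> (f has_integral (\<Sum>t\<in>{1..<n}. c t)) {\<tau> 1..\<tau> n}" for n
  proof (induction n rule: dec_induct)
    case (step n)
    then have "(f has_integral (\<Sum>t\<in>{1..<n}. c t) + c n) {\<tau> 1..\<tau> (Suc n)}"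
      using knot_le[of 1 n] knot_le[of n "Suc n"] assms[of n]
      by (intro has_integral_combine[of "\<tau> 1" "\<tau> n"]) auto
    then show ?case using step by simp
  qed (use has_integral_refl(2)[of f "\<tau> 1"] in simp)
  then show ?thesis using K ends by fastforce
qed

definition interval_ip :: "(nat \<Rightarrow> real) \<Rightarrow> (nat \<Rightarrow> real) \<Rightarrow> nat \<Rightarrow> real" where
  "interval_ip \<beta> \<gamma> t = bern_ip (knot_val \<beta> t) (\<beta> t) (knot_val \<beta> (t + 1)) (knot_val \<gamma> t) (\<gamma> t) (knot_val \<gamma> (t + 1))"

lemma spl_mult_has_integral:
  "((\<lambda>x. spl \<beta> x * spl \<gamma> x) has_integral (\<Sum>t\<in>{1..<K}. gap t * interval_ip \<beta> \<gamma> t)) {a..b}"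
proof (rule has_integral_intervals)
  fix t assume t: "t \<in> {1..<K}"
  have "((\<lambda>x. piece \<beta> t x * piece \<gamma> t x) has_integral gap t * interval_ip \<beta> \<gamma> t) {\<tau> t..\<tau> (t + 1)}"
    using bern_mult_has_integral[of "\<tau> t" "\<tau> (t + 1)"] gap_pos[OF t] gap_eq[OF t]
    by (simp add: piece_def interval_ip_def)
  then show "((\<lambda>x. spl \<beta> x * spl \<gamma> x) has_integral gap t * interval_ip \<beta> \<gamma> t) {\<tau> t..\<tau> (t + 1)}"
    by (rule has_integral_eq[rotated]) (simp only: spl_eq_piece[OF t])
qed

text \<open>Only the intervals in the support of B-spline \<open>j\<close> contribute. The case
  distinction keeps the truncated subtraction \<open>j - 1\<close> from naming interval
  \<open>j\<close> again when \<open>j = 0\<close>, and leaves out interval 0 when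
  \<open>j = 1\<close>.\<close>

lemma sum_interval_ip_unit:
  "(\<Sum>t\<in>{1..<K}. gap t * interval_ip \<beta> (unit j) t) =
     (if 2 \<le> j then gap (j - 1) * interval_ip \<beta> (unit j) (j - 1) else 0)
     + gap j * interval_ip \<beta> (unit j) j + gap (j + 1) * interval_ip \<beta> (unit j) (j + 1)"
proof -
  let ?g = "\<lambda>t. gap t * interval_ip \<beta> (unit j) t"
  have 0: "?g t = 0" if "t \<noteq> j" "t \<noteq> j + 1" "t + 1 \<noteq> j" "1 \<le> t" for t
    using that by (auto simp: interval_ip_def bern_ip_def knot_val_def unit_def)
  have 1: "?g t = 0" if "t \<notin> {1..<K}" for t using that by (auto simp: gap_def)
  have "(\<Sum>t\<in>{1..<K}. ?g t) = (\<Sum>t\<in>{1..<K} \<inter> {j - 1, j, j + 1}. ?g t)"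
    by (rule sum.mono_neutral_right) (use 0 in force)+
  also have "\<dots> = (\<Sum>t\<in>{j - 1, j, j + 1}. ?g t)"
    by (rule sum.mono_neutral_left) (simp, simp, use 1 in blast)
  also have "\<dots> = (if 2 \<le> j then ?g (j - 1) else 0) + ?g j + ?g (j + 1)"
    using 1[of 0] 1[of "j - 1"] by (cases j) auto
  finally show ?thesis .
qed

text \<open>A diagonal rescaling of the Gram matrix. The weight lies between 1 and 8/5 and comes
  close to 8/5 when interval \<open>k\<close> is much longer than both its neighbours. With the
  factor 3/5 the polynomial inequalities above hold for all values of the weights \<open>wt\<close>,
  that is, for all ratios of adjacent intervals.\<close>

definition bweight :: "nat \<Rightarrow> real" where
  "bweight k = 1 + 3/5 * (1 - wt k) * wt (k + 1)"

definition support :: "nat \<Rightarrow> real" where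
  "support j = (if 2 \<le> j then gap (j - 1) else 0) + gap j + gap (j + 1)"

lemma bweight_bounds: "1 \<le> bweight k" "bweight k \<le> 8/5"
proof -
  have "0 \<le> (1 - wt k) * wt (k + 1)" "(1 - wt k) * wt (k + 1) \<le> 1 * 1"
    using wt_nonneg[of k] wt_le_1[of k] wt_nonneg[of "k + 1"] wt_le_1[of "k + 1"]
    by (intro mult_nonneg_nonneg mult_mono; linarith)+
  then show "1 \<le> bweight k" "bweight k \<le> 8/5" unfolding bweight_def by linarith+
qed

lemma support_pos: "j \<le> K \<Longrightarrow> 0 < support j"
proof -
  assume "j \<le> K"
  then consider "j = 0" | "j = 1" "1 < K" | "2 \<le> j" "j - 1 \<in> {1..<K}" using K by fastforce
  then show ?thesis unfolding support_def using gap_nonneg gap_pos[of 1] gap_pos[of "j - 1"] K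
    by cases (auto intro: add_pos_nonneg add_nonneg_pos)
qed

text \<open>Without the weights \<open>bweight\<close> the Gram matrix fails to be diagonally dominant on strongly graded knots.\<close>

lemma gram_row:
  assumes j: "j \<le> K" and B: "0 \<le> B" and bound: "\<And>k. k \<le> K \<Longrightarrow> \<bar>\<beta> k\<bar> \<le> B * bweight k"
    and \<beta>j: "\<beta> j = B * bweight j"
  shows "B * support j / 300 \<le> (\<Sum>t\<in>{1..<K}. gap t * interval_ip \<beta> (unit j) t)"
proof -
  define u where "u = wt j"
  define v where "v = 1 - wt (j + 1)"
  define m where "m = wt (j - 1)"
  define n where "n = 1 - wt (j + 2)"
  \<comment> \<open>Missing neighbours get the value 0, which meets the required bounds; they occur
    only in terms multiplied by an interval length 0.\<close>
  define p where "p = (if 2 \<le> j then \<beta> (j - 2) else 0)"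
  define q where "q = (if 1 \<le> j then \<beta> (j - 1) else 0)"
  define s where "s = (if j + 1 \<le> K then \<beta> (j + 1) else 0)"
  define t where "t = (if j + 2 \<le> K then \<beta> (j + 2) else 0)"
  have uvmn: "0 \<le> u" "u \<le> 1" "0 \<le> v" "v \<le> 1" "0 \<le> m" "m \<le> 1" "0 \<le> n" "n \<le> 1"
    unfolding u_def v_def m_def n_def using wt_nonneg wt_le_1 by auto
  have w: "(1 - wt k) * x \<le> x" "(1 - x) * wt k \<le> 1 - x" if "0 \<le> x" "x \<le> 1" for k x
    using wt_nonneg[of k] wt_le_1[of k] that mult_right_le_one_le[of x "1 - wt k"] mult_left_le[of "wt k" "1 - x"]
    by (auto simp: mult.commute)
  have p: "\<bar>p\<bar> \<le> B * (1 + 3/5 * m)"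
  proof (cases "2 \<le> j")
    case True
    then have "\<bar>p\<bar> \<le> B * bweight (j - 2)" using bound[of "j - 2"] j by (simp add: p_def)
    moreover have "bweight (j - 2) \<le> 1 + 3/5 * m"
    proof -
      have "j - 2 + 1 = j - 1" using True by simp
      then have "bweight (j - 2) = 1 + 3/5 * ((1 - wt (j - 2)) * m)" by (simp add: bweight_def m_def)
      then show ?thesis using w(1)[OF uvmn(5,6), of "j - 2"] by linarith
    qed
    ultimately show ?thesis using B by (meson mult_left_mono order_trans)
  qed (use B uvmn in \<open>simp add: p_def\<close>)
  have q: "\<bar>q\<bar> \<le> B * (1 + 3/5 * (1 - m) * u)"
    using bound[of "j - 1"] j B uvmn by (auto simp: q_def bweight_def u_def m_def)
  have "0 \<le> B * (1 + 3/5 * (1 - n) * v)"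
    using B uvmn by (intro mult_nonneg_nonneg add_nonneg_nonneg) auto
  then have s: "\<bar>s\<bar> \<le> B * (1 + 3/5 * (1 - n) * v)"
    using bound[of "j + 1"] by (auto simp: s_def bweight_def v_def n_def algebra_simps)
  have t: "\<bar>t\<bar> \<le> B * (1 + 3/5 * n)"
  proof (cases "j + 2 \<le> K")
    case True
    then have "\<bar>t\<bar> \<le> B * bweight (j + 2)" using bound[of "j + 2"] j by (simp add: t_def)
    moreover have "bweight (j + 2) \<le> 1 + 3/5 * n"
    proof -
      have "bweight (j + 2) = 1 + 3/5 * ((1 - wt (j + 2)) * wt (j + 3))" by (simp add: bweight_def numeral_3_eq_3)
      moreover have "(1 - wt (j + 2)) * wt (j + 3) \<le> 1 - wt (j + 2)"
        by (rule w(2)[OF wt_nonneg wt_le_1])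
      ultimately show ?thesis by (simp add: n_def)
    qed
    ultimately show ?thesis using B by (meson mult_left_mono order_trans)
  qed (use B uvmn in \<open>simp add: t_def\<close>)
  have r: "\<beta> j = B * (1 + 3/5 * (1 - u) * (1 - v))"
    unfolding \<beta>j bweight_def u_def v_def by simp
  define a' where "a' = (if 2 \<le> j then gap (j - 1) else 0)"
  define A where "A = bern_ip ((1 - m) * p + m * q) q ((1 - u) * q + u * \<beta> j) 0 0 u"
  define M where "M = bern_ip ((1 - u) * q + u * \<beta> j) (\<beta> j) (v * \<beta> j + (1 - v) * s) u 1 v"
  define C where "C = bern_ip (v * \<beta> j + (1 - v) * s) s (n * s + (1 - n) * t) v 0 0"
  have row: "B * (u * (1-v) + (1-u) * (1-v) + v * (1-u)) / 300 \<le>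
     u * (1 - v) * A + (1 - u) * (1 - v) * M + v * (1 - u) * C"
    unfolding A_def M_def C_def by (rule row_scaled) (use uvmn p q s t r B in auto)
  have sum_eq: "(\<Sum>t\<in>{1..<K}. gap t * interval_ip \<beta> (unit j) t) = a' * A + gap j * M + gap (j + 1) * C"
  proof -
    have "a' * A = (if 2 \<le> j then gap (j - 1) * interval_ip \<beta> (unit j) (j - 1) else 0)"
      by (auto simp: a'_def A_def interval_ip_def knot_val_def unit_def u_def m_def p_def q_def numeral_2_eq_2)
    moreover have "gap j * M = gap j * interval_ip \<beta> (unit j) j"
      by (cases "j \<in> {1..<K}") (auto simp: M_def interval_ip_def knot_val_def unit_def u_def v_def q_def s_def gap_def)
    moreover have "gap (j + 1) * C = gap (j + 1) * interval_ip \<beta> (unit j) (j + 1)"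
      by (cases "j + 1 < K") (auto simp: C_def interval_ip_def knot_val_def unit_def v_def s_def t_def n_def gap_def)
    ultimately show ?thesis unfolding sum_interval_ip_unit by presburger
  qed
  have ga: "gap j * u = a' * (1 - u)"
    using wt_gap[of j] by (cases "2 \<le> j") (auto simp: u_def a'_def wt_def)
  have gc: "gap j * v = gap (j + 1) * (1 - v)"
    using wt_gap[of "j + 1"] by (auto simp: v_def)
  \<comment> \<open>For a proper interval \<open>j\<close> the three lengths are
    \<open>gap j / ((1 - u) * (1 - v))\<close> times those of \<open>row_scaled\<close>, and
    \<open>gap j > 0\<close> excludes \<open>u = 1\<close> and \<open>v = 1\<close>. For
    \<open>j = 0\<close> and \<open>j = K\<close> a single interval remains and \<open>row\<close>
    bounds its entry directly.\<close>
  have "B * (a' + gap j + gap (j + 1)) / 300 \<le> a' * A + gap j * M + gap (j + 1) * C"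
  proof (cases "j \<in> {1..<K}")
    case True
    then have gj: "gap j > 0" by (rule gap_pos)
    then have u1: "1 - u > 0" and v1: "1 - v > 0" using ga gc uvmn by (auto simp: less_le)
    have a': "a' = gap j * u / (1 - u)" and c': "gap (j + 1) = gap j * v / (1 - v)"
      using ga gc u1 v1 by (auto simp: field_simps)
    have "gap j / ((1 - u) * (1 - v)) * (B * (u * (1-v) + (1-u) * (1-v) + v * (1-u)) / 300) \<le>
      gap j / ((1 - u) * (1 - v)) * (u * (1 - v) * A + (1 - u) * (1 - v) * M + v * (1 - u) * C)"
      using row gj u1 v1 by (intro mult_left_mono) auto
    moreover have "gap j / ((1 - u) * (1 - v)) * (u * (1 - v) * A + (1 - u) * (1 - v) * M + v * (1 - u) * C)
      = a' * A + gap j * M + gap (j + 1) * C"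
      unfolding a' c' using u1 v1 by (simp add: divide_simps) (simp add: algebra_simps)
    moreover have "gap j / ((1 - u) * (1 - v)) * (B * (u * (1-v) + (1-u) * (1-v) + v * (1-u)) / 300)
      = B * (a' + gap j + gap (j + 1)) / 300"
      unfolding a' c' using u1 v1 by (simp add: divide_simps) (simp add: algebra_simps)
    ultimately show ?thesis by (simp only:)
  next
    case False
    then consider "j = 0" | "j = K" using j by fastforce
    then show ?thesis
    proof cases
      case 1
      then have "u = 0" "v = 1" "a' = 0" "gap j = 0" by (auto simp: u_def v_def a'_def wt_def gap_def)
      then show ?thesis using row gap_nonneg[of "j + 1"] mult_left_mono[of "B / 300" C "gap (j + 1)"]
        by (simp add: algebra_simps)
    next
      case 2
      then have "u = 1" "v = 0" "gap j = 0" "gap (j + 1) = 0" using K by (auto simp: u_def v_def wt_def gap_def)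
      moreover have "a' \<ge> 0" using gap_nonneg by (simp add: a'_def)
      ultimately show ?thesis using row mult_left_mono[of "B / 300" A "a'"]
        by (simp add: algebra_simps)
    qed
  qed
  then show ?thesis unfolding sum_eq support_def a'_def .
qed

text \<open>The coefficients 0 and 1 are within 1/2 of 1/2, and \<open>spl_close\<close> preserves
  this distance.\<close>

lemma spl_unit_nonneg: "x \<in> {a..b} \<Longrightarrow> 0 \<le> spl (unit j) x"
  and spl_unit_le_1: "x \<in> {a..b} \<Longrightarrow> spl (unit j) x \<le> 1"
proof -
  assume x: "x \<in> {a..b}"
  have "\<bar>spl (unit j) x - 1/2\<bar> \<le> 1/2"
    by (rule spl_close[OF locate_interval[OF x]]) (auto simp: unit_def)
  then show "0 \<le> spl (unit j) x" "spl (unit j) x \<le> 1" by linarith+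
qed

lemma integral_spl_unit: "integral {a..b} (spl (unit j)) \<le> support j"
proof -
  have kv: "knot_val (\<lambda>_. 1) t = 1" for t by (simp add: knot_val_def)
  have one: "spl (\<lambda>_. 1) x = 1" for x by (simp add: spl_def piece_def kv bern_1)
  have ip: "interval_ip (\<lambda>_. 1) (unit j) t \<le> 1" for t
  proof -
    have "unit j t \<le> 1" for t by (simp add: unit_def)
    moreover have "knot_val (unit j) t \<le> 1" for t
      using wt_nonneg[of t] wt_le_1[of t] by (auto simp: knot_val_def unit_def)
    moreover have "bern_ip 1 1 1 x y z \<le> 1" if "x \<le> 1" "y \<le> 1" "z \<le> 1" for x y z
      using that by (simp add: bern_ip_def)
    ultimately show ?thesis unfolding interval_ip_def kv by blast
  qed
  have "(spl (unit j) has_integral (\<Sum>t\<in>{1..<K}. gap t * interval_ip (\<lambda>_. 1) (unit j) t)) {a..b}"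
    using spl_mult_has_integral[of "\<lambda>_. 1" "unit j"] by (simp add: one)
  then have "integral {a..b} (spl (unit j)) = (\<Sum>t\<in>{1..<K}. gap t * interval_ip (\<lambda>_. 1) (unit j) t)"
    by (rule integral_unique)
  also have "\<dots> \<le> support j"
    unfolding sum_interval_ip_unit support_def
    using mult_left_mono[OF ip gap_nonneg] by (intro add_mono) auto
  finally show ?thesis .
qed

lemma spl_eq_sum:
  assumes "x \<in> {a..b}"
  shows "spl \<beta> x = (\<Sum>k\<le>K. \<beta> k * spl (unit k) x)"
proof -
  have val: "\<beta> t = (\<Sum>k\<le>K. \<beta> k * unit k t)" if "t \<le> K" for t
    using that by (simp add: unit_def if_distrib cong: if_cong)
  have kv: "knot_val \<beta> t = (\<Sum>k\<le>K. \<beta> k * knot_val (unit k) t)" if "t \<le> K" for t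
    unfolding knot_val_def using val[of t] val[of "t - 1"] that
    by (simp add: sum_distrib_left sum.distrib sum_subtractf algebra_simps)
  have t: "locate x \<in> {1..<K}" using locate_interval[OF assms] by blast
  show ?thesis unfolding spl_def piece_def bern_def
    using kv[of "locate x"] kv[of "locate x + 1"] val[of "locate x"] t
    by (simp add: sum_distrib_left sum_distrib_right sum.distrib sum_subtractf algebra_simps)
qed

text \<open>The coefficient that is largest relative to its weight dominates its row, so some moment
  is at least \<open>B * support j / 300\<close>; replacing integrals by sampled sums costs at most
  half of this. The constant 1000 exceeds \<open>600 * (8/5)\<close> and is the same for all knots;
  only the threshold for \<open>N\<close> is not.\<close>

lemma spl_sup_bound:
  "\<forall>\<^sub>F N in sequentially. \<forall>\<beta> \<epsilon>. (\<forall>j\<le>K. \<bar>riemann a b N (\<lambda>x. spl \<beta> x * spl (unit j) x)\<bar> \<le> \<epsilon> * support j)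
     \<longrightarrow> (\<forall>x\<in>{a..b}. \<bar>spl \<beta> x\<bar> \<le> 1000 * \<epsilon>)"
proof -
  define m where "m = Min (support ` {..K})"
  have m: "0 < m" "\<And>j. j \<le> K \<Longrightarrow> m \<le> support j"
    using support_pos by (auto simp: m_def)
  \<comment> \<open>The \<open>K + 1\<close> sampling errors, each multiplied by a coefficient of
    size at most \<open>B * (8/5)\<close>, then add up to at most
    \<open>B * m / 600\<close>.\<close>
  define \<eta> where "\<eta> = m / (600 * (8/5) * (real K + 1))"
  have \<eta>: "0 < \<eta>" using m by (simp add: \<eta>_def)
  let ?I = "\<lambda>k j. integral {a..b} (\<lambda>x. spl (unit k) x * spl (unit j) x)"
  let ?R = "\<lambda>N k j. riemann a b N (\<lambda>x. spl (unit k) x * spl (unit j) x)"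
  have "\<forall>\<^sub>F N in sequentially. \<bar>?R N k j - ?I k j\<bar> < \<eta>" for k j
    using tendstoD[OF riemann_tendsto_integral[OF a_less_b] \<eta>] continuous_on_spl
    by (simp add: dist_real_def continuous_on_mult)
  then have "\<forall>\<^sub>F N in sequentially. \<forall>k\<in>{..K}. \<forall>j\<in>{..K}. \<bar>?R N k j - ?I k j\<bar> < \<eta>"
    by (simp add: eventually_ball_finite)
  moreover have "\<forall>\<^sub>F N in sequentially. N \<ge> 2" by (rule eventually_ge_at_top)
  ultimately show ?thesis
  proof eventually_elim
    case (elim N)
    show ?case
    proof (intro allI impI)
      fix \<beta> \<epsilon> assume *: "\<forall>j\<le>K. \<bar>riemann a b N (\<lambda>x. spl \<beta> x * spl (unit j) x)\<bar> \<le> \<epsilon> * support j"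
      define B where "B = Max ((\<lambda>k. \<bar>\<beta> k\<bar> / bweight k) ` {..K})"
      have "B \<in> (\<lambda>k. \<bar>\<beta> k\<bar> / bweight k) ` {..K}" unfolding B_def by (rule Max_in) auto
      then obtain j where j: "j \<le> K" "B = \<bar>\<beta> j\<bar> / bweight j" by auto
      have w: "bweight k > 0" for k using bweight_bounds(1)[of k] by linarith
      have "0 \<le> B" using j w[of j] by simp
      have bound: "\<bar>\<beta> k\<bar> \<le> B * bweight k" if "k \<le> K" for k
      proof -
        have "\<bar>\<beta> k\<bar> / bweight k \<le> B" unfolding B_def using that by (intro Max_ge) auto
        then show ?thesis using w[of k] by (simp add: field_simps)
      qed
      \<comment> \<open>The sign makes the extremal coefficient equal to
        \<open>B * bweight j\<close>, as \<open>gram_row\<close> requires.\<close>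
      define \<sigma> :: real where "\<sigma> = (if \<beta> j \<ge> 0 then 1 else -1)"
      define \<gamma> where "\<gamma> k = \<sigma> * \<beta> k" for k
      have \<gamma>: "\<bar>\<gamma> k\<bar> = \<bar>\<beta> k\<bar>" "\<gamma> j = B * bweight j" for k
        using j w[of j] by (auto simp: \<gamma>_def \<sigma>_def)
      have spl_\<gamma>: "spl \<gamma> x = \<sigma> * spl \<beta> x" for x
        using spl_linear[of \<sigma> \<beta> 0 "\<lambda>_. 0" x] by (simp add: \<gamma>_def[abs_def])
      let ?f = "\<lambda>x. spl \<gamma> x * spl (unit j) x"
      have f_eq: "?f x = (\<Sum>k\<le>K. \<gamma> k * (spl (unit k) x * spl (unit j) x))" if "x \<in> {a..b}" for x
        using spl_eq_sum[OF that, of \<gamma>] by (simp add: sum_distrib_right mult.assoc)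
      have "B * support j / 300 \<le> integral {a..b} ?f"
        using gram_row[where \<beta> = \<gamma>, OF j(1) \<open>0 \<le> B\<close> _ \<gamma>(2)] bound \<gamma>(1) integral_unique[OF spl_mult_has_integral] by simp
      also have "integral {a..b} ?f = integral {a..b} (\<lambda>x. \<Sum>k\<le>K. \<gamma> k * (spl (unit k) x * spl (unit j) x))"
        using f_eq by (rule integral_cong)
      also have "\<dots> = (\<Sum>k\<le>K. \<gamma> k * ?I k j)"
        by (subst integral_sum) (auto intro!: integrable_continuous_real continuous_intros continuous_on_spl)
      finally have 1: "B * support j / 300 \<le> (\<Sum>k\<le>K. \<gamma> k * ?I k j)" .
      have "riemann a b N ?f = riemann a b N (\<lambda>x. \<Sum>k\<le>K. \<gamma> k * (spl (unit k) x * spl (unit j) x))"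
        using f_eq by (rule riemann_cong[OF a_less_b elim(2)])
      then have 2: "riemann a b N ?f = (\<Sum>k\<le>K. \<gamma> k * ?R N k j)" by (simp add: riemann_sum riemann_mult)
      have "\<bar>(\<Sum>k\<le>K. \<gamma> k * ?I k j) - (\<Sum>k\<le>K. \<gamma> k * ?R N k j)\<bar> = \<bar>\<Sum>k\<le>K. \<gamma> k * (?I k j - ?R N k j)\<bar>"
        by (simp add: sum_subtractf algebra_simps)
      also have "\<dots> \<le> (\<Sum>k\<le>K. \<bar>\<gamma> k * (?I k j - ?R N k j)\<bar>)" by (rule sum_abs)
      also have "\<dots> \<le> (\<Sum>k\<le>K. (B * (8/5)) * \<eta>)"
        unfolding abs_mult
      proof (intro sum_mono mult_mono)
        fix k assume "k \<in> {..K}"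
        then have k: "k \<le> K" by simp
        show "\<bar>\<gamma> k\<bar> \<le> B * (8/5)"
          using bound[OF k] mult_left_mono[OF bweight_bounds(2)[of k] \<open>0 \<le> B\<close>] \<gamma>(1)[of k] by linarith
        show "\<bar>?I k j - ?R N k j\<bar> \<le> \<eta>" using elim(1) k j(1) by (force simp: abs_minus_commute intro: less_imp_le)
      qed (use \<open>0 \<le> B\<close> in auto)
      also have "\<dots> = B * m / 600" by (simp add: \<eta>_def field_simps)
      also have "\<dots> \<le> B * support j / 600" using m(2)[OF j(1)] \<open>0 \<le> B\<close> by (simp add: mult_left_mono)
      finally have "B * support j / 600 \<le> riemann a b N ?f" using 1 2 by linarith
      also have "\<dots> = \<sigma> * riemann a b N (\<lambda>x. spl \<beta> x * spl (unit j) x)"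
        unfolding spl_\<gamma> mult.assoc by (rule riemann_mult)
      also have "\<dots> \<le> \<bar>riemann a b N (\<lambda>x. spl \<beta> x * spl (unit j) x)\<bar>" by (auto simp: \<sigma>_def)
      also have "\<dots> \<le> \<epsilon> * support j" using * j(1) by blast
      finally have "B / 600 * support j \<le> \<epsilon> * support j" by simp
      then have B: "B \<le> 600 * \<epsilon>" using support_pos[OF j(1)] by (simp add: field_simps)
      show "\<forall>x\<in>{a..b}. \<bar>spl \<beta> x\<bar> \<le> 1000 * \<epsilon>"
      proof
        fix x assume "x \<in> {a..b}"
        note loc = locate_interval[OF this]
        have "\<bar>spl \<beta> x - 0\<bar> \<le> B * (8/5)"
        proof (rule spl_close[OF loc])
          fix k assume "k \<in> {locate x - 1, locate x, locate x + 1}"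
          then have "k \<le> K" using loc(1) by auto
          then show "\<bar>\<beta> k - 0\<bar> \<le> B * (8/5)"
            using bound[of k] mult_left_mono[OF bweight_bounds(2)[of k] \<open>0 \<le> B\<close>] by linarith
        qed
        then show "\<bar>spl \<beta> x\<bar> \<le> 1000 * \<epsilon>" using B \<open>0 \<le> B\<close> by linarith
      qed
    qed
  qed
qed

end

section \<open>Cubic splines and quasi-interpolation\<close>

lemma C1_on_cong:
  fixes a b :: real
  assumes "a < b" "C1_on {a..b} f" "\<And>x. x \<in> {a..b} \<Longrightarrow> g x = f x"
  shows "C1_on {a..b} g"
proof (rule C1_onI[OF assms(1), of _ "deriv_on {a..b} f"])
  fix x assume x: "x \<in> {a..b}"
  show "(g has_real_derivative deriv_on {a..b} f x) (at x within {a..b})"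
    by (rule has_field_derivative_transform_within[OF C1_onD[OF assms(2) x] zero_less_one x])
      (simp add: assms(3))
qed (use assms(2) in \<open>simp add: C1_on_def\<close>)

lemma C1_on_linear:
  fixes a b :: real
  assumes ab: "a < b" and f: "C1_on {a..b} f" and g: "C1_on {a..b} g"
  shows "C1_on {a..b} (\<lambda>x. f x + t * g x)"
    and "x \<in> {a..b} \<Longrightarrow> deriv_on {a..b} (\<lambda>x. f x + t * g x) x = deriv_on {a..b} f x + t * deriv_on {a..b} g x"
proof -
  have d: "((\<lambda>x. f x + t * g x) has_real_derivative deriv_on {a..b} f x + t * deriv_on {a..b} g x) (at x within {a..b})"
    if "x \<in> {a..b}" for x
    using C1_onD[OF f that] C1_onD[OF g that] by (auto intro!: derivative_eq_intros)
  show "C1_on {a..b} (\<lambda>x. f x + t * g x)"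
    by (rule C1_onI[OF ab d]) (use f g in \<open>auto simp: C1_on_def intro!: continuous_intros\<close>)
  show "x \<in> {a..b} \<Longrightarrow> deriv_on {a..b} (\<lambda>x. f x + t * g x) x = deriv_on {a..b} f x + t * deriv_on {a..b} g x"
    by (rule deriv_on_eqI[OF ab _ d])
qed

lemma poly_degree_2:
  fixes r :: "real poly"
  assumes "degree r \<le> 2"
  shows "poly r x = coeff r 0 + coeff r 1 * x + coeff r 2 * x\<^sup>2"
proof -
  have "poly r x = (\<Sum>i\<le>2. coeff r i * x ^ i)"
    unfolding poly_altdef using assms by (intro sum.mono_neutral_left) (auto simp: coeff_eq_0)
  then show ?thesis by (simp add: numeral_2_eq_2)
qed

lemma poly_degree_3:
  fixes r :: "real poly"
  assumes "degree r \<le> 3"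
  shows "poly r x = coeff r 0 + coeff r 1 * x + coeff r 2 * x\<^sup>2 + coeff r 3 * x ^ 3"
proof -
  have "poly r x = (\<Sum>i\<le>3. coeff r i * x ^ i)"
    unfolding poly_altdef using assms by (intro sum.mono_neutral_left) (auto simp: coeff_eq_0)
  then show ?thesis by (simp add: eval_nat_numeral)
qed

context knot_vector
begin

lemma cubic_spline_linear:
  assumes "cubic_spline K \<tau> r" "cubic_spline K \<tau> v"
  shows "cubic_spline K \<tau> (\<lambda>x. r x + t * v x)"
proof -
  note [simp] = ends(1)[simplified] ends(2)
  have C: "C2_on {a..b} r" "C2_on {a..b} v" using assms by (auto simp: cubic_spline_def)
  have "C1_on {a..b} (\<lambda>x. deriv_on {a..b} r x + t * deriv_on {a..b} v x)"
    using C by (intro C1_on_linear[OF a_less_b]) (auto simp: C2_on_def)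
  then have "C1_on {a..b} (deriv_on {a..b} (\<lambda>x. r x + t * v x))"
    by (rule C1_on_cong[OF a_less_b]) (use C in \<open>auto simp: C2_on_def C1_on_linear[OF a_less_b]\<close>)
  then have "C2_on {a..b} (\<lambda>x. r x + t * v x)"
    using C by (auto simp: C2_on_def intro: C1_on_linear[OF a_less_b])
  moreover have "\<exists>q :: real poly. degree q \<le> 3 \<and> (\<forall>x\<in>{\<tau> i..\<tau> (i + 1)}. r x + t * v x = poly q x)"
    if "i \<in> {1..<K}" for i
  proof -
    from that assms obtain q q' :: "real poly" where q: "degree q \<le> 3" "degree q' \<le> 3"
      "\<And>x. x \<in> {\<tau> i..\<tau> (i + 1)} \<Longrightarrow> r x = poly q x" "\<And>x. x \<in> {\<tau> i..\<tau> (i + 1)} \<Longrightarrow> v x = poly q' x"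
      unfolding cubic_spline_def by meson
    have "degree (q + smult t q') \<le> 3" using q by (intro degree_add_le) auto
    then show ?thesis using q by (intro exI[of _ "q + smult t q'"]) auto
  qed
  ultimately show ?thesis unfolding cubic_spline_def by simp
qed

text \<open>This is how the competitor and the test functions are obtained. On one interval
  \<open>P\<close>, in the local variable \<open>x - \<tau> t\<close>, is an explicit cubic
  antiderivative of the piece, so \<open>g\<close> differs from it by a constant.\<close>

lemma cubic_splineI:
  assumes "\<And>x. x \<in> {a..b} \<Longrightarrow> (g has_real_derivative spl \<beta> x) (at x within {a..b})"
  shows "cubic_spline K \<tau> g"
proof -
  note [simp] = ends(1)[simplified] ends(2)
  have d: "deriv_on {a..b} g x = spl \<beta> x" if "x \<in> {a..b}" for x
    using deriv_on_eqI[OF a_less_b that assms[OF that]] .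
  have "C1_on {a..b} g" by (rule C1_onI[OF a_less_b assms continuous_on_spl])
  moreover have "C1_on {a..b} (deriv_on {a..b} g)" by (rule C1_on_cong[OF a_less_b C1_on_spl d])
  ultimately have "C2_on {a..b} g" by (simp add: C2_on_def)
  moreover have "\<exists>q :: real poly. degree q \<le> 3 \<and> (\<forall>x\<in>{\<tau> t..\<tau> (t + 1)}. g x = poly q x)"
    if t: "t \<in> {1..<K}" for t
  proof -
    let ?I = "{\<tau> t..\<tau> (t + 1)}"
    define A where "A = knot_val \<beta> t"
    define B where "B = \<beta> t - A"
    define C where "C = A - 2 * \<beta> t + knot_val \<beta> (t + 1)"
    define P where "P = (\<lambda>y. A * y + B / gap t * y^2 + C / (3 * (gap t)^2) * y^3)"
    have g0: "gap t > 0" using gap_pos[OF t] .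
    have P: "(P has_real_derivative piece \<beta> t (y + \<tau> t)) (at y within S)" for y S
      unfolding P_def piece_def bern_def using g0
      by (auto intro!: derivative_eq_intros simp: A_def B_def C_def field_simps power2_eq_square)
    have "((\<lambda>x. g x - P (x - \<tau> t)) has_real_derivative 0) (at x within ?I)" if x: "x \<in> ?I" for x
    proof -
      have "(g has_real_derivative piece \<beta> t x) (at x within ?I)"
        using DERIV_subset[OF assms interval_subset[OF t], of x] x interval_subset[OF t] spl_eq_piece[OF t x] by auto
      moreover have "((\<lambda>x. P (x - \<tau> t)) has_real_derivative piece \<beta> t x) (at x within ?I)"
      proof -
        have "((\<lambda>x. x - \<tau> t) has_real_derivative 1) (at x within ?I)" by (auto intro!: derivative_eq_intros)
        then show ?thesis
          using DERIV_chain2[of P "piece \<beta> t x" "\<lambda>x. x - \<tau> t" x 1 ?I] P[of "x - \<tau> t" UNIV] by simp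
      qed
      ultimately show ?thesis by (auto intro!: derivative_eq_intros)
    qed
    then obtain k where k: "\<And>x. x \<in> ?I \<Longrightarrow> g x - P (x - \<tau> t) = k"
      using has_field_derivative_zero_constant[of ?I "\<lambda>x. g x - P (x - \<tau> t)"] by auto
    define q where "q = pcompose [:k, A, B / gap t, C / (3 * (gap t)^2):] [:- \<tau> t, 1:]"
    have "degree q \<le> degree [:k, A, B / gap t, C / (3 * (gap t)^2):] * degree [:- \<tau> t, 1:]"
      unfolding q_def by (rule degree_pcompose_le)
    also have "\<dots> \<le> 3" by simp
    finally have "degree q \<le> 3" .
    moreover have "g x = poly q x" if "x \<in> ?I" for x
      using k[OF that] by (simp add: q_def poly_pcompose P_def algebra_simps power2_eq_square power3_eq_cube)
    ultimately show ?thesis by blast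
  qed
  ultimately show ?thesis unfolding cubic_spline_def by simp
qed

text \<open>The derivative of a cubic spline is a differentiable quadratic spline, hence fixed by
  the projection; this also supplies its B-spline coefficients.\<close>

lemma cubic_spline_deriv:
  assumes s: "cubic_spline K \<tau> s" and x: "x \<in> {a..b}"
  shows "spl (lam (deriv_on {a..b} s)) x = deriv_on {a..b} s x"
proof (rule spl_lam[OF _ _ x])
  note [simp] = ends(1)[simplified] ends(2)
  have C: "C1_on {a..b} s" "C1_on {a..b} (deriv_on {a..b} s)"
    using s by (auto simp: cubic_spline_def C2_on_def)
  show "\<exists>y. (deriv_on {a..b} s has_real_derivative y) (at x within {a..b})" if "x \<in> {a..b}" for x
    using C1_onD[OF C(2) that] by blast
  fix t assume t: "t \<in> {1..<K}"
  from s t obtain q :: "real poly" where q: "degree q \<le> 3" "\<And>x. x \<in> {\<tau> t..\<tau> (t + 1)} \<Longrightarrow> s x = poly q x"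
    unfolding cubic_spline_def by blast
  have lt: "\<tau> t < \<tau> (t + 1)" using t by (intro knot_less) auto
  have "deriv_on {a..b} s x = poly (pderiv q) x" if x: "x \<in> {\<tau> t..\<tau> (t + 1)}" for x
  proof -
    have "(s has_real_derivative deriv_on {a..b} s x) (at x within {\<tau> t..\<tau> (t + 1)})"
      using DERIV_subset[OF C1_onD[OF C(1)] interval_subset[OF t]] x interval_subset[OF t] by blast
    then have "(poly q has_real_derivative deriv_on {a..b} s x) (at x within {\<tau> t..\<tau> (t + 1)})"
      by (rule has_field_derivative_transform_within[OF _ zero_less_one x]) (rule q(2))
    moreover have "(poly q has_real_derivative poly (pderiv q) x) (at x within {\<tau> t..\<tau> (t + 1)})"
      using poly_DERIV has_field_derivative_at_within by blast
    ultimately show ?thesis using deriv_on_eqI[OF lt x] by metis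
  qed
  moreover have "degree (pderiv q) \<le> 2" using q(1) by (simp add: degree_pderiv)
  ultimately show "\<exists>c0 c1 c2. \<forall>x\<in>{\<tau> t..\<tau> (t + 1)}. deriv_on {a..b} s x = c0 + c1 * x + c2 * x\<^sup>2"
    using poly_degree_2[of "pderiv q"] by (intro exI[of _ "coeff (pderiv q) 0"] exI[of _ "coeff (pderiv q) 1"]
      exI[of _ "coeff (pderiv q) 2"]) simp
qed

lemma gap_le_mesh: "gap t \<le> mesh K \<tau>" and mesh_pos: "0 < mesh K \<tau>" and ex_gap_eq_mesh: "\<exists>t\<in>{1..<K}. gap t = mesh K \<tau>"
  and mesh_le: "mesh K \<tau> \<le> b - a"
proof -
  have m: "mesh K \<tau> = Max (gap ` {1..<K})" unfolding mesh_def by (rule arg_cong[where f = Max]) (auto simp: gap_def)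
  have "mesh K \<tau> \<in> gap ` {1..<K}" unfolding m using K by (intro Max_in) auto
  then obtain t where t: "t \<in> {1..<K}" "mesh K \<tau> = gap t" by blast
  then show "\<exists>t\<in>{1..<K}. gap t = mesh K \<tau>" and pos: "0 < mesh K \<tau>" using gap_pos by auto
  show "mesh K \<tau> \<le> b - a" using interval_subset[OF t(1)] t gap_eq[OF t(1)] gap_pos[OF t(1)] by simp
  show "gap t \<le> mesh K \<tau>" for t
  proof (cases "t \<in> {1..<K}")
    case True
    then show ?thesis unfolding m by (intro Max_ge) auto
  qed (use pos in \<open>auto simp: gap_def\<close>)
qed

text \<open>At a point of interval \<open>t\<close> only the coefficients \<open>t - 1\<close>,
  \<open>t\<close> and \<open>t + 1\<close> matter. They sample \<open>f\<close> on this interval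
  and its neighbours, whose points are within twice the mesh of \<open>x\<close>; the factor 3 is
  that of \<open>lam_bound\<close>.\<close>

lemma quasi_local:
  assumes x: "x \<in> {a..b}" and f: "\<And>y. y \<in> {a..b} \<Longrightarrow> \<bar>y - x\<bar> \<le> 2 * mesh K \<tau> \<Longrightarrow> \<bar>f y - z\<bar> \<le> r"
  shows "\<bar>spl (lam f) x - z\<bar> \<le> 3 * r"
proof -
  define t where "t = locate x"
  have t: "t \<in> {1..<K}" "x \<in> {\<tau> t..\<tau> (t + 1)}" unfolding t_def using locate_interval[OF x] by auto
  have step: "\<tau> (i + 1) \<le> \<tau> i + mesh K \<tau>" if "i \<in> {1..<K}" for i
    using gap_le_mesh[of i] gap_eq[OF that] by linarith
  have m: "0 < mesh K \<tau>" by (rule mesh_pos)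
  show ?thesis
  proof (rule spl_close[OF t])
    fix k assume k: "k \<in> {t - 1, t, t + 1}"
    show "\<bar>lam f k - z\<bar> \<le> 3 * r"
    proof (rule lam_bound)
      show "k \<le> K" using k t by auto
      fix y assume y: "y \<in> {\<tau> (max 1 k)..\<tau> (min K (k + 1))}"
      have "\<tau> (max 1 (t - 1)) \<le> \<tau> (max 1 k)" "\<tau> (min K (k + 1)) \<le> \<tau> (min K (t + 2))"
        using k t by (intro knot_le; force)+
      moreover have "\<tau> t - mesh K \<tau> \<le> \<tau> (max 1 (t - 1))"
      proof (cases "t = 1")
        case False
        then have t': "t - 1 \<in> {1..<K}" "t - 1 + 1 = t" "max 1 (t - 1) = t - 1" using t(1) by auto
        then show ?thesis using step[OF t'(1)] unfolding t'(2,3) by simp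
      qed (use m in simp)
      moreover have "\<tau> (min K (t + 2)) \<le> \<tau> (t + 1) + mesh K \<tau>"
      proof (cases "t + 1 = K")
        case False
        then have "t + 1 \<in> {1..<K}" "min K (t + 2) = t + 1 + 1" using t(1) by auto
        then show ?thesis using step[of "t + 1"] by simp
      qed (use m in \<open>simp add: min_def\<close>)
      moreover have "\<tau> (t + 1) \<le> \<tau> t + mesh K \<tau>" using step[OF t(1)] .
      moreover have "\<tau> (max 1 k) \<le> y" "y \<le> \<tau> (min K (k + 1))" "\<tau> t \<le> x" "x \<le> \<tau> (t + 1)"
        using y t(2) by auto
      ultimately have "\<bar>y - x\<bar> \<le> 2 * mesh K \<tau>" by linarith
      moreover have "a \<le> \<tau> (max 1 k)" "\<tau> (min K (k + 1)) \<le> b"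
        using knot_le[of 1 "max 1 k"] knot_le[of "min K (k + 1)" K] k t ends by auto
      ultimately show "\<bar>f y - z\<bar> \<le> r" using y by (intro f) auto
    qed
  qed
qed

lemma spl_lam_linear: "spl (lam (\<lambda>p. x * f p + y * g p)) p = x * spl (lam f) p + y * spl (lam g) p"
proof -
  have "lam (\<lambda>p. x * f p + y * g p) = (\<lambda>k. x * lam f k + y * lam g k)" by (rule ext) (rule lam_linear)
  then show ?thesis by (simp only: spl_linear)
qed

text \<open>The quadratic Taylor polynomial \<open>p\<close> at \<open>x\<close> is reproduced and
  agrees with \<open>f\<close> at \<open>x\<close>, so only the remainder is quasi-interpolated.
  \<open>field_Taylor\<close> divides by \<open>fact 2\<close>, and
  \<open>3 * 2 ^ 3 / 2 = 12\<close>.\<close>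

lemma quasi_order3:
  assumes d: "\<And>x. x \<in> {a..b} \<Longrightarrow> (f has_real_derivative f1 x) (at x within {a..b})"
    "\<And>x. x \<in> {a..b} \<Longrightarrow> (f1 has_real_derivative f2 x) (at x within {a..b})"
    "\<And>x. x \<in> {a..b} \<Longrightarrow> (f2 has_real_derivative f3 x) (at x within {a..b})"
    and M: "\<And>x. x \<in> {a..b} \<Longrightarrow> \<bar>f3 x\<bar> \<le> M" and x: "x \<in> {a..b}"
  shows "\<bar>spl (lam f) x - f x\<bar> \<le> 12 * M * mesh K \<tau> ^ 3"
proof -
  define p where "p y = f x + f1 x * (y - x) + f2 x * (y - x)\<^sup>2 / 2" for y
  define F where "F i = (if i = 0 then f else if i = 1 then f1 else if i = 2 then f2 else f3)" for i :: nat
  have "0 \<le> M" using M[OF x] by linarith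
  have taylor: "\<bar>f y - p y\<bar> \<le> M * \<bar>y - x\<bar> ^ 3 / 2" if "y \<in> {a..b}" for y
  proof -
    have "norm (F 0 y - (\<Sum>i\<le>2. F i x * (y - x) ^ i / fact i)) \<le> M * norm (y - x) ^ Suc 2 / fact 2"
    proof (rule field_Taylor[of "{a..b}"])
      fix i :: nat and z assume "z \<in> {a..b}" "i \<le> 2"
      then consider "i = 0" | "i = 1" | "i = 2" by linarith
      then show "(F i has_real_derivative F (Suc i) z) (at z within {a..b})"
        using d \<open>z \<in> {a..b}\<close> by cases (auto simp: F_def)
    qed (use M x that in \<open>auto simp: F_def\<close>)
    then show ?thesis by (simp add: F_def p_def numeral_2_eq_2 eval_nat_numeral)
  qed
  have pp: "spl (lam p) x = p x"
  proof (rule spl_lam[OF _ _ x])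
    show "\<exists>c0 c1 c2. \<forall>y\<in>{\<tau> t..\<tau> (t + 1)}. p y = c0 + c1 * y + c2 * y\<^sup>2" for t
      by (rule exI[of _ "f x - f1 x * x + f2 x * x^2 / 2"], rule exI[of _ "f1 x - f2 x * x"], rule exI[of _ "f2 x / 2"])
        (simp add: p_def field_simps power2_eq_square)
    show "\<exists>z. (p has_real_derivative z) (at y within {a..b})" for y
      unfolding p_def[abs_def] by (rule exI) (auto intro!: derivative_eq_intros)
  qed
  have "p x = f x" by (simp add: p_def)
  then have "spl (lam f) x - f x = spl (lam (\<lambda>y. f y - p y)) x - 0"
    using spl_lam_linear[of 1 f "-1" p x] pp by simp
  also have "\<bar>\<dots>\<bar> \<le> 3 * (M * (2 * mesh K \<tau>) ^ 3 / 2)"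
  proof (rule quasi_local[OF x])
    fix y assume y: "y \<in> {a..b}" "\<bar>y - x\<bar> \<le> 2 * mesh K \<tau>"
    have "M * \<bar>y - x\<bar> ^ 3 \<le> M * (2 * mesh K \<tau>) ^ 3"
      using y \<open>0 \<le> M\<close> by (intro mult_left_mono power_mono) auto
    then show "\<bar>f y - p y - 0\<bar> \<le> M * (2 * mesh K \<tau>) ^ 3 / 2" using taylor[OF y(1)] by simp
  qed
  finally show ?thesis by (simp add: power_mult_distrib)
qed

end

section \<open>Forward differences\<close>

definition fd :: "real \<Rightarrow> (real \<Rightarrow> real) \<Rightarrow> real \<Rightarrow> real" where
  "fd h f x = f (x + h) - f x"

lemma fd_power_DERIV:
  assumes "\<And>y. y \<in> {x..x + real k * h} \<Longrightarrow> (f has_real_derivative f' y) (at y)" "0 \<le> h"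
  shows "((fd h ^^ k) f has_real_derivative (fd h ^^ k) f' x) (at x)"
  using assms(1)
proof (induction k arbitrary: x)
  case (Suc k)
  have "((fd h ^^ k) f has_real_derivative (fd h ^^ k) f' (x + h)) (at (x + h))"
    "((fd h ^^ k) f has_real_derivative (fd h ^^ k) f' x) (at x)"
    using assms(2) by (auto intro!: Suc simp: algebra_simps)
  then show ?case by (auto simp: fd_def[abs_def] DERIV_shift intro!: derivative_eq_intros)
qed simp

text \<open>A difference of order \<open>k + 1\<close> is the increment of the \<open>k\<close>-fold
  difference over one step, to which the mean value theorem applies.\<close>

lemma fd_power_mvt:
  assumes d: "\<And>y. y \<in> {x..x + real (Suc k) * h} \<Longrightarrow> (f has_real_derivative f' y) (at y)" and h: "0 < h"
  shows "\<exists>\<xi>\<in>{x..x + h}. (fd h ^^ Suc k) f x = h * (fd h ^^ k) f' \<xi>"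
proof -
  have D: "((fd h ^^ k) f has_real_derivative (fd h ^^ k) f' y) (at y)" if "y \<in> {x..x + h}" for y
    using that h by (intro fd_power_DERIV d) (auto simp: algebra_simps)
  obtain \<xi> where "x < \<xi>" "\<xi> < x + h" "(fd h ^^ k) f (x + h) - (fd h ^^ k) f x = (x + h - x) * (fd h ^^ k) f' \<xi>"
    using MVT2[of x "x + h" "(fd h ^^ k) f" "(fd h ^^ k) f'"] D h by auto
  then show ?thesis by (intro bexI[of _ \<xi>]) (auto simp: fd_def)
qed

text \<open>Trading each of the four differences for \<open>h\<close> times a derivative leaves
  \<open>h ^ 4 * f4 v\<close> at some point \<open>v\<close> of the stencil.\<close>

lemma fd4_lower_bound:
  assumes d0: "\<And>y. y \<in> {x..x + 4 * h} \<Longrightarrow> (f has_real_derivative f1 y) (at y)"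
    and d1: "\<And>y. y \<in> {x..x + 4 * h} \<Longrightarrow> (f1 has_real_derivative f2 y) (at y)"
    and d2: "\<And>y. y \<in> {x..x + 4 * h} \<Longrightarrow> (f2 has_real_derivative f3 y) (at y)"
    and d3: "\<And>y. y \<in> {x..x + 4 * h} \<Longrightarrow> (f3 has_real_derivative f4 y) (at y)"
    and m: "\<And>y. y \<in> {x..x + 4 * h} \<Longrightarrow> m \<le> f4 y" and h: "0 < h"
  shows "h ^ 4 * m \<le> (fd h ^^ 4) f x"
proof -
  obtain w where w: "w \<in> {x..x + h}" "(fd h ^^ 4) f x = h * (fd h ^^ 3) f1 w"
    using fd_power_mvt[of x 3 h f f1] d0 h by (auto simp: eval_nat_numeral)
  obtain y where y: "y \<in> {w..w + h}" "(fd h ^^ 3) f1 w = h * (fd h ^^ 2) f2 y"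
    using fd_power_mvt[of w 2 h f1 f2] d1 w h by (auto simp: eval_nat_numeral)
  obtain z where z: "z \<in> {y..y + h}" "(fd h ^^ 2) f2 y = h * (fd h ^^ 1) f3 z"
    using fd_power_mvt[of y 1 h f2 f3] d2 w y h by (auto simp: eval_nat_numeral)
  obtain v where v: "v \<in> {z..z + h}" "(fd h ^^ 1) f3 z = h * (fd h ^^ 0) f4 v"
    using fd_power_mvt[of z 0 h f3 f4] d3 w y z h by (auto simp: eval_nat_numeral)
  have "(fd h ^^ 4) f x = h ^ 4 * f4 v" using w y z v by (simp add: eval_nat_numeral)
  moreover have "m \<le> f4 v" using w y z v by (intro m) auto
  ultimately show ?thesis using h by (simp add: mult_left_mono)
qed

text \<open>First differences are kept because they are what an integral bound on the derivative
  controls. Their coefficients have absolute sum 8.\<close>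

lemma fd4_eq: "(fd h ^^ 4) f x = fd h f (x + 3 * h) - 3 * fd h f (x + 2 * h) + 3 * fd h f (x + h) - fd h f x"
  by (simp add: fd_def eval_nat_numeral algebra_simps)

section \<open>Norms on finite-dimensional function spaces\<close>

definition orthonormal_on :: "real \<Rightarrow> real \<Rightarrow> nat \<Rightarrow> (nat \<Rightarrow> real \<Rightarrow> real) \<Rightarrow> bool" where
  "orthonormal_on a b m \<psi> \<longleftrightarrow> (\<forall>j<m. continuous_on {a..b} (\<psi> j))
    \<and> (\<forall>j<m. \<forall>k<m. integral {a..b} (\<lambda>x. \<psi> j x * \<psi> k x) = (if j = k then 1 else 0))"

text \<open>Gram-Schmidt, one function at a time. If the residual \<open>r\<close> vanishes on the
  interval, the basis is kept; otherwise continuity gives \<open>r\<close> a positive norm and it is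
  normalised.\<close>

lemma orthonormal_family:
  fixes \<phi> :: "'i \<Rightarrow> real \<Rightarrow> real"
  assumes ab: "a < b" and "finite I" and "\<And>i. i \<in> I \<Longrightarrow> continuous_on {a..b} (\<phi> i)"
  shows "\<exists>m \<psi>. orthonormal_on a b m \<psi> \<and> (\<forall>i\<in>I. \<exists>c. \<forall>x\<in>{a..b}. \<phi> i x = (\<Sum>j<m. c j * \<psi> j x))"
  using assms(2,3)
proof (induction I)
  case empty
  show ?case by (rule exI[of _ 0]) (simp add: orthonormal_on_def)
next
  case (insert i I)
  from insert obtain m and \<psi> :: "nat \<Rightarrow> real \<Rightarrow> real" where on: "orthonormal_on a b m \<psi>"
    and span: "\<And>i. i \<in> I \<Longrightarrow> \<exists>c. \<forall>x\<in>{a..b}. \<phi> i x = (\<Sum>j<m. c j * \<psi> j x)"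
    by auto
  have cont: "\<And>j. j < m \<Longrightarrow> continuous_on {a..b} (\<psi> j)"
    and orth: "\<And>j k. j < m \<Longrightarrow> k < m \<Longrightarrow> integral {a..b} (\<lambda>x. \<psi> j x * \<psi> k x) = (if j = k then 1 else 0)"
    using on by (auto simp: orthonormal_on_def)
  have \<phi>: "continuous_on {a..b} (\<phi> i)" using insert.prems by simp
  define d where "d j = integral {a..b} (\<lambda>x. \<phi> i x * \<psi> j x)" for j
  define r where "r x = \<phi> i x - (\<Sum>j<m. d j * \<psi> j x)" for x
  have r: "continuous_on {a..b} r"
    unfolding r_def[abs_def] using \<phi> cont by (intro continuous_intros) auto
  note int = integrable_continuous_real
  show ?case
  proof (cases "\<forall>x\<in>{a..b}. r x = 0")
    case True
    then have "\<forall>x\<in>{a..b}. \<phi> i x = (\<Sum>j<m. d j * \<psi> j x)" by (simp add: r_def)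
    then have "\<exists>c. \<forall>x\<in>{a..b}. \<phi> i' x = (\<Sum>j<m. c j * \<psi> j x)" if "i' \<in> insert i I" for i'
      using span that by blast
    then show ?thesis using on by blast
  next
    case False
    define n where "n = integral {a..b} (\<lambda>x. r x * r x)"
    have "n \<noteq> 0"
      unfolding n_def using False ab r integral_eq_0_iff[of a b "\<lambda>x. r x * r x"] by (auto intro!: continuous_intros)
    moreover have "n \<ge> 0" unfolding n_def by (intro integral_nonneg int continuous_intros r) auto
    ultimately have n: "n > 0" by simp
    define \<psi>' where "\<psi>' = \<psi>(m := (\<lambda>x. r x / sqrt n))"
    have rk: "integral {a..b} (\<lambda>x. r x * \<psi> k x) = 0" if k: "k < m" for k
    proof -
      have "integral {a..b} (\<lambda>x. r x * \<psi> k x) = integral {a..b} (\<lambda>x. \<phi> i x * \<psi> k x - (\<Sum>j<m. d j * (\<psi> j x * \<psi> k x)))"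
        by (rule integral_cong) (simp add: r_def algebra_simps sum_distrib_left)
      also have "\<dots> = d k - integral {a..b} (\<lambda>x. \<Sum>j<m. d j * (\<psi> j x * \<psi> k x))"
        unfolding d_def using cont \<phi> k by (subst integral_diff) (auto intro!: int continuous_intros)
      also have "integral {a..b} (\<lambda>x. \<Sum>j<m. d j * (\<psi> j x * \<psi> k x)) = (\<Sum>j<m. d j * integral {a..b} (\<lambda>x. \<psi> j x * \<psi> k x))"
        using cont k by (subst integral_sum) (auto intro!: int continuous_intros)
      also have "\<dots> = (\<Sum>j<m. if j = k then d j else 0)" using orth k by (intro sum.cong) auto
      also have "\<dots> = d k" using k by simp
      finally show ?thesis by simp
    qed
    have rk': "integral {a..b} (\<lambda>x. \<psi>' m x * \<psi> k x) = 0" "integral {a..b} (\<lambda>x. \<psi> k x * \<psi>' m x) = 0" if "k < m" for k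
      using rk[OF that] by (simp_all add: \<psi>'_def mult.commute)
    have rr: "integral {a..b} (\<lambda>x. \<psi>' m x * \<psi>' m x) = 1"
    proof -
      have "integral {a..b} (\<lambda>x. \<psi>' m x * \<psi>' m x) = integral {a..b} (\<lambda>x. r x * r x * (1 / n))"
        using n by (simp add: \<psi>'_def)
      also have "\<dots> = n * (1 / n)" unfolding n_def by (rule integral_mult_left)
      finally show ?thesis using n by simp
    qed
    have \<psi>'_eq: "\<psi>' j = \<psi> j" if "j < m" for j using that by (simp add: \<psi>'_def)
    have 1: "continuous_on {a..b} (\<psi>' j)" if "j < Suc m" for j
      using that cont[of j] r n by (cases "j = m") (auto simp: \<psi>'_def intro!: continuous_intros)
    have 2: "integral {a..b} (\<lambda>x. \<psi>' j x * \<psi>' k x) = (if j = k then 1 else 0)" if "j < Suc m" "k < Suc m" for j k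
    proof (cases "j = m")
      case True
      then show ?thesis using that rr rk'(1)[of k] by (cases "k = m") (simp_all add: \<psi>'_eq)
    next
      case False
      then show ?thesis using that orth[of j k] rk'(2)[of j] by (cases "k = m") (simp_all add: \<psi>'_eq)
    qed
    have 3: "\<exists>c. \<forall>x\<in>{a..b}. \<phi> i' x = (\<Sum>j<Suc m. c j * \<psi>' j x)" if "i' \<in> insert i I" for i'
    proof (cases "i' = i")
      case True
      have "\<phi> i x = (\<Sum>j<Suc m. (d(m := sqrt n)) j * \<psi>' j x)" for x
        using n by (simp add: \<psi>'_def r_def)
      then show ?thesis using True by blast
    next
      case False
      then have "i' \<in> I" using that by simp
      from span[OF this] obtain c where "\<forall>x\<in>{a..b}. \<phi> i' x = (\<Sum>j<m. c j * \<psi> j x)" ..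
      then have "\<forall>x\<in>{a..b}. \<phi> i' x = (\<Sum>j<Suc m. (c(m := 0)) j * \<psi>' j x)" by (simp add: \<psi>'_def)
      then show ?thesis by blast
    qed
    have "orthonormal_on a b (Suc m) \<psi>'" unfolding orthonormal_on_def using 1 2 by simp
    then show ?thesis using 3 by blast
  qed
qed

text \<open>Uniformity in \<open>f\<close> holds because the sampled Gram matrix of an orthonormal basis converges.\<close>

lemma integral_square_le_riemann:
  fixes \<phi> :: "'i \<Rightarrow> real \<Rightarrow> real"
  assumes ab: "a < b" and "finite I" and "\<And>i. i \<in> I \<Longrightarrow> continuous_on {a..b} (\<phi> i)"
  shows "\<forall>\<^sub>F N in sequentially. \<forall>f. (\<exists>c. \<forall>x\<in>{a..b}. f x = (\<Sum>i\<in>I. c i * \<phi> i x))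
    \<longrightarrow> integral {a..b} (\<lambda>x. (f x)\<^sup>2) \<le> 2 * riemann a b N (\<lambda>x. (f x)\<^sup>2)"
proof -
  obtain m and \<psi> :: "nat \<Rightarrow> real \<Rightarrow> real" where on: "orthonormal_on a b m \<psi>"
    and span: "\<And>i. i \<in> I \<Longrightarrow> \<exists>c. \<forall>x\<in>{a..b}. \<phi> i x = (\<Sum>j<m. c j * \<psi> j x)"
    using orthonormal_family[of a b I \<phi>, OF assms] by auto
  have cont: "\<And>j. j < m \<Longrightarrow> continuous_on {a..b} (\<psi> j)"
    and orth: "\<And>j k. j < m \<Longrightarrow> k < m \<Longrightarrow> integral {a..b} (\<lambda>x. \<psi> j x * \<psi> k x) = (if j = k then 1 else 0)"
    using on by (auto simp: orthonormal_on_def)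
  \<comment> \<open>The sampling errors then cost at most the fraction
    \<open>m * \<eta> \<le> 1/2\<close> of the squared norm, which yields the factor 2.\<close>
  define \<eta> where "\<eta> = 1 / (2 * (real m + 1))"
  have \<eta>: "0 < \<eta>" by (simp add: \<eta>_def)
  let ?R = "\<lambda>N j k. riemann a b N (\<lambda>x. \<psi> j x * \<psi> k x)"
  let ?I = "\<lambda>j k. integral {a..b} (\<lambda>x. \<psi> j x * \<psi> k x)"
  have "\<forall>\<^sub>F N in sequentially. \<bar>?R N j k - ?I j k\<bar> < \<eta>" if "j < m" "k < m" for j k
    using tendstoD[OF riemann_tendsto_integral[OF ab] \<eta>] cont that
    by (simp add: dist_real_def continuous_on_mult)
  then have "\<forall>\<^sub>F N in sequentially. \<forall>j\<in>{..<m}. \<forall>k\<in>{..<m}. \<bar>?R N j k - ?I j k\<bar> < \<eta>"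
    by (simp add: eventually_ball_finite)
  moreover have "\<forall>\<^sub>F N in sequentially. N \<ge> 2" by (rule eventually_ge_at_top)
  ultimately show ?thesis
  proof eventually_elim
    case (elim N)
    show ?case
    proof (intro allI impI)
      fix f assume "\<exists>c. \<forall>x\<in>{a..b}. f x = (\<Sum>i\<in>I. c i * \<phi> i x)"
      then obtain c where c: "\<And>x. x \<in> {a..b} \<Longrightarrow> f x = (\<Sum>i\<in>I. c i * \<phi> i x)" by blast
      from span obtain C where C: "\<And>i x. i \<in> I \<Longrightarrow> x \<in> {a..b} \<Longrightarrow> \<phi> i x = (\<Sum>j<m. C i j * \<psi> j x)" by metis
      define e where "e j = (\<Sum>i\<in>I. c i * C i j)" for j
      have f: "f x = (\<Sum>j<m. e j * \<psi> j x)" if "x \<in> {a..b}" for x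
      proof -
        have "f x = (\<Sum>i\<in>I. \<Sum>j<m. c i * (C i j * \<psi> j x))"
          unfolding c[OF that] by (intro sum.cong refl) (simp add: C[OF _ that] sum_distrib_left)
        also have "\<dots> = (\<Sum>j<m. \<Sum>i\<in>I. c i * (C i j * \<psi> j x))" by (rule sum.swap)
        finally show ?thesis by (simp add: e_def sum_distrib_right mult.assoc)
      qed
      have ff: "(f x)\<^sup>2 = (\<Sum>j<m. \<Sum>k<m. e j * e k * (\<psi> j x * \<psi> k x))" if "x \<in> {a..b}" for x
        unfolding f[OF that] power2_eq_square sum_product by (intro sum.cong refl) simp
      have I: "integral {a..b} (\<lambda>x. (f x)\<^sup>2) = (\<Sum>j<m. \<Sum>k<m. e j * e k * ?I j k)"
      proof -
        have "integral {a..b} (\<lambda>x. (f x)\<^sup>2) = integral {a..b} (\<lambda>x. \<Sum>j<m. \<Sum>k<m. e j * e k * (\<psi> j x * \<psi> k x))"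
          using ff by (rule integral_cong)
        also have "\<dots> = (\<Sum>j<m. integral {a..b} (\<lambda>x. \<Sum>k<m. e j * e k * (\<psi> j x * \<psi> k x)))"
          using cont by (intro integral_sum integrable_continuous_real continuous_intros) auto
        also have "\<dots> = (\<Sum>j<m. \<Sum>k<m. integral {a..b} (\<lambda>x. e j * e k * (\<psi> j x * \<psi> k x)))"
          using cont by (intro sum.cong refl integral_sum integrable_continuous_real continuous_intros) auto
        finally show ?thesis by simp
      qed
      have R: "riemann a b N (\<lambda>x. (f x)\<^sup>2) = (\<Sum>j<m. \<Sum>k<m. e j * e k * ?R N j k)"
      proof -
        have "riemann a b N (\<lambda>x. (f x)\<^sup>2) = riemann a b N (\<lambda>x. \<Sum>j<m. \<Sum>k<m. e j * e k * (\<psi> j x * \<psi> k x))"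
          using ff by (rule riemann_cong[OF ab elim(2)])
        then show ?thesis by (simp add: riemann_sum riemann_mult)
      qed
      have "(\<Sum>j<m. \<Sum>k<m. e j * e k * ?I j k) = (\<Sum>j<m. \<Sum>k<m. if k = j then (e j)\<^sup>2 else 0)"
        using orth by (intro sum.cong refl) (auto simp: power2_eq_square)
      also have "\<dots> = (\<Sum>j<m. (e j)\<^sup>2)" by simp
      finally have I': "integral {a..b} (\<lambda>x. (f x)\<^sup>2) = (\<Sum>j<m. (e j)\<^sup>2)" unfolding I .
      have "(\<Sum>j<m. \<Sum>k<m. e j * e k * ?I j k) - (\<Sum>j<m. \<Sum>k<m. e j * e k * ?R N j k)
        = (\<Sum>j<m. \<Sum>k<m. e j * e k * (?I j k - ?R N j k))"
        by (simp add: sum_subtractf algebra_simps)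
      also have "\<dots> \<le> (\<Sum>j<m. \<Sum>k<m. ((e j)\<^sup>2 + (e k)\<^sup>2) / 2 * \<eta>)"
      proof (intro sum_mono)
        fix j k assume jk: "j \<in> {..<m}" "k \<in> {..<m}"
        have "2 * \<bar>e j * e k\<bar> \<le> (e j)\<^sup>2 + (e k)\<^sup>2"
          using sum_squares_bound[of "\<bar>e j\<bar>" "\<bar>e k\<bar>"] by (simp add: abs_mult)
        then have "\<bar>e j * e k\<bar> * \<bar>?I j k - ?R N j k\<bar> \<le> ((e j)\<^sup>2 + (e k)\<^sup>2) / 2 * \<eta>"
          using elim(1) jk by (intro mult_mono) (force simp: abs_minus_commute intro: less_imp_le)+
        then show "e j * e k * (?I j k - ?R N j k) \<le> ((e j)\<^sup>2 + (e k)\<^sup>2) / 2 * \<eta>"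
          unfolding abs_mult[symmetric] by linarith
      qed
      also have "\<dots> = (\<Sum>j<m. \<Sum>k<m. (e j)\<^sup>2 / 2 * \<eta> + (e k)\<^sup>2 / 2 * \<eta>)"
        by (intro sum.cong refl) (simp add: field_simps)
      also have "\<dots> = real m * \<eta> * (\<Sum>j<m. (e j)\<^sup>2)"
        by (simp add: sum.distrib sum_distrib_left sum_distrib_right field_simps flip: sum_divide_distrib)
      also have "\<dots> \<le> 1/2 * (\<Sum>j<m. (e j)\<^sup>2)"
        by (intro mult_right_mono sum_nonneg) (auto simp: \<eta>_def field_simps)
      finally show "integral {a..b} (\<lambda>x. (f x)\<^sup>2) \<le> 2 * riemann a b N (\<lambda>x. (f x)\<^sup>2)"
        using I' I R by linarith
    qed
  qed
qed

section \<open>Integral bounds for increments and oscillations\<close>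

lemma increment_bound:
  fixes f :: "real \<Rightarrow> real"
  assumes "p \<le> r" and "\<And>x. x \<in> {p..r} \<Longrightarrow> (f has_real_derivative f' x) (at x within {p..r})"
    and q: "q integrable_on {p..r}" and "\<And>x. x \<in> {p..r} \<Longrightarrow> \<bar>f' x\<bar> \<le> q x"
  shows "\<bar>f r - f p\<bar> \<le> integral {p..r} q"
proof -
  have "(f' has_integral f r - f p) {p..r}"
    using assms(1,2) by (intro fundamental_theorem_of_calculus) (auto simp: has_real_derivative_iff_has_vector_derivative)
  then show ?thesis
    using integral_norm_bound_integral[of f' "{p..r}" q] q assms(4) by (auto simp: integral_unique)
qed

text \<open>With an antiderivative \<open>\<Psi>\<close> the integral collapses to that of
  \<open>\<Phi>\<close> around \<open>a\<close> minus that around \<open>b\<close>, each over a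
  window of length \<open>2 * h\<close>. So the local oscillation of a monotone function has an
  integral of the order of the step.\<close>

lemma integral_shift_difference:
  fixes \<Phi> :: "real \<Rightarrow> real"
  assumes anti: "\<And>x y. x \<le> y \<Longrightarrow> \<Phi> y \<le> \<Phi> x" and cont: "continuous_on UNIV \<Phi>"
    and lo: "\<And>x. B \<le> \<Phi> x" and hi: "\<And>x. \<Phi> x \<le> A" and h: "0 < h" and ab: "a \<le> b"
  shows "integral {a..b} (\<lambda>x. \<Phi> (x - h) - \<Phi> (x + h)) \<le> 2 * h * (A - B)"
proof -
  let ?J = "{a - h..b + h}"
  have "continuous_on ?J \<Phi>" using cont continuous_on_subset by blast
  then obtain \<Psi> where \<Psi>: "\<And>x. x \<in> ?J \<Longrightarrow> (\<Psi> has_real_derivative \<Phi> x) (at x within ?J)"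
    using antiderivative_continuous[of "a - h" "b + h" \<Phi>]
    by (auto simp: has_real_derivative_iff_has_vector_derivative)
  have d: "((\<lambda>x. \<Psi> (x + k)) has_vector_derivative \<Phi> (x + k)) (at x within {a..b})"
    if "x \<in> {a..b}" "k = h \<or> k = -h" for x k
  proof -
    have "x + k \<in> ?J" "(\<lambda>x. x + k) ` {a..b} \<subseteq> ?J" using that h by auto
    then have "(\<Psi> has_real_derivative \<Phi> (x + k)) (at (x + k) within (\<lambda>x. x + k) ` {a..b})"
      using DERIV_subset[OF \<Psi>] by blast
    then have "(\<Psi> \<circ> (\<lambda>x. x + k) has_real_derivative \<Phi> (x + k) * 1) (at x within {a..b})"
      by (rule DERIV_image_chain) (auto intro!: derivative_eq_intros)
    then show ?thesis by (simp add: has_real_derivative_iff_has_vector_derivative comp_def)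
  qed
  have "((\<lambda>x. \<Phi> (x + -h) - \<Phi> (x + h)) has_integral
      (\<Psi> (b + -h) - \<Psi> (b + h)) - (\<Psi> (a + -h) - \<Psi> (a + h))) {a..b}"
    using ab d[of _ "-h"] d[of _ h] by (intro fundamental_theorem_of_calculus has_vector_derivative_diff) blast+
  then have "integral {a..b} (\<lambda>x. \<Phi> (x - h) - \<Phi> (x + h)) =
      (\<Psi> (a + h) - \<Psi> (a - h)) - (\<Psi> (b + h) - \<Psi> (b - h))"
    by (simp add: integral_unique)
  moreover have "(\<Phi> has_integral \<Psi> (x + h) - \<Psi> (x - h)) {x - h..x + h}" if "x \<in> {a..b}" for x
  proof (rule fundamental_theorem_of_calculus)
    fix y assume "y \<in> {x - h..x + h}"
    then show "(\<Psi> has_vector_derivative \<Phi> y) (at y within {x - h..x + h})"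
      using DERIV_subset[OF \<Psi>, of y "{x - h..x + h}"] that
      by (auto simp: has_real_derivative_iff_has_vector_derivative)
  qed (use h in simp)
  then have "\<Psi> (a + h) - \<Psi> (a - h) \<le> 2 * h * A" "2 * h * B \<le> \<Psi> (b + h) - \<Psi> (b - h)"
    using has_integral_le[of \<Phi> "\<Psi> (a + h) - \<Psi> (a - h)" "{a - h..a + h}" "\<lambda>_. A" "2 * h * A"]
      has_integral_le[of "\<lambda>_. B" "2 * h * B" "{b - h..b + h}" \<Phi> "\<Psi> (b + h) - \<Psi> (b - h)"]
      has_integral_const_real[of A "a - h" "a + h"] has_integral_const_real[of B "b - h" "b + h"] ab h hi lo
    by auto
  ultimately show ?thesis by (simp add: algebra_simps)
qed

section \<open>The least squares problem\<close>

definition foc_op :: "(firm \<Rightarrow> real) \<Rightarrow> real \<Rightarrow> real \<Rightarrow> (firm \<Rightarrow> real \<Rightarrow> real) \<Rightarrow> firm \<Rightarrow> real \<Rightarrow> real" where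
  "foc_op c a b r i p = deriv_on {a..b} (r (rival i)) p - r i p / (p - c i)"

lemma foc_error_eq: "foc_error c D a b r i p = foc_op c a b r i p - deriv_on {a..b} D p"
  by (simp add: foc_error_def foc_op_def)

lemma foc_op_linear:
  assumes "a < b" "\<And>i. C1_on {a..b} (r i)" "\<And>i. C1_on {a..b} (v i)" "x \<in> {a..b}"
  shows "foc_op c a b (\<lambda>i x. r i x + t * v i x) i x = foc_op c a b r i x + t * foc_op c a b v i x"
  using assms by (simp add: foc_op_def C1_on_linear field_simps add_divide_distrib)

definition sampled_objective ::
  "(firm \<Rightarrow> real) \<Rightarrow> (real \<Rightarrow> real) \<Rightarrow> real \<Rightarrow> real \<Rightarrow> nat \<Rightarrow> (firm \<Rightarrow> real \<Rightarrow> real) \<Rightarrow> real" where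
  "sampled_objective c D a b N r =
     riemann a b N (\<lambda>x. (foc_error c D a b r Firm1 x)\<^sup>2) + riemann a b N (\<lambda>x. (foc_error c D a b r Firm2 x)\<^sup>2)"

lemma sampled_objective_eq:
  "sampled_objective c D a b N r = (b - a) / (real N - 1) * lsq_objective c D a b N r"
  by (simp add: sampled_objective_def riemann_def lsq_objective_def sum.distrib algebra_simps)

lemma sampled_objective_minimal:
  assumes "lsq_solution c D a b K \<tau> N r" "\<And>i. cubic_spline K \<tau> (g i)" "a < b" "2 \<le> N"
  shows "sampled_objective c D a b N r \<le> sampled_objective c D a b N g"
proof -
  have "lsq_objective c D a b N r \<le> lsq_objective c D a b N g"
    using assms(1,2) unfolding lsq_solution_def is_arg_min_def by (meson not_le)
  then show ?thesis unfolding sampled_objective_eq using assms(3,4) by (intro mult_left_mono) auto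
qed

text \<open>The quadratic is tested at \<open>t = - B / (C + 1)\<close>; adding 1 keeps the
  denominator positive when \<open>C = 0\<close>.\<close>

lemma linear_coeff_zero:
  fixes B C :: real
  assumes "\<And>t. 0 \<le> 2 * t * B + t\<^sup>2 * C" "0 \<le> C"
  shows "B = 0"
proof -
  have "0 \<le> 2 * (- B / (C + 1)) * B + (- B / (C + 1))\<^sup>2 * C" by (rule assms)
  then have "0 \<le> (C + 1)\<^sup>2 * (2 * (- B / (C + 1)) * B + (- B / (C + 1))\<^sup>2 * C)" by simp
  also have "\<dots> = - 2 * B\<^sup>2 * (C + 1) + B\<^sup>2 * C"
    using assms(2) by (simp add: divide_simps) (simp add: algebra_simps power2_eq_square)
  also have "\<dots> = - (B\<^sup>2 * (C + 2))" by (simp add: algebra_simps)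
  finally have "B\<^sup>2 * (C + 2) \<le> 0" by simp
  then show ?thesis using assms(2) by (simp add: mult_le_0_iff)
qed

lemma (in knot_vector) cubic_spline_C1: "cubic_spline K \<tau> r \<Longrightarrow> C1_on {a..b} r"
  using ends by (simp add: cubic_spline_def C2_on_def)

text \<open>These are the normal equations: along the line \<open>r + t * v\<close> the objective is
  quadratic in \<open>t\<close> with its minimum at \<open>t = 0\<close>, so the linear coefficient
  vanishes.\<close>

lemma (in knot_vector) lsq_orthogonal:
  assumes sol: "lsq_solution c D a b K \<tau> N r" and v: "\<And>i. cubic_spline K \<tau> (v i)" and N: "2 \<le> N"
  shows "riemann a b N (\<lambda>x. foc_error c D a b r Firm1 x * foc_op c a b v Firm1 x)
    + riemann a b N (\<lambda>x. foc_error c D a b r Firm2 x * foc_op c a b v Firm2 x) = 0"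
proof -
  let ?e = "foc_error c D a b r" and ?l = "foc_op c a b v"
  have r: "cubic_spline K \<tau> (r i)" for i using sol by (simp add: lsq_solution_def is_arg_min_def)
  let ?B = "\<lambda>i. riemann a b N (\<lambda>x. ?e i x * ?l i x)" and ?C = "\<lambda>i. riemann a b N (\<lambda>x. (?l i x)\<^sup>2)"
  have expand: "riemann a b N (\<lambda>x. (foc_error c D a b (\<lambda>i x. r i x + t * v i x) i x)\<^sup>2)
      = riemann a b N (\<lambda>x. (?e i x)\<^sup>2) + 2 * t * ?B i + t\<^sup>2 * ?C i" for t i
  proof -
    have "riemann a b N (\<lambda>x. (foc_error c D a b (\<lambda>i x. r i x + t * v i x) i x)\<^sup>2)
      = riemann a b N (\<lambda>x. (?e i x)\<^sup>2 + 2 * t * (?e i x * ?l i x) + t\<^sup>2 * (?l i x)\<^sup>2)"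
    proof (rule riemann_cong[OF a_less_b N])
      fix x assume "x \<in> {a..b}"
      then have "foc_error c D a b (\<lambda>i x. r i x + t * v i x) i x = ?e i x + t * ?l i x"
        unfolding foc_error_eq using foc_op_linear[OF a_less_b cubic_spline_C1[OF r] cubic_spline_C1[OF v]] by simp
      then show "(foc_error c D a b (\<lambda>i x. r i x + t * v i x) i x)\<^sup>2
          = (?e i x)\<^sup>2 + 2 * t * (?e i x * ?l i x) + t\<^sup>2 * (?l i x)\<^sup>2"
        by (simp add: power2_eq_square algebra_simps)
    qed
    then show ?thesis by (simp only: riemann_add riemann_mult)
  qed
  show ?thesis
  proof (rule linear_coeff_zero)
    fix t
    have "cubic_spline K \<tau> (\<lambda>x. r i x + t * v i x)" for i by (rule cubic_spline_linear[OF r v])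
    then have "sampled_objective c D a b N r \<le> sampled_objective c D a b N (\<lambda>i x. r i x + t * v i x)"
      by (rule sampled_objective_minimal[OF sol _ a_less_b N])
    then show "0 \<le> 2 * t * (?B Firm1 + ?B Firm2) + t\<^sup>2 * (?C Firm1 + ?C Firm2)"
      unfolding sampled_objective_def expand by (simp add: algebra_simps)
    have "0 \<le> riemann a b N (\<lambda>x. (?l i x)\<^sup>2)" for i
      using riemann_mono[OF a_less_b N, of "\<lambda>_. 0" "\<lambda>x. (?l i x)\<^sup>2"] by (simp add: riemann_def)
    then show "0 \<le> ?C Firm1 + ?C Firm2" by simp
  qed
qed

section \<open>The duopoly and the variation of the marginal supplies\<close>

locale duopoly =
  fixes c :: "firm \<Rightarrow> real" and D :: "real \<Rightarrow> real" and a b :: real and s :: "firm \<Rightarrow> real \<Rightarrow> real"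
  assumes cost: "\<And>i. c i < a" and price_range: "a < b" and D_C1: "C1_on {a..b} D"
    and D'_anti: "\<And>x y. x \<in> {a..b} \<Longrightarrow> y \<in> {a..b} \<Longrightarrow> x \<le> y \<Longrightarrow> deriv_on {a..b} D y \<le> deriv_on {a..b} D x"
    and s_C1: "\<And>i. C1_on {a..b} (s i)"
    and foc: "\<And>i x. x \<in> {a..b} \<Longrightarrow> foc_op c a b s i x = deriv_on {a..b} D x"
begin

abbreviation s' :: "firm \<Rightarrow> real \<Rightarrow> real" where "s' i \<equiv> deriv_on {a..b} (s i)"

definition W :: real where "W = 1 / min (a - c Firm1) (a - c Firm2)"
definition L :: real where "L = max (b - c Firm1) (b - c Firm2)"

lemma margin:
  assumes "x \<in> {a..b}"
  shows "0 < x - c i" "1 / (x - c i) \<le> W" "x - c i \<le> L"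
proof -
  have "min (a - c Firm1) (a - c Firm2) \<le> a - c i" "b - c i \<le> L" unfolding L_def by (cases i; simp)+
  then show "0 < x - c i" "x - c i \<le> L" "1 / (x - c i) \<le> W"
    using cost[of i] cost[of Firm1] cost[of Firm2] assms unfolding W_def by (auto intro!: divide_left_mono simp: min_def)
qed

lemma W_pos: "0 < W" and L_pos: "0 < L"
  using cost[of Firm1] cost[of Firm2] price_range by (auto simp: W_def L_def min_def max_def)

lemma s_deriv: "x \<in> {a..b} \<Longrightarrow> (s i has_real_derivative s' i x) (at x within {a..b})"
  using C1_onD[OF s_C1] .

lemma continuous_on_C1: "C1_on {a..b} f \<Longrightarrow> continuous_on {a..b} f"
  unfolding C1_on_def using differentiable_imp_continuous_on by blast

lemma continuous_on_foc_op: "(\<And>i. C1_on {a..b} (r i)) \<Longrightarrow> continuous_on {a..b} (foc_op c a b r i)"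
  unfolding foc_op_def[abs_def] using margin(1)[of _ i] continuous_on_C1[of "r i"]
  by (intro continuous_intros) (force simp: C1_on_def)+

lemma continuous_on_foc_error: "(\<And>i. C1_on {a..b} (r i)) \<Longrightarrow> continuous_on {a..b} (foc_error c D a b r i)"
  unfolding foc_error_eq[abs_def] using D_C1 by (intro continuous_intros continuous_on_foc_op) (auto simp: C1_on_def)

lemma foc_error_eq_foc_op:
  assumes "\<And>i. C1_on {a..b} (r i)" "x \<in> {a..b}"
  shows "foc_error c D a b r i x = foc_op c a b (\<lambda>i x. r i x - s i x) i x"
  using foc_op_linear[OF price_range assms(1) s_C1 assms(2), where c = c and t = "-1" and i = i] foc[OF assms(2)] by (simp add: foc_error_eq)

text \<open>Concavity of \<open>D\<close> enters here.  Mere continuity of \<open>s'\<close> would not make the \<open>L\<^sup>2\<close> error \<open>o(H\<^sup>1\<^sup>/\<^sup>2)\<close>.\<close>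

lemma variation_control:
  obtains \<Phi> :: "real \<Rightarrow> real" where "\<And>x y. x \<le> y \<Longrightarrow> \<Phi> y \<le> \<Phi> x" "continuous_on UNIV \<Phi>"
    "\<And>x. \<Phi> b \<le> \<Phi> x" "\<And>x. \<Phi> x \<le> \<Phi> a"
    "\<And>\<omega>. 0 < \<omega> \<Longrightarrow> \<exists>d>0. \<forall>x y. \<bar>x - y\<bar> < d \<longrightarrow> \<bar>\<Phi> x - \<Phi> y\<bar> < \<omega>"
    "\<And>i x y. x \<in> {a..b} \<Longrightarrow> y \<in> {a..b} \<Longrightarrow> \<bar>s' i x - s' i y\<bar> \<le> \<bar>\<Phi> x - \<Phi> y\<bar>"
proof -
  let ?q = "\<lambda>i x. s i x / (x - c i)" and ?q' = "\<lambda>i x. s' i x / (x - c i) - s i x / (x - c i)\<^sup>2"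
  have q': "(?q i has_real_derivative ?q' i x) (at x within {a..b})" if "x \<in> {a..b}" for i x
  proof -
    have nz: "x - c i \<noteq> 0" using margin(1)[OF that, of i] by simp
    have "u / z - v / z\<^sup>2 = (u * z - v * 1) / (z * z)" if "z \<noteq> 0" for u v z :: real
      using that by (simp add: field_simps power2_eq_square)
    then have "?q' i x = (s' i x * (x - c i) - s i x * 1) / ((x - c i) * (x - c i))" using nz by blast
    moreover have "((\<lambda>x. x - c i) has_real_derivative 1) (at x within {a..b})"
      by (auto intro!: derivative_eq_intros)
    note DERIV_divide[where f = "s i" and g = "\<lambda>x. x - c i", OF s_deriv[OF that] this nz]
    ultimately show ?thesis by simp
  qed
  have "\<exists>\<Lambda>. \<forall>x\<in>{a..b}. \<bar>?q' i x\<bar> \<le> \<Lambda>" for i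
  proof -
    have "continuous_on {a..b} (?q' i)"
      using margin(1)[of _ i] s_C1[of i] continuous_on_C1[of "s i"]
      by (intro continuous_intros) (force simp: C1_on_def)+
    then have "bounded (?q' i ` {a..b})" by (intro compact_imp_bounded compact_continuous_image) auto
    then show ?thesis unfolding bounded_iff by auto
  qed
  then obtain \<Lambda> where \<Lambda>: "\<And>i x. x \<in> {a..b} \<Longrightarrow> \<bar>?q' i x\<bar> \<le> \<Lambda> i" by metis
  define M where "M = max (\<Lambda> Firm1) (\<Lambda> Firm2)"
  have M: "\<bar>?q' i x\<bar> \<le> M" if "x \<in> {a..b}" for i x
    using \<Lambda>[OF that, of i] by (cases i) (auto simp: M_def)
  then have "0 \<le> M" using price_range by (meson abs_ge_zero atLeastAtMost_iff less_imp_le order_refl order_trans)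
  have lip: "\<bar>?q i x - ?q i y\<bar> \<le> M * \<bar>x - y\<bar>" if "x \<in> {a..b}" "y \<in> {a..b}" for i x y
    using field_differentiable_bound[of "{a..b}" "?q i" "?q' i" M x y] q' M that by auto
  \<comment> \<open>Clamping extends \<open>\<Phi>\<close> to the whole line, so that it can be
    shifted past the end points.\<close>
  define cl where "cl x = max a (min b x)" for x
  have cl: "cl x \<in> {a..b}" "\<bar>cl x - cl y\<bar> \<le> \<bar>x - y\<bar>" "x \<le> y \<Longrightarrow> cl x \<le> cl y" for x y
    using price_range by (auto simp: cl_def)
  have cl_id: "x \<in> {a..b} \<Longrightarrow> cl x = x" for x by (auto simp: cl_def)
  \<comment> \<open>By the first order conditions \<open>s'\<close> is \<open>D'\<close> plus a
    quotient with Lipschitz constant \<open>M\<close>. Subtracting \<open>M * x\<close> from the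
    non-increasing \<open>D'\<close> leaves a non-increasing function whose drop between two points
    also pays for the quotient.\<close>
  define \<Phi> where "\<Phi> x = deriv_on {a..b} D (cl x) - M * cl x" for x
  have anti: "\<Phi> y \<le> \<Phi> x" if "x \<le> y" for x y
    using D'_anti[OF cl(1) cl(1) cl(3)[OF that]] mult_left_mono[OF cl(3)[OF that] \<open>0 \<le> M\<close>] by (simp add: \<Phi>_def)
  have unif: "\<exists>d>0. \<forall>x y. \<bar>x - y\<bar> < d \<longrightarrow> \<bar>\<Phi> x - \<Phi> y\<bar> < \<omega>" if "0 < \<omega>" for \<omega>
  proof -
    define f where "f x = deriv_on {a..b} D x - M * x" for x
    have "continuous_on {a..b} f"
      unfolding f_def using D_C1 by (intro continuous_intros) (simp add: C1_on_def)
    then have "uniformly_continuous_on {a..b} f"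
      using compact_uniformly_continuous by blast
    then obtain d where "d > 0" and d: "\<And>x y. x \<in> {a..b} \<Longrightarrow> y \<in> {a..b} \<Longrightarrow> \<bar>y - x\<bar> < d \<Longrightarrow> \<bar>f y - f x\<bar> < \<omega>"
      unfolding uniformly_continuous_on_def dist_real_def using \<open>0 < \<omega>\<close> by metis
    have "\<bar>\<Phi> x - \<Phi> y\<bar> < \<omega>" if "\<bar>x - y\<bar> < d" for x y
      using d[OF cl(1) cl(1), of x y] d[OF cl(1) cl(1), of y x] cl(2)[of x y] that by (simp add: \<Phi>_def f_def)
    then show ?thesis using \<open>d > 0\<close> by blast
  qed
  have "continuous_on UNIV \<Phi>"
    unfolding continuous_on_iff dist_real_def using unif by (metis abs_minus_commute)
  moreover have "\<bar>s' i x - s' i y\<bar> \<le> \<bar>\<Phi> x - \<Phi> y\<bar>" if xy: "x \<in> {a..b}" "y \<in> {a..b}" for i x y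
  proof -
    have s': "s' i z = deriv_on {a..b} D z + ?q (rival i) z" if "z \<in> {a..b}" for z
      using foc[OF that, of "rival i"] by (cases i) (auto simp: foc_op_def)
    have key: "\<bar>s' i x - s' i y\<bar> \<le> \<Phi> x - \<Phi> y" if "x \<le> y" "x \<in> {a..b}" "y \<in> {a..b}" for x y
      using D'_anti[OF that(2,3,1)] lip[OF that(2,3), of "rival i"] that(1)
      unfolding s'[OF that(2)] s'[OF that(3)] \<Phi>_def cl_id[OF that(2)] cl_id[OF that(3)] by (simp add: algebra_simps)
    show ?thesis
    proof (cases "x \<le> y")
      case True
      then show ?thesis using key[of x y] xy by linarith
    next
      case False
      then show ?thesis using key[of y x] xy by (simp add: abs_minus_commute)
    qed
  qed
  moreover have "\<Phi> b \<le> \<Phi> x" "\<Phi> x \<le> \<Phi> a" for x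
  proof -
    have "\<Phi> x = \<Phi> (cl x)" by (simp add: \<Phi>_def cl_id[OF cl(1)])
    then show "\<Phi> b \<le> \<Phi> x" "\<Phi> x \<le> \<Phi> a" using anti[of "cl x" b] anti[of a "cl x"] cl(1)[of x] by auto
  qed
  ultimately show ?thesis using anti unif that by blast
qed

text \<open>This integrates \<open>2 * l * \<bar>y\<bar> \<le> l\<^sup>2 + y\<^sup>2\<close>; the
  free weight \<open>l\<close> takes the place of the Cauchy-Schwarz inequality.\<close>

lemma weighted_abs_bound:
  fixes l :: real
  assumes "continuous_on {p..r} e" "p \<le> r" "0 < l"
  shows "integral {p..r} (\<lambda>x. \<bar>e x\<bar>) \<le> l * (r - p) / 2 + integral {p..r} (\<lambda>x. (e x)\<^sup>2) / (2 * l)"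
proof -
  have "\<bar>y\<bar> \<le> l / 2 + y\<^sup>2 * (1 / (2 * l))" for y :: real
  proof -
    have "2 * l * \<bar>y\<bar> \<le> l\<^sup>2 + y\<^sup>2" using sum_squares_bound[of l "\<bar>y\<bar>"] by simp
    then show ?thesis using assms(3) by (simp add: field_simps power2_eq_square)
  qed
  then have "integral {p..r} (\<lambda>x. \<bar>e x\<bar>) \<le> integral {p..r} (\<lambda>x. l / 2 + (e x)\<^sup>2 * (1 / (2 * l)))"
    using assms by (intro integral_le integrable_continuous_real continuous_intros) auto
  also have "\<dots> = l / 2 * (r - p) + integral {p..r} (\<lambda>x. (e x)\<^sup>2) * (1 / (2 * l))"
    using assms by (subst integral_add) (auto intro!: integrable_continuous_real continuous_intros)
  finally show ?thesis by simp
qed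

end

section \<open>The homogeneous first order conditions\<close>

text \<open>With \<open>X = x - p\<close> and \<open>Y = x - q\<close> for the two costs
  \<open>p\<close> and \<open>q\<close>, the second homogeneous solution, normalised by
  \<open>X * u2 - Y * u1 = 1\<close>, satisfies \<open>(u1 / X)' = G p q\<close>. \<open>G1\<close>
  and \<open>G2\<close> are the next derivatives; up to sign and order of the costs,
  \<open>G2\<close> is the fourth derivative of each component.\<close>

definition G :: "real \<Rightarrow> real \<Rightarrow> real \<Rightarrow> real" where "G p q x = 1 / ((x - p)\<^sup>2 * (x - q))"
definition G1 :: "real \<Rightarrow> real \<Rightarrow> real \<Rightarrow> real" where
  "G1 p q x = - (2 / ((x - p) ^ 3 * (x - q)) + 1 / ((x - p)\<^sup>2 * (x - q)\<^sup>2))"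
definition G2 :: "real \<Rightarrow> real \<Rightarrow> real \<Rightarrow> real" where
  "G2 p q x = 6 / ((x - p) ^ 4 * (x - q)) + 4 / ((x - p) ^ 3 * (x - q)\<^sup>2) + 2 / ((x - p)\<^sup>2 * (x - q) ^ 3)"

lemma has_derivative_inverse_powers:
  fixes p q x :: real
  assumes "x \<noteq> p" "x \<noteq> q"
  shows "((\<lambda>x. 1 / ((x - p) ^ m * (x - q) ^ n)) has_real_derivative
    - (real m / ((x - p) ^ Suc m * (x - q) ^ n) + real n / ((x - p) ^ m * (x - q) ^ Suc n))) (at x within S)"
proof -
  have "((\<lambda>x. (x - p) ^ m * (x - q) ^ n) has_real_derivative
      real m * (x - p) ^ (m - 1) * (x - q) ^ n + real n * (x - q) ^ (n - 1) * (x - p) ^ m) (at x within S)"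
    by (auto intro!: derivative_eq_intros simp: algebra_simps)
  then have "((\<lambda>x. inverse ((x - p) ^ m * (x - q) ^ n)) has_real_derivative
     - (inverse ((x - p) ^ m * (x - q) ^ n) * (real m * (x - p) ^ (m - 1) * (x - q) ^ n + real n * (x - q) ^ (n - 1) * (x - p) ^ m)
       * inverse ((x - p) ^ m * (x - q) ^ n))) (at x within S)"
    using assms by (intro DERIV_inverse') auto
  moreover have "inverse (A ^ m * B ^ n) * (real m * A ^ (m - 1) * B ^ n + real n * B ^ (n - 1) * A ^ m) * inverse (A ^ m * B ^ n)
     = real m / (A ^ Suc m * B ^ n) + real n / (A ^ m * B ^ Suc n)" if "A \<noteq> 0" "B \<noteq> 0" for A B :: real
    using that by (cases m; cases n) (simp_all add: field_simps)
  ultimately show ?thesis using assms by (simp add: inverse_eq_divide)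
qed

lemma G_deriv: "x \<noteq> p \<Longrightarrow> x \<noteq> q \<Longrightarrow> (G p q has_real_derivative G1 p q x) (at x within S)"
  using has_derivative_inverse_powers[of x p q 2 1 S] unfolding G_def[abs_def] G1_def by (simp add: eval_nat_numeral)

lemma G1_deriv: "x \<noteq> p \<Longrightarrow> x \<noteq> q \<Longrightarrow> (G1 p q has_real_derivative G2 p q x) (at x within S)"
proof -
  assume x: "x \<noteq> p" "x \<noteq> q"
  have "((\<lambda>x. - (2 * (1 / ((x - p) ^ 3 * (x - q) ^ 1)) + 1 / ((x - p) ^ 2 * (x - q) ^ 2))) has_real_derivative
      - (2 * - (real 3 / ((x - p) ^ Suc 3 * (x - q) ^ 1) + real 1 / ((x - p) ^ 3 * (x - q) ^ Suc 1))
        + - (real 2 / ((x - p) ^ Suc 2 * (x - q) ^ 2) + real 2 / ((x - p) ^ 2 * (x - q) ^ Suc 2)))) (at x within S)"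
    by (intro DERIV_minus DERIV_add DERIV_cmult has_derivative_inverse_powers x)
  then have "(G1 p q has_real_derivative
      - (2 * - (real 3 / ((x - p) ^ Suc 3 * (x - q) ^ 1) + real 1 / ((x - p) ^ 3 * (x - q) ^ Suc 1))
        + - (real 2 / ((x - p) ^ Suc 2 * (x - q) ^ 2) + real 2 / ((x - p) ^ 2 * (x - q) ^ Suc 2)))) (at x within S)"
    unfolding G1_def[abs_def] by simp
  moreover have "- (2 * - (real 3 / ((x - p) ^ Suc 3 * (x - q) ^ 1) + real 1 / ((x - p) ^ 3 * (x - q) ^ Suc 1))
        + - (real 2 / ((x - p) ^ Suc 2 * (x - q) ^ 2) + real 2 / ((x - p) ^ 2 * (x - q) ^ Suc 2))) = G2 p q x"
    unfolding G2_def by (simp add: eval_nat_numeral)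
  ultimately show ?thesis by (simp only:)
qed

text \<open>In the reciprocals \<open>A\<close> and \<open>B\<close> all three terms are monomials
  of degree 5, with coefficients 6, 4 and 2 that sum to 12.\<close>

lemma G2_bounds:
  assumes "0 < x - p" "0 < x - q" "1 / (x - p) \<le> w" "1 / (x - q) \<le> w" "x - p \<le> l" "x - q \<le> l"
  shows "12 / l ^ 5 \<le> G2 p q x" "\<bar>G2 p q x\<bar> \<le> 12 * w ^ 5"
proof -
  define A where "A = 1 / (x - p)"
  define B where "B = 1 / (x - q)"
  have AB: "1 / l \<le> A" "A \<le> w" "1 / l \<le> B" "B \<le> w" "0 < 1 / l"
    using assms unfolding A_def B_def by (auto intro!: divide_left_mono)
  have G2: "G2 p q x = 6 * (A ^ 4 * B) + 4 * (A ^ 3 * B\<^sup>2) + 2 * (A\<^sup>2 * B ^ 3)"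
    by (simp add: G2_def A_def B_def power_one_over field_simps)
  have nn: "0 \<le> A" "0 \<le> B" "0 \<le> w" using AB by linarith+
  have up: "A ^ m * B ^ n \<le> w ^ (m + n)" for m n
    unfolding power_add by (intro mult_mono power_mono zero_le_power AB nn)
  have lo: "(1 / l) ^ (m + n) \<le> A ^ m * B ^ n" for m n
    unfolding power_add by (intro mult_mono power_mono zero_le_power AB nn less_imp_le[OF AB(5)])
  have "12 * (1 / l) ^ 5 \<le> G2 p q x" and "G2 p q x \<le> 12 * w ^ 5"
    unfolding G2 using up[of 4 1] up[of 3 2] up[of 2 3] lo[of 4 1] lo[of 3 2] lo[of 2 3] by simp_all
  moreover have "0 \<le> G2 p q x" unfolding G2 by (intro add_nonneg_nonneg mult_nonneg_nonneg zero_le_power nn) simp_all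
  ultimately show "12 / l ^ 5 \<le> G2 p q x" "\<bar>G2 p q x\<bar> \<le> 12 * w ^ 5" by (simp_all add: power_one_over)
qed

context duopoly
begin

text \<open>The construction takes place on a larger interval, still to the right of both costs, so
  that the derivatives at \<open>a\<close> and \<open>b\<close> are two-sided, as the lemmas on
  finite differences ask.\<close>

lemma kernel_antiderivatives:
  obtains F A :: "real \<Rightarrow> real" where
    "\<And>x. x \<in> {a..b} \<Longrightarrow> (F has_real_derivative G (c Firm1) (c Firm2) x) (at x)"
    "\<And>x. x \<in> {a..b} \<Longrightarrow> (A has_real_derivative F x) (at x)"
proof -
  define m where "m = max (c Firm1) (c Firm2)"
  have m: "c i \<le> m" for i by (cases i) (auto simp: m_def)
  have "m < a" using cost by (simp add: m_def)
  define l where "l = (a + m) / 2"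
  have l: "m < l" "l < a" using \<open>m < a\<close> by (auto simp: l_def)
  have nz: "x \<noteq> c i" if "x \<in> {l..b + 1}" for x i using that m[of i] l by auto
  have "continuous_on {l..b + 1} (G (c Firm1) (c Firm2))"
    by (rule DERIV_continuous_on[OF G_deriv]) (use nz in auto)
  then obtain F where F: "\<And>x. x \<in> {l..b + 1} \<Longrightarrow> (F has_real_derivative G (c Firm1) (c Firm2) x) (at x within {l..b + 1})"
    using antiderivative_continuous[of l "b + 1"] by (auto simp: has_real_derivative_iff_has_vector_derivative)
  have "continuous_on {l..b + 1} F" using F by (rule DERIV_continuous_on)
  then obtain A where A: "\<And>x. x \<in> {l..b + 1} \<Longrightarrow> (A has_real_derivative F x) (at x within {l..b + 1})"
    using antiderivative_continuous[of l "b + 1"] by (auto simp: has_real_derivative_iff_has_vector_derivative)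
  have "at x within {l..b + 1} = at x" "x \<in> {l..b + 1}" if "x \<in> {a..b}" for x
    using that l by (auto intro!: at_within_interior)
  then show ?thesis using that[of F A] F A by metis
qed

definition Cker :: real where "Cker = 2 * L * W\<^sup>2 + 2 * L * W ^ 3 * (b - a) + W"

lemma Cker_pos: "0 < Cker"
  unfolding Cker_def using W_pos L_pos price_range by (intro add_nonneg_pos add_nonneg_nonneg mult_nonneg_nonneg) auto

text \<open>With \<open>x = p - c\<^sub>1\<close>, \<open>y = p - c\<^sub>2\<close> the quantity \<open>x u\<^sub>2 - y u\<^sub>1\<close> has derivative \<open>x e\<^sub>1 - y e\<^sub>2\<close>, and
  \<open>u\<^sub>1 / x\<close> has derivative \<open>(x u\<^sub>2 - y u\<^sub>1) / (x\<^sup>2 y) + e\<^sub>2 / x\<close>.  So up to the error \<open>e\<close> every \<open>u\<close> is a combination of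
  \<open>(x, y)\<close> and of one further solution of the homogeneous system.\<close>

lemma kernel_decomposition:
  assumes r: "\<And>i. C1_on {a..b} (r i)"
    and F: "\<And>x. x \<in> {a..b} \<Longrightarrow> (F has_real_derivative G (c Firm1) (c Firm2) x) (at x)"
    and \<mu>: "\<And>i. integral {a..b} (\<lambda>x. \<bar>foc_error c D a b r i x\<bar>) \<le> \<mu>"
  obtains \<beta> \<gamma> where
    "\<And>x. x \<in> {a..b} \<Longrightarrow> \<bar>deriv_on {a..b} (r Firm2) x - s' Firm2 x - (\<gamma> + \<beta> * F x)
        - foc_error c D a b r Firm1 x\<bar> \<le> Cker * \<mu>"
    "\<And>x. x \<in> {a..b} \<Longrightarrow> \<bar>deriv_on {a..b} (r Firm1) x - s' Firm1 x
        - (\<gamma> + \<beta> * (F x + 1 / ((x - c Firm1) * (x - c Firm2))))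
        - foc_error c D a b r Firm2 x\<bar> \<le> Cker * \<mu>"
proof -
  define u where "u i x = r i x - s i x" for i x
  define u' where "u' i x = deriv_on {a..b} (r i) x - s' i x" for i x
  define e where "e i = foc_error c D a b r i" for i
  let ?X = "\<lambda>x. x - c Firm1" and ?Y = "\<lambda>x. x - c Firm2"
  have u: "(u i has_real_derivative u' i x) (at x within {a..b})" if "x \<in> {a..b}" for i x
    unfolding u_def[abs_def] u'_def using C1_onD[OF r that] s_deriv[OF that] by (auto intro!: derivative_eq_intros)
  have e: "e i x = u' (rival i) x - u i x / (x - c i)" if "x \<in> {a..b}" for i x
  proof -
    have "deriv_on {a..b} (u (rival i)) x = u' (rival i) x" by (rule deriv_on_eqI[OF price_range that u[OF that]])
    then show ?thesis using foc_error_eq_foc_op[where r = r and i = i, OF r that] unfolding e_def foc_op_def u_def[abs_def] by simp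
  qed
  have cont_e: "continuous_on {a..b} (e i)" for i unfolding e_def by (rule continuous_on_foc_error[OF r])
  have e_nonneg: "0 \<le> integral {a..b} (\<lambda>x. \<bar>e i x\<bar>)" for i by (rule integral_nonneg) (auto intro!: integrable_continuous_real continuous_intros cont_e)
  have \<mu>0: "0 \<le> \<mu>" using e_nonneg[of Firm1] \<mu>[of Firm1] by (simp add: e_def)
  have sub: "integral {a..x} (\<lambda>x. \<bar>e i x\<bar>) \<le> \<mu>" if "x \<in> {a..b}" for i x
  proof -
    have "integral {a..x} (\<lambda>x. \<bar>e i x\<bar>) \<le> integral {a..b} (\<lambda>x. \<bar>e i x\<bar>)"
      using that by (intro integral_subset_le integrable_continuous_real continuous_intros continuous_on_subset[OF cont_e]) auto
    then show ?thesis using \<mu>[of i] by (simp add: e_def)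
  qed
  define \<delta> where "\<delta> x = ?X x * u Firm2 x - ?Y x * u Firm1 x" for x
  \<comment> \<open>\<open>\<beta>\<close> and later \<open>\<gamma>\<close> are the values at
    \<open>a\<close> of two quantities that would be constant if the error functions
    vanished.\<close>
  define \<beta> where "\<beta> = \<delta> a"
  have \<delta>': "(\<delta> has_real_derivative ?X x * e Firm1 x - ?Y x * e Firm2 x) (at x within {a..b})" if x: "x \<in> {a..b}" for x
  proof -
    have nz: "?X x \<noteq> 0" "?Y x \<noteq> 0" using margin(1)[OF x] by (metis less_irrefl)+
    have "(\<delta> has_real_derivative (u Firm2 x + ?X x * u' Firm2 x) - (u Firm1 x + ?Y x * u' Firm1 x)) (at x within {a..b})"
      unfolding \<delta>_def[abs_def] using u[OF x] by (auto intro!: derivative_eq_intros simp: algebra_simps)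
    moreover have "?X x * e Firm1 x = ?X x * u' Firm2 x - u Firm1 x" "?Y x * e Firm2 x = ?Y x * u' Firm1 x - u Firm2 x"
      using nz e[OF x, of Firm1] e[OF x, of Firm2] by (simp_all add: right_diff_distrib)
    then have "(u Firm2 x + ?X x * u' Firm2 x) - (u Firm1 x + ?Y x * u' Firm1 x) = ?X x * e Firm1 x - ?Y x * e Firm2 x"
      by linarith
    ultimately show ?thesis by (simp only:)
  qed
  have \<delta>_bound: "\<bar>\<delta> x - \<beta>\<bar> \<le> 2 * L * \<mu>" if x: "x \<in> {a..b}" for x
  proof -
    have ax: "{a..x} \<subseteq> {a..b}" using x by auto
    have "\<bar>\<delta> x - \<delta> a\<bar> \<le> integral {a..x} (\<lambda>x. L * \<bar>e Firm1 x\<bar> + L * \<bar>e Firm2 x\<bar>)"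
    proof (rule increment_bound)
      fix y assume y: "y \<in> {a..x}"
      then have y': "y \<in> {a..b}" using ax by blast
      show "(\<delta> has_real_derivative ?X y * e Firm1 y - ?Y y * e Firm2 y) (at y within {a..x})"
        using DERIV_subset[OF \<delta>'[OF y'] ax] .
      have "\<bar>?X y * e Firm1 y\<bar> \<le> L * \<bar>e Firm1 y\<bar>" "\<bar>?Y y * e Firm2 y\<bar> \<le> L * \<bar>e Firm2 y\<bar>"
        unfolding abs_mult using margin[OF y', of Firm1] margin[OF y', of Firm2] by (auto intro!: mult_right_mono)
      then show "\<bar>?X y * e Firm1 y - ?Y y * e Firm2 y\<bar> \<le> L * \<bar>e Firm1 y\<bar> + L * \<bar>e Firm2 y\<bar>" by linarith
    qed (use x ax in \<open>auto intro!: integrable_continuous_real continuous_intros continuous_on_subset[OF cont_e]\<close>)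
    also have "\<dots> = L * integral {a..x} (\<lambda>x. \<bar>e Firm1 x\<bar>) + L * integral {a..x} (\<lambda>x. \<bar>e Firm2 x\<bar>)"
      using ax by (subst integral_add) (auto intro!: integrable_continuous_real continuous_intros continuous_on_subset[OF cont_e])
    also have "\<dots> \<le> L * \<mu> + L * \<mu>" using sub[OF x] L_pos by (intro add_mono mult_left_mono) auto
    finally show ?thesis by (simp add: \<beta>_def mult.commute mult.left_commute)
  qed
  define h where "h x = u Firm1 x / ?X x - \<beta> * F x" for x
  define \<gamma> where "\<gamma> = h a"
  have h': "(h has_real_derivative (\<delta> x - \<beta>) * G (c Firm1) (c Firm2) x + e Firm2 x / ?X x) (at x within {a..b})"
    if x: "x \<in> {a..b}" for x
  proof -
    have nz: "?X x \<noteq> 0" "?Y x \<noteq> 0" using margin(1)[OF x] by (metis less_irrefl)+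
    have dX: "(?X has_real_derivative 1) (at x within {a..b})" by (auto intro!: derivative_eq_intros)
    have "(h has_real_derivative (u' Firm1 x * ?X x - u Firm1 x * 1) / (?X x * ?X x) - \<beta> * G (c Firm1) (c Firm2) x) (at x within {a..b})"
      unfolding h_def[abs_def]
      by (intro DERIV_diff DERIV_cmult DERIV_divide[OF u[OF x] dX nz(1)] has_field_derivative_at_within[OF F[OF x]])
    moreover have "u' Firm1 x = e Firm2 x + u Firm2 x / ?Y x" using e[OF x, of Firm2] by simp
    moreover have "((e2 + u2 / Y) * X - u1 * 1) / (X * X) - \<beta> * (1 / (X\<^sup>2 * Y)) = (X * u2 - Y * u1 - \<beta>) * (1 / (X\<^sup>2 * Y)) + e2 / X"
      if "X \<noteq> 0" "Y \<noteq> 0" for X Y e2 u1 u2 :: real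
      using that by (simp add: divide_simps power2_eq_square) (simp add: algebra_simps)
    ultimately show ?thesis using nz by (simp add: G_def \<delta>_def)
  qed
  have inv: "\<bar>1 / (x - c i)\<bar> \<le> W" "0 \<le> 1 / (x - c i)" if "x \<in> {a..b}" for x i
    using margin[OF that, of i] by auto
  have h_bound: "\<bar>h x - \<gamma>\<bar> \<le> (2 * L * W ^ 3 * (b - a) + W) * \<mu>" if x: "x \<in> {a..b}" for x
  proof -
    have ax: "{a..x} \<subseteq> {a..b}" using x by auto
    have "\<bar>h x - h a\<bar> \<le> integral {a..x} (\<lambda>x. 2 * L * \<mu> * W ^ 3 + W * \<bar>e Firm2 x\<bar>)"
    proof (rule increment_bound)
      fix y assume y: "y \<in> {a..x}"
      then have y': "y \<in> {a..b}" using ax by blast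
      show "(h has_real_derivative (\<delta> y - \<beta>) * G (c Firm1) (c Firm2) y + e Firm2 y / ?X y) (at y within {a..x})"
        using DERIV_subset[OF h'[OF y'] ax] .
      have "G (c Firm1) (c Firm2) y = (1 / ?X y)\<^sup>2 * (1 / ?Y y)" by (simp add: G_def power_one_over)
      also have "\<bar>\<dots>\<bar> \<le> W\<^sup>2 * W"
        unfolding abs_mult power_abs using inv[OF y'] W_pos by (intro mult_mono power_mono) auto
      finally have "\<bar>G (c Firm1) (c Firm2) y\<bar> \<le> W ^ 3" by (simp add: power2_eq_square power3_eq_cube)
      then have "\<bar>(\<delta> y - \<beta>) * G (c Firm1) (c Firm2) y\<bar> \<le> 2 * L * \<mu> * W ^ 3"
        unfolding abs_mult using \<delta>_bound[OF y'] L_pos \<mu>0 by (intro mult_mono) auto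
      moreover have "\<bar>e Firm2 y / ?X y\<bar> \<le> W * \<bar>e Firm2 y\<bar>"
        using mult_right_mono[OF inv(1)[OF y', of Firm1], of "\<bar>e Firm2 y\<bar>"] by (simp add: abs_mult abs_divide)
      ultimately show "\<bar>(\<delta> y - \<beta>) * G (c Firm1) (c Firm2) y + e Firm2 y / ?X y\<bar> \<le> 2 * L * \<mu> * W ^ 3 + W * \<bar>e Firm2 y\<bar>"
        by linarith
    qed (use x ax in \<open>auto intro!: integrable_continuous_real continuous_intros continuous_on_subset[OF cont_e]\<close>)
    also have "\<dots> = 2 * L * \<mu> * W ^ 3 * (x - a) + W * integral {a..x} (\<lambda>x. \<bar>e Firm2 x\<bar>)"
      using ax x by (subst integral_add) (auto intro!: integrable_continuous_real continuous_intros continuous_on_subset[OF cont_e])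
    also have "\<dots> \<le> 2 * L * \<mu> * W ^ 3 * (b - a) + W * \<mu>"
      using sub[OF x] L_pos W_pos \<mu>0 x by (intro add_mono mult_left_mono) auto
    finally show ?thesis by (simp add: \<gamma>_def algebra_simps)
  qed
  have "\<bar>u' Firm2 x - (\<gamma> + \<beta> * F x) - e Firm1 x\<bar> \<le> Cker * \<mu>" if x: "x \<in> {a..b}" for x
  proof -
    have "u' Firm2 x - (\<gamma> + \<beta> * F x) - e Firm1 x = h x - \<gamma>"
      using e[OF x, of Firm1] by (simp add: h_def)
    moreover have "(2 * L * W ^ 3 * (b - a) + W) * \<mu> \<le> Cker * \<mu>"
      using L_pos W_pos \<mu>0 by (intro mult_right_mono) (auto simp: Cker_def)
    ultimately show ?thesis using h_bound[OF x] by linarith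
  qed
  moreover have "\<bar>u' Firm1 x - (\<gamma> + \<beta> * (F x + 1 / (?X x * ?Y x))) - e Firm2 x\<bar> \<le> Cker * \<mu>" if x: "x \<in> {a..b}" for x
  proof -
    have nz: "?X x \<noteq> 0" "?Y x \<noteq> 0" using margin(1)[OF x] by (metis less_irrefl)+
    \<comment> \<open>For the second kernel solution \<open>u2 / Y\<close> equals
      \<open>F + 1 / (X * Y)\<close>; the deviation from it combines those of \<open>h\<close> and
      \<open>\<delta>\<close>.\<close>
    have alg: "u2 / Y - (\<gamma> + \<beta> * (f + 1 / (X * Y))) = (u1 / X - \<beta> * f - \<gamma>) + (X * u2 - Y * u1 - \<beta>) * ((1 / X) * (1 / Y))"
      if "X \<noteq> 0" "Y \<noteq> 0" for X Y u1 u2 f :: real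
      using that by (simp add: field_simps)
    have "u' Firm1 x - e Firm2 x = u Firm2 x / ?Y x" using e[OF x, of Firm2] by simp
    then have eq: "u' Firm1 x - (\<gamma> + \<beta> * (F x + 1 / (?X x * ?Y x))) - e Firm2 x = (h x - \<gamma>) + (\<delta> x - \<beta>) * ((1 / ?X x) * (1 / ?Y x))"
      using alg[OF nz, of "u Firm2 x" "F x" "u Firm1 x"] by (simp add: h_def \<delta>_def)
    have "\<bar>(\<delta> x - \<beta>) * ((1 / ?X x) * (1 / ?Y x))\<bar> \<le> (2 * L * \<mu>) * (W * W)"
      unfolding abs_mult[of "\<delta> x - \<beta>"] abs_mult[of "1 / ?X x"]
      using \<delta>_bound[OF x] inv[OF x] W_pos L_pos \<mu>0 by (intro mult_mono) auto
    moreover have "(2 * L * \<mu>) * (W * W) + (2 * L * W ^ 3 * (b - a) + W) * \<mu> = Cker * \<mu>"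
      by (simp add: Cker_def algebra_simps power2_eq_square)
    ultimately show ?thesis unfolding eq using h_bound[OF x] by linarith
  qed
  ultimately show ?thesis using that[of \<gamma> \<beta>] unfolding u'_def e_def by blast
qed

end

section \<open>The residual is close to a spline\<close>

lemma (in knot_vector) spl_lam_diff: "spl (lam (\<lambda>p. f p - g p)) p = spl (lam f) p - spl (lam g) p"
  using spl_lam_linear[of 1 f "-1" g p] by simp

context duopoly
begin

text \<open>Like the two constants after it, this depends only on the costs and the price range. The
  factor \<open>64 = 4 ^ 3\<close> stems from the step \<open>H / 4\<close>.\<close>

definition Cbeta :: real where "Cbeta = 64 * L ^ 5 * (2 * Cker * (b - a) + 8)"

lemma Cbeta_nonneg: "0 \<le> Cbeta"
  unfolding Cbeta_def using L_pos Cker_pos price_range by (intro mult_nonneg_nonneg add_nonneg_nonneg) auto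

text \<open>The summands account for the distance to the kernel, the quasi-interpolation of
  \<open>s'\<close> and that of the kernel solution.\<close>

definition Capx :: real where "Capx = 2 * Cker * (b - a) + 3 + 144 * W ^ 5 * Cbeta"

lemma Capx_pos: "0 < Capx"
  unfolding Capx_def using W_pos Cker_pos Cbeta_nonneg price_range
  by (intro add_pos_nonneg add_nonneg_pos mult_nonneg_nonneg) auto

definition Cfin :: real where "Cfin = 2001 * Capx + 2000 * W * (b - a)"

end

section \<open>Estimates for one knot vector\<close>

locale approximation = duopoly c D a b s + knot_vector a b K \<tau>
  for c D a b s K \<tau> +
  fixes \<Phi> :: "real \<Rightarrow> real" and \<omega> :: real
  assumes \<Phi>_anti: "\<And>x y. x \<le> y \<Longrightarrow> \<Phi> y \<le> \<Phi> x" and \<Phi>_cont: "continuous_on UNIV \<Phi>"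
    and \<Phi>_ge: "\<And>x. \<Phi> b \<le> \<Phi> x" and \<Phi>_le: "\<And>x. \<Phi> x \<le> \<Phi> a"
    and control: "\<And>i x y. x \<in> {a..b} \<Longrightarrow> y \<in> {a..b} \<Longrightarrow> \<bar>s' i x - s' i y\<bar> \<le> \<bar>\<Phi> x - \<Phi> y\<bar>"
    and osc_le: "\<And>x. \<Phi> (x - 2 * mesh K \<tau>) - \<Phi> (x + 2 * mesh K \<tau>) \<le> \<omega>"
begin

abbreviation H :: real where "H \<equiv> mesh K \<tau>"

text \<open>The half width \<open>2 * H\<close> is the reach of the quasi-interpolant in
  \<open>quasi_local\<close>.\<close>

definition osc :: "real \<Rightarrow> real" where "osc x = \<Phi> (x - 2 * H) - \<Phi> (x + 2 * H)"

definition V :: real where "V = \<Phi> a - \<Phi> b"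

lemma osc_nonneg: "0 \<le> osc x"
  using \<Phi>_anti[of "x - 2 * H" "x + 2 * H"] mesh_pos by (simp add: osc_def)

lemma \<omega>_nonneg: "0 \<le> \<omega>"
  using osc_nonneg[of 0] osc_le[of 0] by (simp add: osc_def)

lemma V_nonneg: "0 \<le> V"
  using \<Phi>_ge[of a] by (simp add: V_def)

lemma continuous_on_osc: "continuous_on S osc"
proof -
  have "continuous_on S (\<lambda>x. \<Phi> (x + k))" for k
    by (rule continuous_on_compose2[OF \<Phi>_cont]) (auto intro!: continuous_intros)
  from continuous_on_diff[OF this[of "- 2 * H"] this[of "2 * H"]] show ?thesis
    by (simp add: osc_def[abs_def])
qed

lemma integral_osc: "integral {a..b} osc \<le> 4 * H * V"
  using integral_shift_difference[OF \<Phi>_anti \<Phi>_cont \<Phi>_ge \<Phi>_le, of "2 * H" a b] mesh_pos price_range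
  by (simp add: osc_def[abs_def] V_def)

lemma s'_near:
  assumes "x \<in> {a..b}" "y \<in> {a..b}" "\<bar>y - x\<bar> \<le> 2 * H"
  shows "\<bar>s' i y - s' i x\<bar> \<le> osc x"
proof -
  have "\<Phi> (x + 2 * H) \<le> \<Phi> y" "\<Phi> y \<le> \<Phi> (x - 2 * H)" "\<Phi> (x + 2 * H) \<le> \<Phi> x" "\<Phi> x \<le> \<Phi> (x - 2 * H)"
    using assms(3) mesh_pos by (auto intro!: \<Phi>_anti)
  then show ?thesis using control[OF assms(2,1), of i] by (simp add: osc_def)
qed

lemma quasi_s': "x \<in> {a..b} \<Longrightarrow> \<bar>spl (lam (s' i)) x - s' i x\<bar> \<le> 3 * osc x"
  by (rule quasi_local) (auto intro!: s'_near)

text \<open>The derivative of \<open>g i\<close> is the quasi-interpolant of \<open>s' i\<close>.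
  Its squared deviation is at most \<open>9 * (osc x)\<^sup>2\<close>; one factor is replaced by
  \<open>\<omega>\<close> and the other integrates to order \<open>H\<close>, so the product is
  small compared with \<open>H\<close>. The supplies themselves differ by at most
  \<open>12 * H * V\<close>, which contributes only order \<open>H\<^sup>2\<close>.\<close>

lemma competitor:
  obtains g where "\<And>i. cubic_spline K \<tau> (g i)"
    "\<And>i. integral {a..b} (\<lambda>x. (foc_error c D a b g i x)\<^sup>2) \<le> H * (72 * \<omega> * V + 288 * W\<^sup>2 * V\<^sup>2 * (b - a) * H)"
proof -
  define g where "g i x = s i a + integral {a..x} (spl (lam (s' i)))" for i x
  have g': "(g i has_real_derivative spl (lam (s' i)) x) (at x within {a..b})" if "x \<in> {a..b}" for i x
    unfolding g_def[abs_def] using integral_has_real_derivative[OF continuous_on_spl that]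
    by (auto intro!: derivative_eq_intros)
  have g: "cubic_spline K \<tau> (g i)" for i using g' by (rule cubic_splineI)
  note int = integrable_continuous_real
  have gs: "\<bar>g i x - s i x\<bar> \<le> 12 * H * V" if x: "x \<in> {a..b}" for i x
  proof -
    have ax: "{a..x} \<subseteq> {a..b}" using x by auto
    have "\<bar>(g i x - s i x) - (g i a - s i a)\<bar> \<le> integral {a..x} (\<lambda>x. 3 * osc x)"
    proof (rule increment_bound)
      fix y assume "y \<in> {a..x}"
      then have y: "y \<in> {a..b}" using ax by blast
      show "((\<lambda>x. g i x - s i x) has_real_derivative spl (lam (s' i)) y - s' i y) (at y within {a..x})"
        using DERIV_subset[OF DERIV_diff[OF g'[OF y] s_deriv[OF y]] ax] .
    qed (use x ax quasi_s' in \<open>auto intro!: int continuous_intros continuous_on_osc\<close>)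
    also have "\<dots> \<le> integral {a..b} (\<lambda>x. 3 * osc x)"
      using ax osc_nonneg by (intro integral_subset_le int continuous_intros continuous_on_osc) auto
    also have "\<dots> \<le> 3 * (4 * H * V)" using integral_osc by simp
    finally show ?thesis by (simp add: g_def)
  qed
  have err: "foc_error c D a b g i x = (spl (lam (s' (rival i))) x - s' (rival i) x) - (g i x - s i x) / (x - c i)"
    if x: "x \<in> {a..b}" for i x
    using deriv_on_eqI[OF price_range x g'[OF x, of "rival i"]] foc[OF x, of i]
    by (simp add: foc_error_def foc_op_def diff_divide_distrib)
  have sq: "(foc_error c D a b g i x)\<^sup>2 \<le> 18 * \<omega> * osc x + 2 * W\<^sup>2 * (12 * H * V)\<^sup>2" if x: "x \<in> {a..b}" for i x
  proof -
    let ?p = "spl (lam (s' (rival i))) x - s' (rival i) x" and ?q = "(g i x - s i x) / (x - c i)"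
    have "\<bar>?p\<bar>\<^sup>2 \<le> (3 * osc x)\<^sup>2" using quasi_s'[OF x] by (intro power_mono) auto
    also have "(3 * osc x)\<^sup>2 = 9 * (osc x * osc x)" by (simp add: power2_eq_square)
    also have "\<dots> \<le> 9 * (\<omega> * osc x)"
      using osc_nonneg[of x] osc_le[of x] by (intro mult_left_mono mult_right_mono) (auto simp: osc_def)
    finally have p: "?p\<^sup>2 \<le> 9 * \<omega> * osc x" by simp
    have "\<bar>?q\<bar> = \<bar>g i x - s i x\<bar> * (1 / (x - c i))" using margin(1)[OF x, of i] by (simp add: abs_divide)
    also have "\<dots> \<le> (12 * H * V) * W"
      using gs[OF x, of i] margin[OF x, of i] mesh_pos V_nonneg by (intro mult_mono) auto
    finally have "\<bar>?q\<bar>\<^sup>2 \<le> (12 * H * V * W)\<^sup>2" by (intro power_mono) auto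
    then have q: "?q\<^sup>2 \<le> (12 * H * V)\<^sup>2 * W\<^sup>2" by (simp only: power2_abs power_mult_distrib)
    have "(y - z)\<^sup>2 \<le> 2 * y\<^sup>2 + 2 * z\<^sup>2" for y z :: real
      using zero_le_power2[of "y + z"] by (simp add: power2_diff power2_sum)
    from this[of ?p ?q] show ?thesis unfolding err[OF x] using p q by (simp add: mult.commute mult.left_commute)
  qed
  have "integral {a..b} (\<lambda>x. (foc_error c D a b g i x)\<^sup>2) \<le> H * (72 * \<omega> * V + 288 * W\<^sup>2 * V\<^sup>2 * (b - a) * H)" for i
  proof -
    have "integral {a..b} (\<lambda>x. (foc_error c D a b g i x)\<^sup>2) \<le> integral {a..b} (\<lambda>x. 18 * \<omega> * osc x + 2 * W\<^sup>2 * (12 * H * V)\<^sup>2)"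
      using sq by (intro integral_le int continuous_intros continuous_on_foc_error cubic_spline_C1 g continuous_on_osc) auto
    also have "\<dots> = 18 * \<omega> * integral {a..b} osc + 2 * W\<^sup>2 * (12 * H * V)\<^sup>2 * (b - a)"
      using price_range by (subst integral_add) (auto intro!: int continuous_intros continuous_on_osc)
    also have "\<dots> \<le> 18 * \<omega> * (4 * H * V) + 2 * W\<^sup>2 * (12 * H * V)\<^sup>2 * (b - a)"
      using mult_left_mono[OF integral_osc, of "18 * \<omega>"] \<omega>_nonneg by simp
    also have "\<dots> = H * (72 * \<omega> * V + 288 * W\<^sup>2 * V\<^sup>2 * (b - a) * H)"
      by (simp add: power2_eq_square algebra_simps)
    finally show ?thesis .
  qed
  then show ?thesis using that g by blast
qed

text \<open>On the longest interval a cubic has vanishing fourth difference, whereas that of an antiderivative of \<open>F\<close> is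
  of exact order \<open>H\<^sup>4\<close>; this bounds the coefficient \<open>\<beta>\<close>.\<close>

lemma kernel_coefficient_bound:
  assumes r: "cubic_spline K \<tau> r" and e: "continuous_on {a..b} e" and \<epsilon>: "0 < \<epsilon>"
    and e2: "integral {a..b} (\<lambda>x. (e x)\<^sup>2) \<le> 4 * \<epsilon>\<^sup>2 * H"
    and F: "\<And>x. x \<in> {a..b} \<Longrightarrow> (F has_real_derivative G (c Firm1) (c Firm2) x) (at x)"
    and A: "\<And>x. x \<in> {a..b} \<Longrightarrow> (A has_real_derivative F x) (at x)"
    and near: "\<And>x. x \<in> {a..b} \<Longrightarrow> \<bar>deriv_on {a..b} r x - s' i x - (\<gamma> + \<beta> * F x) - e x\<bar> \<le> Cker * (2 * \<epsilon> * (b - a))"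
  shows "\<bar>\<beta>\<bar> * H ^ 3 \<le> Cbeta * (\<omega> + \<epsilon>)"
proof -
  obtain t where t: "t \<in> {1..<K}" "gap t = H" using ex_gap_eq_mesh by blast
  define l where "l = \<tau> t"
  \<comment> \<open>Quartering the longest interval puts all five points of the fourth difference
    into it.\<close>
  define h where "h = H / 4"
  have h: "0 < h" "H = 4 * h" using mesh_pos by (simp_all add: h_def)
  have I: "{l..l + 4 * h} = {\<tau> t..\<tau> (t + 1)}" using gap_eq[OF t(1)] t(2) h by (simp add: l_def)
  have sub: "{l..l + 4 * h} \<subseteq> {a..b}" unfolding I by (rule interval_subset[OF t(1)])
  have lx: "l \<in> {a..b}" using sub h by auto
  \<comment> \<open>The derivative of \<open>v\<close> stays near the constant
    \<open>s' i l\<close>, up to \<open>C\<close> and \<open>e\<close>, so every first difference of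
    \<open>v\<close> is nearly \<open>s' i l * h\<close>, and this constant cancels in the fourth
    difference.\<close>
  define v where "v x = r x - \<beta> * A x - \<gamma> * x" for x
  define v' where "v' x = deriv_on {a..b} r x - \<beta> * F x - \<gamma>" for x
  define C where "C = \<omega> + Cker * (2 * \<epsilon> * (b - a))"
  have v': "(v has_real_derivative v' x) (at x within {a..b})" if "x \<in> {a..b}" for x
    unfolding v_def[abs_def] v'_def
    using C1_onD[OF cubic_spline_C1[OF r] that] has_field_derivative_at_within[OF A[OF that]]
    by (auto intro!: derivative_eq_intros)
  have v'_bound: "\<bar>v' x - s' i l\<bar> \<le> C + \<bar>e x\<bar>" if "x \<in> {l..l + 4 * h}" for x
  proof -
    have x: "x \<in> {a..b}" using that sub by blast
    have "\<bar>s' i x - s' i l\<bar> \<le> \<omega>"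
      using s'_near[OF lx x, of i] that h osc_le[of l] by (auto simp: osc_def)
    then show ?thesis using near[OF x] by (simp add: v'_def C_def)
  qed
  note int = integrable_continuous_real
  \<comment> \<open>The weight \<open>2 * \<epsilon>\<close> balances the two terms and makes the
    bound proportional to the length \<open>H\<close>.\<close>
  have e_int: "integral {l..l + 4 * h} (\<lambda>x. \<bar>e x\<bar>) \<le> 2 * \<epsilon> * H"
  proof -
    have "integral {l..l + 4 * h} (\<lambda>x. \<bar>e x\<bar>) \<le> 2 * \<epsilon> * (l + 4 * h - l) / 2 + integral {l..l + 4 * h} (\<lambda>x. (e x)\<^sup>2) / (2 * (2 * \<epsilon>))"
      by (rule weighted_abs_bound) (use h \<epsilon> continuous_on_subset[OF e sub] in auto)
    also have "integral {l..l + 4 * h} (\<lambda>x. (e x)\<^sup>2) \<le> integral {a..b} (\<lambda>x. (e x)\<^sup>2)"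
      using sub by (intro integral_subset_le int continuous_intros e continuous_on_subset[OF e sub]) auto
    also have "\<dots> \<le> 4 * \<epsilon>\<^sup>2 * H" by (rule e2)
    finally show ?thesis using \<epsilon> h by (simp add: divide_right_mono power2_eq_square)
  qed
  have step: "\<bar>fd h v x - s' i l * h\<bar> \<le> C * h + 8 * \<epsilon> * h" if x: "l \<le> x" "x \<le> l + 3 * h" for x
  proof -
    have sx: "{x..x + h} \<subseteq> {l..l + 4 * h}" using x by auto
    have "\<bar>(v (x + h) - s' i l * (x + h)) - (v x - s' i l * x)\<bar> \<le> integral {x..x + h} (\<lambda>x. C + \<bar>e x\<bar>)"
    proof (rule increment_bound)
      fix y assume y: "y \<in> {x..x + h}"
      then have y': "y \<in> {l..l + 4 * h}" "y \<in> {a..b}" using sx sub by blast+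
      have "((\<lambda>x. v x - s' i l * x) has_real_derivative v' y - s' i l) (at y within {a..b})"
        using v'[OF y'(2)] by (auto intro!: derivative_eq_intros)
      then show "((\<lambda>x. v x - s' i l * x) has_real_derivative v' y - s' i l) (at y within {x..x + h})"
        by (rule DERIV_subset) (use sx sub in blast)
      show "\<bar>v' y - s' i l\<bar> \<le> C + \<bar>e y\<bar>" by (rule v'_bound[OF y'(1)])
    next
      show "(\<lambda>x. C + \<bar>e x\<bar>) integrable_on {x..x + h}"
        using sx sub by (intro int continuous_intros continuous_on_subset[OF e]) auto
    qed (use h in auto)
    also have "\<dots> = C * h + integral {x..x + h} (\<lambda>x. \<bar>e x\<bar>)"
      using sx sub h by (subst integral_add) (auto intro!: int continuous_intros continuous_on_subset[OF e])
    also have "integral {x..x + h} (\<lambda>x. \<bar>e x\<bar>) \<le> integral {l..l + 4 * h} (\<lambda>x. \<bar>e x\<bar>)"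
      using sx sub by (intro integral_subset_le int continuous_intros continuous_on_subset[OF e]) auto
    also have "\<dots> \<le> 2 * \<epsilon> * H" by (rule e_int)
    finally show ?thesis using h by (simp add: fd_def algebra_simps)
  qed
  have v4: "\<bar>(fd h ^^ 4) v l\<bar> \<le> 8 * (C * h + 8 * \<epsilon> * h)"
    using step[of l] step[of "l + h"] step[of "l + 2 * h"] step[of "l + 3 * h"] h unfolding fd4_eq by simp
  obtain q :: "real poly" where q: "degree q \<le> 3" "\<And>x. x \<in> {l..l + 4 * h} \<Longrightarrow> r x = poly q x"
    using r t unfolding cubic_spline_def I by blast
  have r_eq: "r x = coeff q 0 + coeff q 1 * x + coeff q 2 * x\<^sup>2 + coeff q 3 * x ^ 3" if "x \<in> {l..l + 4 * h}" for x
    using q(2)[OF that] poly_degree_3[OF q(1)] by simp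
  have fd4_poly: "(fd h ^^ 4) v l = - \<beta> * (fd h ^^ 4) A l"
  proof -
    have pts: "l \<in> {l..l + 4 * h}" "l + h \<in> {l..l + 4 * h}" "l + 2 * h \<in> {l..l + 4 * h}" "l + 3 * h \<in> {l..l + 4 * h}"
      "l + 4 * h \<in> {l..l + 4 * h}" using h by auto
    have e4: "(fd h ^^ 4) f l = f (l + 4 * h) - 4 * f (l + 3 * h) + 6 * f (l + 2 * h) - 4 * f (l + h) + f l" for f
    proof -
      have eqs: "l + 3 * h + h = l + 4 * h" "l + 2 * h + h = l + 3 * h" "l + h + h = l + 2 * h" by simp_all
      have "A - B - 3 * (B - C) + 3 * (C - D) - (D - E) = A - 4 * B + 6 * C - 4 * D + E" for A B C D E :: real by simp
      then show ?thesis unfolding fd4_eq fd_def eqs by blast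
    qed
    show ?thesis unfolding e4 v_def pts[THEN r_eq] by (simp add: algebra_simps power2_eq_square power3_eq_cube)
  qed
  have "h ^ 4 * (12 / L ^ 5) \<le> (fd h ^^ 4) A l"
  proof (rule fd4_lower_bound)
    fix y assume "y \<in> {l..l + 4 * h}"
    then have y: "y \<in> {a..b}" using sub by blast
    have nz: "y \<noteq> c Firm1" "y \<noteq> c Firm2" using margin(1)[OF y, of Firm1] margin(1)[OF y, of Firm2] by auto
    show "(A has_real_derivative F y) (at y)" "(F has_real_derivative G (c Firm1) (c Firm2) y) (at y)"
      using A[OF y] F[OF y] by auto
    show "(G (c Firm1) (c Firm2) has_real_derivative G1 (c Firm1) (c Firm2) y) (at y)"
      "(G1 (c Firm1) (c Firm2) has_real_derivative G2 (c Firm1) (c Firm2) y) (at y)"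
      by (intro G_deriv G1_deriv nz)+
    show "12 / L ^ 5 \<le> G2 (c Firm1) (c Firm2) y" by (rule G2_bounds(1)[where w = W]) (use margin[OF y] in auto)
  qed (rule h)
  then have "\<bar>\<beta>\<bar> * (h ^ 4 * (12 / L ^ 5)) \<le> \<bar>\<beta>\<bar> * \<bar>(fd h ^^ 4) A l\<bar>" by (intro mult_left_mono) auto
  also have "\<dots> = \<bar>(fd h ^^ 4) v l\<bar>" by (simp add: fd4_poly abs_mult)
  also have "\<dots> \<le> 8 * (C * h + 8 * \<epsilon> * h)" by (rule v4)
  finally have "h * (\<bar>\<beta>\<bar> * h ^ 3 * (12 / L ^ 5)) \<le> h * (8 * (C + 8 * \<epsilon>))"
    by (simp add: algebra_simps eval_nat_numeral)
  then have "\<bar>\<beta>\<bar> * h ^ 3 * (12 / L ^ 5) \<le> 8 * (C + 8 * \<epsilon>)" by (rule mult_left_le_imp_le[OF _ h(1)])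
  then have "\<bar>\<beta>\<bar> * h ^ 3 * 12 \<le> 8 * (C + 8 * \<epsilon>) * L ^ 5" using L_pos by (simp add: field_simps)
  moreover have "C + 8 * \<epsilon> \<le> (2 * Cker * (b - a) + 8) * (\<omega> + \<epsilon>)"
  proof -
    have "0 \<le> (2 * Cker * (b - a) + 7) * \<omega>" using Cker_pos price_range \<omega>_nonneg by (intro mult_nonneg_nonneg add_nonneg_nonneg) auto
    then show ?thesis by (simp add: C_def algebra_simps)
  qed
  then have "8 * (C + 8 * \<epsilon>) * L ^ 5 \<le> 8 * ((2 * Cker * (b - a) + 8) * (\<omega> + \<epsilon>)) * L ^ 5" using L_pos by simp
  ultimately have "\<bar>\<beta>\<bar> * h ^ 3 * 12 \<le> 8 * ((2 * Cker * (b - a) + 8) * (\<omega> + \<epsilon>)) * L ^ 5" by linarith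
  moreover have "0 \<le> (2 * Cker * (b - a) + 8) * (\<omega> + \<epsilon>) * L ^ 5"
    using Cker_pos price_range \<omega>_nonneg \<epsilon> L_pos by (intro mult_nonneg_nonneg add_nonneg_nonneg) auto
  moreover have "\<bar>\<beta>\<bar> * H ^ 3 = 64 * (\<bar>\<beta>\<bar> * h ^ 3)" unfolding h(2) by (simp add: power_mult_distrib)
  moreover have "Cbeta * (\<omega> + \<epsilon>) = 64 * ((2 * Cker * (b - a) + 8) * (\<omega> + \<epsilon>) * L ^ 5)" by (simp add: Cbeta_def)
  ultimately show ?thesis by linarith
qed

text \<open>The third derivative of \<open>\<kappa>\<close> is \<open>k * G2 (c i) (c j)\<close>, so
  \<open>quasi_order3\<close> applies with \<open>M = \<bar>k\<bar> * (12 * W ^ 5)\<close>.\<close>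

lemma quasi_kernel:
  assumes d: "\<And>x. x \<in> {a..b} \<Longrightarrow> (\<kappa> has_real_derivative k * G (c i) (c j) x) (at x)" and x: "x \<in> {a..b}"
  shows "\<bar>spl (lam \<kappa>) x - \<kappa> x\<bar> \<le> 144 * W ^ 5 * (\<bar>k\<bar> * H ^ 3)"
proof -
  have "\<bar>spl (lam \<kappa>) x - \<kappa> x\<bar> \<le> 12 * (\<bar>k\<bar> * (12 * W ^ 5)) * H ^ 3"
  proof (rule quasi_order3[OF _ _ _ _ x])
    fix y assume y: "y \<in> {a..b}"
    have nz: "y \<noteq> c i" "y \<noteq> c j" using margin(1)[OF y, of i] margin(1)[OF y, of j] by auto
    show "(\<kappa> has_real_derivative k * G (c i) (c j) y) (at y within {a..b})"
      by (rule has_field_derivative_at_within[OF d[OF y]])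
    show "((\<lambda>y. k * G (c i) (c j) y) has_real_derivative k * G1 (c i) (c j) y) (at y within {a..b})"
      "((\<lambda>y. k * G1 (c i) (c j) y) has_real_derivative k * G2 (c i) (c j) y) (at y within {a..b})"
      by (intro DERIV_cmult G_deriv G1_deriv nz)+
    have "\<bar>G2 (c i) (c j) y\<bar> \<le> 12 * W ^ 5" by (rule G2_bounds(2)[where l = L]) (use margin[OF y] in auto)
    then show "\<bar>k * G2 (c i) (c j) y\<bar> \<le> \<bar>k\<bar> * (12 * W ^ 5)" unfolding abs_mult by (intro mult_left_mono) auto
  qed
  then show ?thesis by (simp add: mult.assoc mult.left_commute)
qed

text \<open>Up to the kernel error the residual is \<open>f = r' - s' - \<kappa>\<close>, with
  \<open>\<kappa>\<close> taken from the kernel, and the spline is \<open>spl (lam f)\<close>. The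
  term \<open>r'\<close>, for which no bound is available, is reproduced exactly and drops out; only
  the quasi-interpolation errors of \<open>s'\<close> and \<open>\<kappa>\<close> remain.\<close>

lemma residual_near_spline:
  assumes r: "\<And>i. cubic_spline K \<tau> (r i)" and \<epsilon>: "0 < \<epsilon>"
    and e2: "\<And>i. integral {a..b} (\<lambda>x. (foc_error c D a b r i x)\<^sup>2) \<le> 4 * \<epsilon>\<^sup>2 * H"
  shows "\<exists>\<alpha>. \<forall>x\<in>{a..b}. \<bar>foc_error c D a b r i x - spl \<alpha> x\<bar> \<le> Capx * (\<omega> + \<epsilon>)"
proof -
  have C1: "C1_on {a..b} (r i)" for i by (rule cubic_spline_C1[OF r])
  let ?\<mu> = "2 * \<epsilon> * (b - a)"
  have \<mu>: "integral {a..b} (\<lambda>x. \<bar>foc_error c D a b r i x\<bar>) \<le> ?\<mu>" for i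
  proof -
    have "integral {a..b} (\<lambda>x. \<bar>foc_error c D a b r i x\<bar>) \<le>
      2 * \<epsilon> * (b - a) / 2 + integral {a..b} (\<lambda>x. (foc_error c D a b r i x)\<^sup>2) / (2 * (2 * \<epsilon>))"
      using \<epsilon> price_range by (intro weighted_abs_bound continuous_on_foc_error C1) auto
    also have "\<dots> \<le> \<epsilon> * (b - a) + 4 * \<epsilon>\<^sup>2 * H / (2 * (2 * \<epsilon>))"
    proof -
      have "integral {a..b} (\<lambda>x. (foc_error c D a b r i x)\<^sup>2) / (2 * (2 * \<epsilon>)) \<le> 4 * \<epsilon>\<^sup>2 * H / (2 * (2 * \<epsilon>))"
        by (rule divide_right_mono[OF e2]) (use \<epsilon> in simp)
      then show ?thesis by simp
    qed
    also have "\<dots> = \<epsilon> * (b - a) + \<epsilon> * H" using \<epsilon> by (simp add: power2_eq_square)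
    also have "\<dots> \<le> \<epsilon> * (b - a) + \<epsilon> * (b - a)" using mesh_le \<epsilon> by simp
    finally show ?thesis by simp
  qed
  obtain F A where F: "\<And>x. x \<in> {a..b} \<Longrightarrow> (F has_real_derivative G (c Firm1) (c Firm2) x) (at x)"
    and A: "\<And>x. x \<in> {a..b} \<Longrightarrow> (A has_real_derivative F x) (at x)"
    using kernel_antiderivatives by blast
  obtain \<beta> \<gamma> where near1: "\<And>x. x \<in> {a..b} \<Longrightarrow> \<bar>deriv_on {a..b} (r Firm2) x - s' Firm2 x - (\<gamma> + \<beta> * F x)
        - foc_error c D a b r Firm1 x\<bar> \<le> Cker * ?\<mu>"
    and near2: "\<And>x. x \<in> {a..b} \<Longrightarrow> \<bar>deriv_on {a..b} (r Firm1) x - s' Firm1 x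
        - (\<gamma> + \<beta> * (F x + 1 / ((x - c Firm1) * (x - c Firm2)))) - foc_error c D a b r Firm2 x\<bar> \<le> Cker * ?\<mu>"
    using kernel_decomposition[OF C1 F \<mu>] by metis
  have \<beta>: "\<bar>\<beta>\<bar> * H ^ 3 \<le> Cbeta * (\<omega> + \<epsilon>)"
    by (rule kernel_coefficient_bound[OF r continuous_on_foc_error[OF C1] \<epsilon> e2 F A near1])
  have main: "\<exists>\<alpha>. \<forall>x\<in>{a..b}. \<bar>e x - spl \<alpha> x\<bar> \<le> Capx * (\<omega> + \<epsilon>)"
    if near: "\<And>x. x \<in> {a..b} \<Longrightarrow> \<bar>deriv_on {a..b} (r j) x - s' j x - \<kappa> x - e x\<bar> \<le> Cker * ?\<mu>"
      and \<kappa>: "\<And>x. x \<in> {a..b} \<Longrightarrow> (\<kappa> has_real_derivative k * G (c p) (c q) x) (at x)" and k: "\<bar>k\<bar> = \<bar>\<beta>\<bar>"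
    for e \<kappa> j k p q
  proof (intro exI ballI)
    fix x assume x: "x \<in> {a..b}"
    let ?f = "\<lambda>x. deriv_on {a..b} (r j) x - s' j x - \<kappa> x"
    have "spl (lam ?f) x = deriv_on {a..b} (r j) x - spl (lam (s' j)) x - spl (lam \<kappa>) x"
      by (simp only: spl_lam_diff cubic_spline_deriv[OF r x])
    moreover have "\<bar>spl (lam (s' j)) x - s' j x\<bar> \<le> 3 * \<omega>"
      using quasi_s'[OF x, of j] osc_le[of x] by (simp add: osc_def)
    moreover have "\<bar>spl (lam \<kappa>) x - \<kappa> x\<bar> \<le> 144 * W ^ 5 * (Cbeta * (\<omega> + \<epsilon>))"
    proof -
      have "144 * W ^ 5 * (\<bar>k\<bar> * H ^ 3) \<le> 144 * W ^ 5 * (Cbeta * (\<omega> + \<epsilon>))"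
        unfolding k using \<beta> W_pos by (intro mult_left_mono) auto
      then show ?thesis using quasi_kernel[OF \<kappa> x] by linarith
    qed
    moreover have "Cker * ?\<mu> + 3 * \<omega> + 144 * W ^ 5 * (Cbeta * (\<omega> + \<epsilon>)) \<le> Capx * (\<omega> + \<epsilon>)"
    proof -
      have "0 \<le> 2 * Cker * (b - a) * \<omega>" using Cker_pos price_range \<omega>_nonneg by (intro mult_nonneg_nonneg) auto
      then show ?thesis using \<epsilon> by (simp add: Capx_def algebra_simps)
    qed
    ultimately show "\<bar>e x - spl (lam ?f) x\<bar> \<le> Capx * (\<omega> + \<epsilon>)" using near[OF x] by linarith
  qed
  show ?thesis
  proof (cases i)
    case Firm1
    show ?thesis unfolding Firm1
    proof (rule main[OF near1, where k = \<beta> and p = Firm1 and q = Firm2])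
      show "((\<lambda>x. \<gamma> + \<beta> * F x) has_real_derivative \<beta> * G (c Firm1) (c Firm2) x) (at x)" if "x \<in> {a..b}" for x
        using F[OF that] by (auto intro!: derivative_eq_intros)
    qed auto
  next
    case Firm2
    show ?thesis unfolding Firm2
    \<comment> \<open>Differentiating \<open>F + 1 / ((x - c Firm1) * (x - c Firm2))\<close> cancels
      \<open>G (c Firm1) (c Firm2)\<close> and leaves \<open>G\<close> with exchanged costs, whence
      the sign of \<open>k\<close>.\<close>
    proof (rule main[OF near2, where k = "- \<beta>" and p = Firm2 and q = Firm1])
      fix x assume x: "x \<in> {a..b}"
      have nz: "x \<noteq> c Firm1" "x \<noteq> c Firm2" using margin(1)[OF x, of Firm1] margin(1)[OF x, of Firm2] by auto
      have "((\<lambda>x. 1 / ((x - c Firm1) * (x - c Firm2))) has_real_derivative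
          - (G (c Firm1) (c Firm2) x + G (c Firm2) (c Firm1) x)) (at x)"
        using has_derivative_inverse_powers[OF nz, of 1 1 UNIV] by (simp add: G_def power2_eq_square mult.commute)
      then have "((\<lambda>x. \<gamma> + \<beta> * (F x + 1 / ((x - c Firm1) * (x - c Firm2)))) has_real_derivative
          0 + \<beta> * (G (c Firm1) (c Firm2) x + - (G (c Firm1) (c Firm2) x + G (c Firm2) (c Firm1) x))) (at x)"
        by (intro DERIV_add DERIV_const DERIV_cmult F[OF x])
      then show "((\<lambda>x. \<gamma> + \<beta> * (F x + 1 / ((x - c Firm1) * (x - c Firm2)))) has_real_derivative - \<beta> * G (c Firm2) (c Firm1) x) (at x)"
        by simp
    qed auto
  qed
qed

end

section \<open>Uniform convergence\<close>

context approximation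
begin

text \<open>For fixed knots all error functions lie in one finite-dimensional space, as
  \<open>integral_square_le_riemann\<close> requires: B-splines from the derivative of the rival,
  antiderivatives of B-splines and the value at \<open>a\<close> from the own supply, both divided
  by the margin, and \<open>D'\<close>.\<close>

lemma foc_error_span:
  fixes i :: firm
  defines "\<phi> \<equiv> case_sum (\<lambda>k. spl (unit k)) (case_sum (\<lambda>k x. integral {a..x} (spl (unit k)) / (x - c i))
    (\<lambda>z x. if z then 1 / (x - c i) else deriv_on {a..b} D x))"
  assumes r: "\<And>i. cubic_spline K \<tau> (r i)"
  shows "\<exists>q. \<forall>x\<in>{a..b}. foc_error c D a b r i x = (\<Sum>\<iota>\<in>{..K} <+> ({..K} <+> UNIV). q \<iota> * \<phi> \<iota> x)"
proof -
  let ?l = "\<lambda>i. lam (deriv_on {a..b} (r i))"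
  define q where "q = case_sum (?l (rival i)) (case_sum (\<lambda>k. - ?l i k) (\<lambda>z. if z then - r i a else - 1))"
  have "foc_error c D a b r i x = (\<Sum>\<iota>\<in>{..K} <+> ({..K} <+> UNIV). q \<iota> * \<phi> \<iota> x)" if x: "x \<in> {a..b}" for x
  proof -
    have ax: "{a..x} \<subseteq> {a..b}" using x by auto
    have sp: "deriv_on {a..b} (r j) y = (\<Sum>k\<le>K. ?l j k * spl (unit k) y)" if "y \<in> {a..b}" for j y
      by (rule trans[OF cubic_spline_deriv[OF r[of j] that, symmetric] spl_eq_sum[OF that]])
    have "((\<lambda>y. \<Sum>k\<le>K. ?l i k * spl (unit k) y) has_integral r i x - r i a) {a..x}"
    proof (rule fundamental_theorem_of_calculus)
      fix y assume "y \<in> {a..x}"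
      then have y: "y \<in> {a..b}" using ax by blast
      show "(r i has_vector_derivative (\<Sum>k\<le>K. ?l i k * spl (unit k) y)) (at y within {a..x})"
        unfolding sp[OF y, symmetric] has_real_derivative_iff_has_vector_derivative[symmetric]
        by (rule DERIV_subset[OF C1_onD[OF cubic_spline_C1[OF r] y] ax])
    qed (use x in simp)
    then have "r i x - r i a = integral {a..x} (\<lambda>y. \<Sum>k\<le>K. ?l i k * spl (unit k) y)" by (simp add: integral_unique)
    also have "\<dots> = (\<Sum>k\<le>K. integral {a..x} (\<lambda>y. ?l i k * spl (unit k) y))"
      by (rule integral_sum)
        (auto intro!: integrable_continuous_real continuous_intros continuous_on_subset[OF continuous_on_spl ax])
    finally have "r i x = r i a + (\<Sum>k\<le>K. ?l i k * integral {a..x} (spl (unit k)))" by simp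
    then show ?thesis
      by (simp add: foc_error_def sp[OF x] sum.Plus UNIV_bool q_def \<phi>_def add_divide_distrib sum_divide_distrib sum_negf)
  qed
  then show ?thesis by blast
qed

lemma eventually_integral_foc_error:
  "\<forall>\<^sub>F N in sequentially. \<forall>r. (\<forall>i. cubic_spline K \<tau> (r i)) \<longrightarrow>
     integral {a..b} (\<lambda>x. (foc_error c D a b r i x)\<^sup>2) \<le> 2 * riemann a b N (\<lambda>x. (foc_error c D a b r i x)\<^sup>2)"
proof -
  let ?\<phi> = "case_sum (\<lambda>k. spl (unit k)) (case_sum (\<lambda>k x. integral {a..x} (spl (unit k)) / (x - c i))
    (\<lambda>z x. if z then 1 / (x - c i) else deriv_on {a..b} D x))"
  have nz: "x - c i \<noteq> 0" if "x \<in> {a..b}" for x using margin(1)[OF that, of i] by simp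
  have P: "continuous_on {a..b} (\<lambda>x. integral {a..x} (spl (unit k)))" for k
    using indefinite_integral_continuous_1[OF integrable_continuous_real[OF continuous_on_spl]] .
  have "continuous_on {a..b} (?\<phi> \<iota>)" for \<iota> :: "nat + (nat + bool)"
  proof (cases \<iota>)
    case (Inr z)
    show ?thesis
    proof (cases z)
      case (Inr y)
      then show ?thesis using \<open>\<iota> = Inr z\<close> D_C1 nz by (cases y) (auto simp: C1_on_def intro!: continuous_intros)
    qed (use Inr P nz in \<open>auto intro!: continuous_intros\<close>)
  qed (simp add: continuous_on_spl)
  then have "\<forall>\<^sub>F N in sequentially. \<forall>f. (\<exists>q. \<forall>x\<in>{a..b}. f x = (\<Sum>\<iota>\<in>{..K} <+> ({..K} <+> UNIV). q \<iota> * ?\<phi> \<iota> x))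
    \<longrightarrow> integral {a..b} (\<lambda>x. (f x)\<^sup>2) \<le> 2 * riemann a b N (\<lambda>x. (f x)\<^sup>2)"
    by (intro integral_square_le_riemann price_range) auto
  then show ?thesis
  proof eventually_elim
    case (elim N)
    then show ?case using foc_error_span by blast
  qed
qed

text \<open>Only the supply of the rival is varied, by an antiderivative of a B-spline. It enters
  the condition of firm \<open>i\<close> through its derivative and that of the rival through its
  value, so a moment of one error is traded for a smoothed moment of the other.\<close>

lemma test_function:
  assumes sol: "lsq_solution c D a b K \<tau> N r" and N: "2 \<le> N"
  shows "riemann a b N (\<lambda>x. foc_error c D a b r i x * spl (unit j) x) =
    riemann a b N (\<lambda>x. foc_error c D a b r (rival i) x * (integral {a..x} (spl (unit j)) / (x - c (rival i))))"
proof -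
  define v where "v k x = (if k = rival i then integral {a..x} (spl (unit j)) else 0)" for k x
  have ri: "rival i \<noteq> i" "rival (rival i) = i" by (cases i; simp)+
  have v': "(v (rival i) has_real_derivative spl (unit j) x) (at x within {a..b})" "(v i has_real_derivative 0) (at x within {a..b})"
    if "x \<in> {a..b}" for x
    unfolding v_def[abs_def] using integral_has_real_derivative[OF continuous_on_spl that] ri by simp_all
  have "spl (\<lambda>_. 0) x = 0" for x using spl_linear[of 0 "\<lambda>_. 0" 0 "\<lambda>_. 0" x] by simp
  then have "cubic_spline K \<tau> (v i)" "cubic_spline K \<tau> (v (rival i))"
    using v' cubic_splineI[of "v i" "\<lambda>_. 0"] cubic_splineI[of "v (rival i)" "unit j"] by auto
  then have v: "cubic_spline K \<tau> (v k)" for k by (cases i; cases k) auto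
  have op: "foc_op c a b v i x = spl (unit j) x"
    "foc_op c a b v (rival i) x = - (integral {a..x} (spl (unit j)) / (x - c (rival i)))" if "x \<in> {a..b}" for x
    using deriv_on_eqI[OF price_range that v'(1)[OF that]] deriv_on_eqI[OF price_range that v'(2)[OF that]] ri
    by (simp_all add: foc_op_def) (simp_all add: v_def)
  have "riemann a b N (\<lambda>x. foc_error c D a b r i x * foc_op c a b v i x)
    + riemann a b N (\<lambda>x. foc_error c D a b r (rival i) x * foc_op c a b v (rival i) x) = 0"
    using lsq_orthogonal[OF sol v N] by (cases i) (simp_all add: add.commute)
  moreover have "riemann a b N (\<lambda>x. foc_error c D a b r i x * foc_op c a b v i x)
      = riemann a b N (\<lambda>x. foc_error c D a b r i x * spl (unit j) x)"
    using op by (intro riemann_cong[OF price_range N]) simp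
  moreover have "riemann a b N (\<lambda>x. foc_error c D a b r (rival i) x * foc_op c a b v (rival i) x)
      = riemann a b N (\<lambda>x. - 1 * (foc_error c D a b r (rival i) x * (integral {a..x} (spl (unit j)) / (x - c (rival i)))))"
    using op by (intro riemann_cong[OF price_range N]) simp
  ultimately show ?thesis unfolding riemann_mult by simp
qed

lemma riemann_abs_bound:
  assumes N: "2 \<le> N" and \<epsilon>: "0 < \<epsilon>" and e2: "riemann a b N (\<lambda>x. (e x)\<^sup>2) \<le> 2 * \<epsilon>\<^sup>2 * H"
  shows "riemann a b N (\<lambda>x. \<bar>e x\<bar>) \<le> 2 * \<epsilon> * (b - a)"
proof -
  have "\<bar>y\<bar> \<le> \<epsilon> / 2 * 1 + 1 / (2 * \<epsilon>) * y\<^sup>2" for y :: real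
    using sum_squares_bound[of \<epsilon> "\<bar>y\<bar>"] \<epsilon> by (simp add: field_simps power2_eq_square)
  then have "riemann a b N (\<lambda>x. \<bar>e x\<bar>) \<le> riemann a b N (\<lambda>x. \<epsilon> / 2 * 1 + 1 / (2 * \<epsilon>) * (e x)\<^sup>2)"
    by (intro riemann_mono[OF price_range N]) auto
  also have "\<dots> = \<epsilon> / 2 * riemann a b N (\<lambda>_. 1) + 1 / (2 * \<epsilon>) * riemann a b N (\<lambda>x. (e x)\<^sup>2)"
    by (simp only: riemann_add riemann_mult)
  also have "\<dots> \<le> \<epsilon> / 2 * (2 * (b - a)) + 1 / (2 * \<epsilon>) * (2 * \<epsilon>\<^sup>2 * H)"
  proof (intro add_mono mult_left_mono e2)
    have "real N / (real N - 1) \<le> 2" using N by (simp add: field_simps)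
    then have "(b - a) * (real N / (real N - 1)) \<le> (b - a) * 2" using price_range by (intro mult_left_mono) auto
    then show "riemann a b N (\<lambda>_. 1) \<le> 2 * (b - a)" by (simp add: riemann_def)
  qed (use \<epsilon> in auto)
  also have "\<dots> = \<epsilon> * (b - a) + \<epsilon> * H" using \<epsilon> by (simp add: power2_eq_square)
  also have "\<dots> \<le> \<epsilon> * (b - a) + \<epsilon> * (b - a)" using mesh_le \<epsilon> by simp
  finally show ?thesis by simp
qed

lemma riemann_abs:
  assumes N: "2 \<le> N"
  shows "\<bar>riemann a b N f\<bar> \<le> riemann a b N (\<lambda>x. \<bar>f x\<bar>)"
proof -
  have "riemann a b N f \<le> riemann a b N (\<lambda>x. \<bar>f x\<bar>)"
    "riemann a b N (\<lambda>x. - 1 * f x) \<le> riemann a b N (\<lambda>x. \<bar>f x\<bar>)"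
    by (intro riemann_mono[OF price_range N]; simp)+
  then show ?thesis unfolding riemann_mult by linarith
qed

text \<open>A B-spline moment of \<open>spl \<alpha>\<close> splits into two parts, both
  proportional to \<open>support j\<close>, as \<open>sup\<close> demands. For the moment of the
  error this holds because the antiderivative of the B-spline is at most \<open>support j\<close>;
  for that of the difference because the sampled mass is at most
  \<open>2 * support j\<close>.\<close>

lemma foc_error_bound:
  assumes sol: "lsq_solution c D a b K \<tau> N r" and N: "2 \<le> N" and \<epsilon>: "0 < \<epsilon>"
    and samp: "sampled_objective c D a b N r \<le> 2 * \<epsilon>\<^sup>2 * H"
    and norm: "\<And>i. integral {a..b} (\<lambda>x. (foc_error c D a b r i x)\<^sup>2) \<le> 2 * riemann a b N (\<lambda>x. (foc_error c D a b r i x)\<^sup>2)"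
    and sup: "\<And>\<beta> \<epsilon>. (\<forall>j\<le>K. \<bar>riemann a b N (\<lambda>x. spl \<beta> x * spl (unit j) x)\<bar> \<le> \<epsilon> * support j)
      \<Longrightarrow> (\<forall>x\<in>{a..b}. \<bar>spl \<beta> x\<bar> \<le> 1000 * \<epsilon>)"
    and mass: "\<And>j. j \<le> K \<Longrightarrow> riemann a b N (spl (unit j)) \<le> 2 * support j"
    and x: "x \<in> {a..b}"
  shows "\<bar>foc_error c D a b r i x\<bar> \<le> Cfin * (\<omega> + \<epsilon>)"
proof -
  let ?e = "foc_error c D a b r"
  have r: "cubic_spline K \<tau> (r i)" for i using sol by (simp add: lsq_solution_def is_arg_min_def)
  have nonneg: "0 \<le> riemann a b N (\<lambda>x. (?e i x)\<^sup>2)" for i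
    using riemann_mono[OF price_range N, of "\<lambda>_. 0" "\<lambda>x. (?e i x)\<^sup>2"] by (simp add: riemann_def)
  have e2: "riemann a b N (\<lambda>x. (?e i x)\<^sup>2) \<le> 2 * \<epsilon>\<^sup>2 * H" for i
    using samp nonneg[of Firm1] nonneg[of Firm2] unfolding sampled_objective_def by (cases i) auto
  have "integral {a..b} (\<lambda>x. (?e i x)\<^sup>2) \<le> 4 * \<epsilon>\<^sup>2 * H" for i using norm[of i] e2[of i] by linarith
  from residual_near_spline[OF r \<epsilon> this, of i] obtain \<alpha> where
    \<alpha>: "\<And>x. x \<in> {a..b} \<Longrightarrow> \<bar>?e i x - spl \<alpha> x\<bar> \<le> Capx * (\<omega> + \<epsilon>)" by blast
  define \<theta> where "\<theta> = Capx * (\<omega> + \<epsilon>)"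
  have "0 \<le> \<theta>" using Capx_pos \<omega>_nonneg \<epsilon> by (simp add: \<theta>_def)
  have "\<bar>riemann a b N (\<lambda>x. spl \<alpha> x * spl (unit j) x)\<bar> \<le> (2 * \<theta> + 2 * W * (b - a) * \<epsilon>) * support j" if j: "j \<le> K" for j
  proof -
    let ?N = "spl (unit j)" and ?P = "\<lambda>x. integral {a..x} (spl (unit j))"
    have "riemann a b N (\<lambda>x. spl \<alpha> x * ?N x) = riemann a b N (\<lambda>x. ?e i x * ?N x + - 1 * ((?e i x - spl \<alpha> x) * ?N x))"
      by (rule arg_cong[where f = "riemann a b N"]) (auto simp: algebra_simps)
    also have "\<dots> = riemann a b N (\<lambda>x. ?e i x * ?N x) - riemann a b N (\<lambda>x. (?e i x - spl \<alpha> x) * ?N x)"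
      by (simp only: riemann_add riemann_mult)
    finally have split: "riemann a b N (\<lambda>x. spl \<alpha> x * ?N x) =
      riemann a b N (\<lambda>x. ?e i x * ?N x) - riemann a b N (\<lambda>x. (?e i x - spl \<alpha> x) * ?N x)" .
    have "\<bar>riemann a b N (\<lambda>x. (?e i x - spl \<alpha> x) * ?N x)\<bar> \<le> riemann a b N (\<lambda>x. \<bar>(?e i x - spl \<alpha> x) * ?N x\<bar>)"
      by (rule riemann_abs[OF N])
    also have "\<dots> \<le> riemann a b N (\<lambda>x. \<theta> * ?N x)"
      using \<alpha> spl_unit_nonneg
      by (intro riemann_mono[OF price_range N]) (auto simp: abs_mult \<theta>_def intro!: mult_right_mono)
    also have "\<dots> \<le> \<theta> * (2 * support j)"
      unfolding riemann_mult using mass[OF j] \<open>0 \<le> \<theta>\<close> by (rule mult_left_mono)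
    finally have 1: "\<bar>riemann a b N (\<lambda>x. (?e i x - spl \<alpha> x) * ?N x)\<bar> \<le> \<theta> * (2 * support j)" .
    have P: "0 \<le> ?P x" "?P x \<le> support j" if "x \<in> {a..b}" for x
    proof -
      have ax: "{a..x} \<subseteq> {a..b}" using that by auto
      note int = integrable_continuous_real[OF continuous_on_subset[OF continuous_on_spl]]
      show "0 \<le> ?P x" using ax spl_unit_nonneg by (intro integral_nonneg int) auto
      have "?P x \<le> integral {a..b} ?N" using ax spl_unit_nonneg by (intro integral_subset_le int) auto
      then show "?P x \<le> support j" using integral_spl_unit[of j] by simp
    qed
    have "\<bar>riemann a b N (\<lambda>x. ?e i x * ?N x)\<bar> \<le> riemann a b N (\<lambda>x. \<bar>?e (rival i) x * (?P x / (x - c (rival i)))\<bar>)"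
      unfolding test_function[OF sol N] by (rule riemann_abs[OF N])
    also have "\<dots> \<le> riemann a b N (\<lambda>x. support j * W * \<bar>?e (rival i) x\<bar>)"
    proof (rule riemann_mono[OF price_range N])
      fix y assume y: "y \<in> {a..b}"
      have "\<bar>?P y / (y - c (rival i))\<bar> = ?P y * (1 / (y - c (rival i)))"
        using P(1)[OF y] margin(1)[OF y, of "rival i"] by (simp add: abs_divide)
      also have "\<dots> \<le> support j * W"
        using P[OF y] margin[OF y, of "rival i"] by (intro mult_mono) auto
      finally have "\<bar>?P y / (y - c (rival i))\<bar> \<le> support j * W" .
      from mult_left_mono[OF this abs_ge_zero[of "?e (rival i) y"]]
      show "\<bar>?e (rival i) y * (?P y / (y - c (rival i)))\<bar> \<le> support j * W * \<bar>?e (rival i) y\<bar>"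
        by (simp only: abs_mult mult.commute)
    qed
    also have "\<dots> \<le> support j * W * (2 * \<epsilon> * (b - a))"
      unfolding riemann_mult using riemann_abs_bound[OF N \<epsilon> e2] W_pos support_pos[OF j] by (intro mult_left_mono) auto
    finally show ?thesis using 1 split by (simp add: algebra_simps)
  qed
  then have "\<bar>spl \<alpha> x\<bar> \<le> 1000 * (2 * \<theta> + 2 * W * (b - a) * \<epsilon>)" using sup x by blast
  then have "\<bar>?e i x\<bar> \<le> 2001 * \<theta> + 2000 * W * (b - a) * \<epsilon>" using \<alpha>[OF x] unfolding \<theta>_def[symmetric] by simp
  also have "\<dots> \<le> Cfin * (\<omega> + \<epsilon>)"
  proof -
    have "0 \<le> 2000 * W * (b - a) * \<omega>" using W_pos price_range \<omega>_nonneg by (intro mult_nonneg_nonneg) auto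
    then show ?thesis by (simp add: Cfin_def \<theta>_def algebra_simps)
  qed
  finally show ?thesis .
qed

text \<open>By \<open>small\<close> the squared errors of the competitor integrate to at most
  \<open>\<epsilon>\<^sup>2 * H\<close>, half of what is needed; the slack absorbs the sampling, and
  the minimiser does no worse.\<close>

lemma eventually_foc_error_bound:
  assumes \<epsilon>: "0 < \<epsilon>" and small: "144 * \<omega> * V + 576 * W\<^sup>2 * V\<^sup>2 * (b - a) * H \<le> \<epsilon>\<^sup>2"
  shows "\<forall>\<^sub>F N in sequentially. \<forall>r. lsq_solution c D a b K \<tau> N r \<longrightarrow>
    (\<forall>i. \<forall>x\<in>{a..b}. \<bar>foc_error c D a b r i x\<bar> \<le> Cfin * (\<omega> + \<epsilon>))"
proof -
  obtain g where g: "\<And>i. cubic_spline K \<tau> (g i)"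
    and g2: "\<And>i. integral {a..b} (\<lambda>x. (foc_error c D a b g i x)\<^sup>2) \<le> H * (72 * \<omega> * V + 288 * W\<^sup>2 * V\<^sup>2 * (b - a) * H)"
    using competitor by metis
  let ?g = "\<lambda>i x. (foc_error c D a b g i x)\<^sup>2"
  have "continuous_on {a..b} (?g i)" for i
    by (intro continuous_intros continuous_on_foc_error cubic_spline_C1 g)
  then have "(\<lambda>N. sampled_objective c D a b N g) \<longlonglongrightarrow> integral {a..b} (?g Firm1) + integral {a..b} (?g Firm2)"
    unfolding sampled_objective_def by (intro tendsto_add riemann_tendsto_integral price_range)
  moreover have "integral {a..b} (?g Firm1) + integral {a..b} (?g Firm2) < 2 * \<epsilon>\<^sup>2 * H"
  proof -
    have "integral {a..b} (?g Firm1) + integral {a..b} (?g Firm2) \<le> H * (144 * \<omega> * V + 576 * W\<^sup>2 * V\<^sup>2 * (b - a) * H)"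
      using g2[of Firm1] g2[of Firm2] by (simp add: algebra_simps)
    also have "\<dots> \<le> H * \<epsilon>\<^sup>2" using small mesh_pos by (intro mult_left_mono) auto
    also have "\<dots> < 2 * \<epsilon>\<^sup>2 * H" using mesh_pos \<epsilon> by simp
    finally show ?thesis .
  qed
  ultimately have "\<forall>\<^sub>F N in sequentially. sampled_objective c D a b N g < 2 * \<epsilon>\<^sup>2 * H" by (rule order_tendstoD)
  moreover have "\<forall>\<^sub>F N in sequentially. \<forall>j\<in>{..K}. riemann a b N (spl (unit j)) < 2 * support j"
  proof (intro eventually_ball_finite ballI)
    fix j assume "j \<in> {..K}"
    then have "integral {a..b} (spl (unit j)) < 2 * support j" using integral_spl_unit[of j] support_pos[of j] by simp
    then show "\<forall>\<^sub>F N in sequentially. riemann a b N (spl (unit j)) < 2 * support j"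
      by (rule order_tendstoD[OF riemann_tendsto_integral[OF price_range continuous_on_spl]])
  qed simp
  moreover have "\<forall>\<^sub>F N in sequentially. 2 \<le> N" by (rule eventually_ge_at_top)
  ultimately show ?thesis
    using spl_sup_bound eventually_integral_foc_error[of Firm1] eventually_integral_foc_error[of Firm2]
  proof eventually_elim
    case (elim N)
    show ?case
    proof (intro allI impI ballI)
      fix r i x assume sol: "lsq_solution c D a b K \<tau> N r" and x: "x \<in> {a..b}"
      have r: "\<forall>i. cubic_spline K \<tau> (r i)" using sol by (simp add: lsq_solution_def is_arg_min_def)
      show "\<bar>foc_error c D a b r i x\<bar> \<le> Cfin * (\<omega> + \<epsilon>)"
      proof (rule foc_error_bound[OF sol elim(3) \<epsilon> _ _ _ _ x])
        show "sampled_objective c D a b N r \<le> 2 * \<epsilon>\<^sup>2 * H"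
          using sampled_objective_minimal[where g = g, OF sol g price_range elim(3)] elim(1) by linarith
        show "integral {a..b} (\<lambda>x. (foc_error c D a b r i x)\<^sup>2) \<le> 2 * riemann a b N (\<lambda>x. (foc_error c D a b r i x)\<^sup>2)" for i
          using elim(5,6) r by (cases i) auto
        show "\<forall>x\<in>{a..b}. \<bar>spl \<beta> x\<bar> \<le> 1000 * \<epsilon>'"
          if "\<forall>j\<le>K. \<bar>riemann a b N (\<lambda>x. spl \<beta> x * spl (unit j) x)\<bar> \<le> \<epsilon>' * support j" for \<beta> \<epsilon>'
          using elim(4) that by blast
        show "riemann a b N (spl (unit j)) \<le> 2 * support j" if "j \<le> K" for j
          using elim(2) that by (simp add: less_imp_le)
      qed
    qed
  qed
qed

end

section \<open>Passage to the limit\<close>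

context duopoly
begin

lemma foc_error_tendsto_0:
  assumes "0 < \<epsilon>"
  shows "\<exists>\<delta>>0. \<forall>K \<tau>. knots a b K \<tau> \<and> mesh K \<tau> < \<delta> \<longrightarrow>
    (\<exists>N0. \<forall>N\<ge>N0. \<forall>r. lsq_solution c D a b K \<tau> N r \<longrightarrow> (\<forall>i. \<forall>x\<in>{a..b}. \<bar>foc_error c D a b r i x\<bar> < \<epsilon>))"
proof -
  obtain \<Phi> :: "real \<Rightarrow> real" where \<Phi>: "\<And>x y. x \<le> y \<Longrightarrow> \<Phi> y \<le> \<Phi> x" "continuous_on UNIV \<Phi>"
    "\<And>x. \<Phi> b \<le> \<Phi> x" "\<And>x. \<Phi> x \<le> \<Phi> a"
    and unif: "\<And>\<omega>. 0 < \<omega> \<Longrightarrow> \<exists>d>0. \<forall>x y. \<bar>x - y\<bar> < d \<longrightarrow> \<bar>\<Phi> x - \<Phi> y\<bar> < \<omega>"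
    and control: "\<And>i x y. x \<in> {a..b} \<Longrightarrow> y \<in> {a..b} \<Longrightarrow> \<bar>s' i x - s' i y\<bar> \<le> \<bar>\<Phi> x - \<Phi> y\<bar>"
    using variation_control by metis
  define var where "var = \<Phi> a - \<Phi> b"
  have var: "0 \<le> var" using \<Phi>(3)[of a] by (simp add: var_def)
  have Cfin: "0 < Cfin" unfolding Cfin_def using Capx_pos W_pos price_range by (intro add_pos_nonneg) auto
  \<comment> \<open>With \<open>\<omega> \<le> \<eta>\<close> this makes the final bound at most
    \<open>\<epsilon> / 2\<close>.\<close>
  define \<eta> where "\<eta> = \<epsilon> / (4 * Cfin)"
  have \<eta>: "0 < \<eta>" using assms Cfin by (simp add: \<eta>_def)
  define \<omega> where "\<omega> = min \<eta> (\<eta>\<^sup>2 / (288 * (var + 1)))"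
  have \<omega>: "0 < \<omega>" "\<omega> \<le> \<eta>" "144 * \<omega> * var \<le> \<eta>\<^sup>2 / 2"
  proof -
    show "0 < \<omega>" "\<omega> \<le> \<eta>" using \<eta> var by (auto simp: \<omega>_def)
    have "\<omega> * (288 * (var + 1)) \<le> \<eta>\<^sup>2 / (288 * (var + 1)) * (288 * (var + 1))"
      using var by (intro mult_right_mono) (auto simp: \<omega>_def)
    also have "\<dots> = \<eta>\<^sup>2" using var by simp
    finally show "144 * \<omega> * var \<le> \<eta>\<^sup>2 / 2" using \<open>0 < \<omega>\<close> by (simp add: algebra_simps)
  qed
  obtain d where d: "d > 0" "\<And>x y. \<bar>x - y\<bar> < d \<Longrightarrow> \<bar>\<Phi> x - \<Phi> y\<bar> < \<omega>" using unif[OF \<omega>(1)] by blast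
  define Q where "Q = 576 * W\<^sup>2 * var\<^sup>2 * (b - a)"
  have Q: "0 \<le> Q" unfolding Q_def using price_range by (intro mult_nonneg_nonneg) auto
  \<comment> \<open>The window in \<open>osc_le\<close> has width four times the mesh, hence
    \<open>d / 4\<close>; the other term keeps the second half of the condition \<open>small\<close>
    below \<open>\<eta>\<^sup>2 / 2\<close>.\<close>
  define \<delta> where "\<delta> = min (d / 4) (\<eta>\<^sup>2 / (2 * (Q + 1)))"
  have \<delta>: "0 < \<delta>" using d(1) \<eta> Q by (simp add: \<delta>_def)
  have "\<exists>N0. \<forall>N\<ge>N0. \<forall>r. lsq_solution c D a b K \<tau> N r \<longrightarrow> (\<forall>i. \<forall>x\<in>{a..b}. \<bar>foc_error c D a b r i x\<bar> < \<epsilon>)"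
    if kn: "knots a b K \<tau>" and m: "mesh K \<tau> < \<delta>" for K \<tau>
  proof -
    interpret kv: knot_vector a b K \<tau> by unfold_locales (rule kn)
    have m0: "0 < mesh K \<tau>" by (rule kv.mesh_pos)
    interpret approximation c D a b s K \<tau> \<Phi> \<omega>
    proof unfold_locales
      fix x
      have "\<bar>(x - 2 * mesh K \<tau>) - (x + 2 * mesh K \<tau>)\<bar> < d" using m m0 by (simp add: \<delta>_def)
      from d(2)[OF this] show "\<Phi> (x - 2 * mesh K \<tau>) - \<Phi> (x + 2 * mesh K \<tau>) \<le> \<omega>" by linarith
    qed (use \<Phi> control in auto)
    have "Q * mesh K \<tau> \<le> \<eta>\<^sup>2 / 2"
    proof -
      have "mesh K \<tau> * (2 * (Q + 1)) \<le> \<eta>\<^sup>2 / (2 * (Q + 1)) * (2 * (Q + 1))"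
        using m Q by (intro mult_right_mono) (auto simp: \<delta>_def)
      also have "\<dots> = \<eta>\<^sup>2" using Q by simp
      finally show ?thesis using m0 by (simp add: algebra_simps)
    qed
    then have "144 * \<omega> * (\<Phi> a - \<Phi> b) + 576 * W\<^sup>2 * (\<Phi> a - \<Phi> b)\<^sup>2 * (b - a) * mesh K \<tau> \<le> \<eta>\<^sup>2"
      using \<omega>(3) unfolding var_def Q_def by linarith
    then have "\<forall>\<^sub>F N in sequentially. \<forall>r. lsq_solution c D a b K \<tau> N r \<longrightarrow>
        (\<forall>i. \<forall>x\<in>{a..b}. \<bar>foc_error c D a b r i x\<bar> \<le> Cfin * (\<omega> + \<eta>))"
      using eventually_foc_error_bound[OF \<eta>] by (simp add: V_def)
    then obtain N0 where N0: "\<And>N r i x. N0 \<le> N \<Longrightarrow> lsq_solution c D a b K \<tau> N r \<Longrightarrow> x \<in> {a..b} \<Longrightarrow>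
        \<bar>foc_error c D a b r i x\<bar> \<le> Cfin * (\<omega> + \<eta>)"
      unfolding eventually_sequentially by blast
    have "Cfin * (\<omega> + \<eta>) \<le> Cfin * (2 * \<eta>)" using \<omega>(2) Cfin by (intro mult_left_mono) auto
    also have "\<dots> < \<epsilon>" using assms Cfin by (simp add: \<eta>_def)
    finally show ?thesis using N0 by (meson le_less_trans)
  qed
  then show ?thesis using \<delta> by blast
qed

end

text \<open>The chord slope \<open>S\<close> of the convex function \<open>- D\<close> separates its
  derivatives at \<open>x\<close> and \<open>y\<close>, which are limits of difference quotients
  taken from inside the interval and so cover the end points too.\<close>

lemma concave_on_deriv_antimono:
  fixes D :: "real \<Rightarrow> real"
  assumes "concave_on {a..b} D" "C1_on {a..b} D" "x \<in> {a..b}" "y \<in> {a..b}" "x \<le> y"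
  shows "deriv_on {a..b} D y \<le> deriv_on {a..b} D x"
proof (cases "x = y")
  case False
  then have xy: "x < y" using assms(5) by simp
  have sub: "{x..y} \<subseteq> {a..b}" using assms(3,4) by auto
  define f where "f t = - D t" for t
  have conv: "convex_on {x..y} f"
    using assms(1) convex_on_subset[OF _ sub] unfolding concave_on_def f_def[abs_def] by auto
  define S where "S = (f y - f x) / (y - x)"
  have d: "(f has_real_derivative - deriv_on {a..b} D z) (at z within {x..y})" if "z \<in> {x..y}" for z
    unfolding f_def[abs_def] using DERIV_subset[OF C1_onD[OF assms(2)] sub] that sub by (auto intro!: DERIV_minus)
  have nt: "at x within {x..y} \<noteq> bot" "at y within {x..y} \<noteq> bot"
    using xy by (auto simp: trivial_limit_within islimpt_Icc)
  have "- deriv_on {a..b} D x \<le> S"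
  proof (rule tendsto_upperbound[OF _ _ nt(1)])
    show "((\<lambda>t. (f t - f x) / (t - x)) \<longlongrightarrow> - deriv_on {a..b} D x) (at x within {x..y})"
      using d[of x] xy by (simp add: has_field_derivative_iff)
    have "(f t - f x) / (t - x) \<le> S" if "t \<in> {x..y}" "t \<noteq> x" for t
      using convex_onD_Icc'[OF conv that(1)] that by (simp add: S_def divide_le_eq)
    then show "\<forall>\<^sub>F t in at x within {x..y}. (f t - f x) / (t - x) \<le> S"
      by (simp add: eventually_at_filter)
  qed
  moreover have "S \<le> - deriv_on {a..b} D y"
  proof (rule tendsto_lowerbound[OF _ _ nt(2)])
    show "((\<lambda>t. (f t - f y) / (t - y)) \<longlongrightarrow> - deriv_on {a..b} D y) (at y within {x..y})"
      using d[of y] xy by (simp add: has_field_derivative_iff)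
    have "S \<le> (f t - f y) / (t - y)" if "t \<in> {x..y}" "t \<noteq> y" for t
    proof -
      have "f t \<le> (f x - f y) / (y - x) * (y - t) + f y" by (rule convex_onD_Icc''[OF conv that(1)])
      also have "(f x - f y) / (y - x) * (y - t) = S * (t - y)" using xy by (simp add: S_def field_simps)
      finally show ?thesis using that by (simp add: le_divide_eq mult.commute)
    qed
    then show "\<forall>\<^sub>F t in at y within {x..y}. S \<le> (f t - f y) / (t - y)"
      by (simp add: eventually_at_filter)
  qed
  ultimately show ?thesis by simp
qed simp

theorem theorem2:
  fixes c :: "firm \<Rightarrow> real"
    and D :: "real \<Rightarrow> real"
    and p_a p_b :: real
    and s :: "firm \<Rightarrow> real \<Rightarrow> real"
  assumes "max (c Firm1) (c Firm2) < p_a" and "p_a < p_b"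
    and "strict_antimono_on {p_a..p_b} D"
    and "C1_on {p_a..p_b} D"
    and "concave_on {p_a..p_b} D"
    and "\<And>i. C1_on {p_a..p_b} (s i)"
    and "\<And>i p. p \<in> {p_a..p_b} \<Longrightarrow>
           deriv_on {p_a..p_b} (s (rival i)) p - s i p / (p - c i) = deriv_on {p_a..p_b} D p"
  shows "\<forall>\<epsilon>>0. \<exists>\<delta>>0. \<forall>K \<tau>. knots p_a p_b K \<tau> \<and> mesh K \<tau> < \<delta> \<longrightarrow>
           (\<exists>N0. \<forall>N\<ge>N0. \<forall>s_hat. lsq_solution c D p_a p_b K \<tau> N s_hat \<longrightarrow>
              (\<forall>i. \<forall>p\<in>{p_a..p_b}. \<bar>foc_error c D p_a p_b s_hat i p\<bar> < \<epsilon>))"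
proof -
  interpret duopoly c D p_a p_b s
  proof
    show "c i < p_a" for i using assms(1) by (cases i) auto
  qed (use assms concave_on_deriv_antimono in \<open>auto simp: foc_op_def\<close>)
  show ?thesis using foc_error_tendsto_0 by blast
qed

end
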